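(* Let $(K;S)$ be a tame metric topological dynamical system with $S$ amenable. Then the following assertions are equivalent. (i) For each operator net $(T_\alpha)_{\alpha\in A}$ which is right ergodic for $\mathcal{T}_S$ with respect to the $\sigma(\mathrm{C}(K),\ell^1(K))$-topology, each $f\in\mathrm{C}(K)$ and each $x\in K$ the limit $\lim_\alpha T_\alpha f(x)$ exists. (ii) The system $(K;S)$ is weak* mean ergodic. (iii) For each $x\in K$ the system $(\overline{Sx};S)$ contains a unique minimal set.
   Context: Compact spaces are Hausdorff; vector spaces are complex. A semitopological semigroup $S$ (separately continuous multiplication) is amenable if $\mathrm{C}_{\mathrm{b}}(S)$ (bounded continuous functions) has a two-sided invariant mean: a positive $m\in\mathrm{C}_{\mathrm{b}}(S)'$ with $m(\mathbf{1})=1$, $m(L_sf)=m(f)$ and $m(R_sf)=m(f)$ for all $f,s$, where $L_sf(t)=f(st)$, $R_sf(t)=f(ts)$. A topological dynamical system $(K;S)$ is a compact space $K$ with a semitopological semigroup $S$ acting on $K$ such that $S\times K\to K$ is continuous; it is metric if $K$ is metrizable. Koopman semigroup: $\mathcal{T}_S=\{T_s\mid s\in S\}$ on $\mathrm{C}(K)$, $T_sf(x)=f(sx)$; $\mathcal{T}_S'=\{T_s'\mid s\in S\}$ on $\mathrm{C}(K)'$. A metric system is tame if for each $f\in\mathrm{C}(K)$ the orbit $\mathcal{T}_Sf$ is relatively sequentially compact in $\mathbb{C}^K$ with the product topology (every sequence in it has a subsequence converging in $\mathbb{C}^K$). $\ell^1(K)$ is identified with the discrete measures in $\mathrm{C}(K)'$,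 so $\sigma(\mathrm{C}(K),\ell^1(K))$ is the topology given by the seminorms $f\mapsto|\sum_xa_xf(x)|$, $(a_x)\in\ell^1(K)$. For a semigroup $\mathcal{S}$ of continuous operators on a locally convex space $Y$, a net $(T_\alpha)$ in the closure of $\mathrm{co}\,\mathcal{S}$ in $Y^Y$ (product topology) is left (resp. right) ergodic for $\mathcal{S}$ if $\lim_\alpha(\mathrm{Id}-T)T_\alpha y=0$ (resp. $\lim_\alpha T_\alpha(\mathrm{Id}-T)y=0$) for each $y\in Y$, $T\in\mathcal{S}$; "with respect to a topology" means $Y$ carries that topology. $(K;S)$ is weak* mean ergodic if each left ergodic net for $\mathcal{T}_S'$ on $Y=\mathrm{C}(K)'$ with the weak* topology $\sigma(\mathrm{C}(K)',\mathrm{C}(K))$ converges pointwise on $\mathrm{C}(K)'$. A minimal set is a non-empty closed $S$-invariant subset having no closed $S$-invariant subsets other than $\emptyset$ and itself. *)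

theory Defs
  imports "HOL-Analysis.Analysis"
begin

subsection \<open>Nets\<close>

definition directed_set :: "'i set \<Rightarrow> ('i \<Rightarrow> 'i \<Rightarrow> bool) \<Rightarrow> bool" where
  "directed_set A le \<longleftrightarrow> A \<noteq> {} \<and> reflp_on A le \<and> transp_on A le \<and>
     (\<forall>a\<in>A. \<forall>b\<in>A. \<exists>c\<in>A. le a c \<and> le b c)"

text \<open>The filter of tails: a limit of a net over \<open>(A, le)\<close> is a limit along this filter.\<close>

definition net_filter :: "'i set \<Rightarrow> ('i \<Rightarrow> 'i \<Rightarrow> bool) \<Rightarrow> 'i filter" where
  "net_filter A le = (INF a\<in>A. principal {b \<in> A. le a b})"

lemma eventually_net_filter:
  assumes "directed_set A le"
  shows "eventually P (net_filter A le) \<longleftrightarrow> (\<exists>a\<in>A. \<forall>b\<in>A. le a b \<longrightarrow> P b)"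
proof -
  have "eventually P (net_filter A le) \<longleftrightarrow> (\<exists>a\<in>A. eventually P (principal {b \<in> A. le a b}))"
    unfolding net_filter_def
  proof (rule eventually_INF_base)
    show "A \<noteq> {}" using assms by (simp add: directed_set_def)
    fix a b assume ab: "a \<in> A" "b \<in> A"
    then obtain c where c: "c \<in> A" "le a c" "le b c"
      using assms by (auto simp: directed_set_def)
    have "le a d \<and> le b d" if "d \<in> A" "le c d" for d
      using assms ab c that by (meson directed_set_def transp_onD)
    then show "\<exists>x\<in>A. principal {b \<in> A. le x b}
        \<le> inf (principal {b \<in> A. le a b}) (principal {ba \<in> A. le b ba})"
      using c by auto
  qed
  then show ?thesis by (auto simp: eventually_principal)
qed

text \<open>
  One cannot quantify over all index types inside a formula. Nets with values in \<open>'x\<close> are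
  therefore quantified over all directed sets in the single type \<open>'x net_index\<close>. No net is lost:
  by \<open>net_reindex\<close>, every net over an arbitrary index type has the same tails, hence the same
  convergence behaviour, as one indexed by \<open>'x net_index\<close>.
\<close>

type_synonym 'x net_index = "'x set \<times> 'x"

lemma net_reindex:
  fixes A :: "'i set" and T :: "'i \<Rightarrow> 'x"
  assumes A: "directed_set A le"
  obtains B :: "'x net_index set" and le' T'
  where "directed_set B le'" "T' ` B \<subseteq> T ` A"
    "filtermap T' (net_filter B le') = filtermap T (net_filter A le)"
proof -
  define F where "F = net_filter A le"
  define B where "B = {(U, t). eventually (\<lambda>a. T a \<in> U) F \<and> t \<in> U \<and> t \<in> T ` A}"
  define le' where "le' = (\<lambda>(U :: 'x set, t :: 'x) (V, u :: 'x). V \<subseteq> U)"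
  have ev: "eventually P F \<longleftrightarrow> (\<exists>a\<in>A. \<forall>b\<in>A. le a b \<longrightarrow> P b)" for P
    unfolding F_def by (rule eventually_net_filter[OF A])
  have evA: "eventually (\<lambda>a. a \<in> A) F"
    using A by (auto simp: ev directed_set_def)
  have inB: "\<exists>t. (U, t) \<in> B" if "eventually (\<lambda>a. T a \<in> U) F" for U
  proof -
    from that obtain a where a: "a \<in> A" "\<forall>b\<in>A. le a b \<longrightarrow> T b \<in> U"
      by (auto simp: ev)
    moreover have "le a a" using A a by (auto simp: directed_set_def reflp_on_def)
    ultimately have "(U, T a) \<in> B" using that by (auto simp: B_def)
    then show ?thesis ..
  qed
  have B: "directed_set B le'"
    unfolding directed_set_def
  proof (intro conjI)
    show "B \<noteq> {}" using inB[of UNIV] by auto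
    show "reflp_on B le'" by (auto simp: reflp_on_def le'_def)
    show "transp_on B le'" by (auto simp: transp_on_def le'_def)
    show "\<forall>a\<in>B. \<forall>b\<in>B. \<exists>c\<in>B. le' a c \<and> le' b c"
    proof (intro ballI)
      fix a b assume ab: "a \<in> B" "b \<in> B"
      then have "eventually (\<lambda>i. T i \<in> fst a \<inter> fst b) F"
        by (auto simp: B_def intro: eventually_conj)
      from inB[OF this] obtain t where "(fst a \<inter> fst b, t) \<in> B" ..
      then show "\<exists>c\<in>B. le' a c \<and> le' b c"
        by (intro bexI[of _ "(fst a \<inter> fst b, t)"]) (auto simp: le'_def)
    qed
  qed
  have "eventually P (filtermap snd (net_filter B le')) \<longleftrightarrow> eventually P (filtermap T F)" for P
  proof -
    have "(\<exists>a\<in>B. \<forall>b\<in>B. le' a b \<longrightarrow> P (snd b)) \<longleftrightarrow> eventually (\<lambda>a. P (T a)) F"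
    proof
      assume "\<exists>a\<in>B. \<forall>b\<in>B. le' a b \<longrightarrow> P (snd b)"
      then obtain U t where U: "(U, t) \<in> B" "\<And>b. b \<in> B \<Longrightarrow> le' (U, t) b \<Longrightarrow> P (snd b)" by auto
      then have "eventually (\<lambda>a. T a \<in> U) F" by (auto simp: B_def)
      with evA show "eventually (\<lambda>a. P (T a)) F"
      proof eventually_elim
        case (elim a)
        then have "(U, T a) \<in> B" using U(1) by (auto simp: B_def)
        from U(2)[OF this] show ?case by (auto simp: le'_def)
      qed
    next
      assume "eventually (\<lambda>a. P (T a)) F"
      then have "eventually (\<lambda>a. T a \<in> Collect P) F" by simp
      from inB[OF this] obtain t where "(Collect P, t) \<in> B" ..
      then show "\<exists>a\<in>B. \<forall>b\<in>B. le' a b \<longrightarrow> P (snd b)"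
        by (rule bexI[rotated]) (auto simp: le'_def B_def)
    qed
    then show ?thesis by (simp add: eventually_filtermap eventually_net_filter[OF B])
  qed
  then have "filtermap snd (net_filter B le') = filtermap T (net_filter A le)"
    unfolding F_def by (simp add: filter_eq_iff)
  moreover have "snd ` B \<subseteq> T ` A" by (auto simp: B_def)
  ultimately show ?thesis by (rule that[OF B, rotated])
qed

lemma limitin_filtermap: "limitin X f l (filtermap g F) \<longleftrightarrow> limitin X (\<lambda>x. f (g x)) l F"
  by (simp add: limitin_def eventually_filtermap)


subsection \<open>Locally convex topologies and ergodic nets\<close>

text \<open>
  The topology on the subspace \<open>Y\<close> given by a family \<open>P\<close> of seminorms. A locally convex space is
  represented by a topology whose \<open>topspace\<close> is a subspace of the ambient vector space.
\<close>

definition seminorm_topology :: "'y::real_vector set \<Rightarrow> ('y \<Rightarrow> real) set \<Rightarrow> 'y topology" where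
  "seminorm_topology Y P =
     topology_generated_by {{y \<in> Y. p (y - y0) < e} |p y0 e. p \<in> P \<and> y0 \<in> Y \<and> e > 0}"

text \<open>
  \<open>Y\<^sup>Y\<close> with the product topology, for \<open>Y = topspace \<tau>\<close>. As everywhere in the library, the points
  of this product are the functions \<open>Y \<rightarrow> Y\<close> that are \<open>undefined\<close> outside \<open>Y\<close>; this is why
  operators are restricted to \<open>Y\<close> below.
\<close>

definition self_power :: "'y topology \<Rightarrow> ('y \<Rightarrow> 'y) topology" where
  "self_power \<tau> = product_topology (\<lambda>_. \<tau>) (topspace \<tau>)"

definition operator_hull :: "'y::real_vector set \<Rightarrow> ('y \<Rightarrow> 'y) set \<Rightarrow> ('y \<Rightarrow> 'y) set" where
  "operator_hull Y \<S> =
     {restrict (\<lambda>y. \<Sum>T\<in>F. c T *\<^sub>R T y) Y |F c.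
        finite F \<and> F \<subseteq> \<S> \<and> (\<forall>T\<in>F. 0 \<le> c T) \<and> sum c F = 1}"

definition operator_net ::
  "'y::real_vector topology \<Rightarrow> ('y \<Rightarrow> 'y) set \<Rightarrow> 'i set \<Rightarrow> ('i \<Rightarrow> 'i \<Rightarrow> bool) \<Rightarrow>
     ('i \<Rightarrow> 'y \<Rightarrow> 'y) \<Rightarrow> bool" where
  "operator_net \<tau> \<S> A le T \<longleftrightarrow> directed_set A le \<and>
     T ` A \<subseteq> self_power \<tau> closure_of operator_hull (topspace \<tau>) \<S>"

definition left_ergodic_net ::
  "'y::real_vector topology \<Rightarrow> ('y \<Rightarrow> 'y) set \<Rightarrow> 'i set \<Rightarrow> ('i \<Rightarrow> 'i \<Rightarrow> bool) \<Rightarrow>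
     ('i \<Rightarrow> 'y \<Rightarrow> 'y) \<Rightarrow> bool" where
  "left_ergodic_net \<tau> \<S> A le T \<longleftrightarrow> operator_net \<tau> \<S> A le T \<and>
     (\<forall>R\<in>\<S>. \<forall>y\<in>topspace \<tau>. limitin \<tau> (\<lambda>\<alpha>. T \<alpha> y - R (T \<alpha> y)) 0 (net_filter A le))"

definition right_ergodic_net ::
  "'y::real_vector topology \<Rightarrow> ('y \<Rightarrow> 'y) set \<Rightarrow> 'i set \<Rightarrow> ('i \<Rightarrow> 'i \<Rightarrow> bool) \<Rightarrow>
     ('i \<Rightarrow> 'y \<Rightarrow> 'y) \<Rightarrow> bool" where
  "right_ergodic_net \<tau> \<S> A le T \<longleftrightarrow> operator_net \<tau> \<S> A le T \<and>
     (\<forall>R\<in>\<S>. \<forall>y\<in>topspace \<tau>. limitin \<tau> (\<lambda>\<alpha>. T \<alpha> (y - R y)) 0 (net_filter A le))"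

lemma left_ergodic_net_reindex:
  fixes A :: "'i set" and T :: "'i \<Rightarrow> 'y::real_vector \<Rightarrow> 'y"
  assumes "left_ergodic_net \<tau> \<S> A le T"
  obtains B :: "('y \<Rightarrow> 'y) net_index set" and le' T'
  where "left_ergodic_net \<tau> \<S> B le' T'"
    "filtermap T' (net_filter B le') = filtermap T (net_filter A le)"
proof -
  have "directed_set A le" using assms by (simp add: left_ergodic_net_def operator_net_def)
  then obtain B :: "('y \<Rightarrow> 'y) net_index set" and le' T' where
    B: "directed_set B le'" "T' ` B \<subseteq> T ` A"
       "filtermap T' (net_filter B le') = filtermap T (net_filter A le)"
    by (rule net_reindex)
  have "limitin \<tau> (\<lambda>\<alpha>. T' \<alpha> y - R (T' \<alpha> y)) 0 (net_filter B le')"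
    if R: "R \<in> \<S>" "y \<in> topspace \<tau>" for R y
  proof -
    have "limitin \<tau> (\<lambda>t. t y - R (t y)) 0 (filtermap T (net_filter A le))"
      using assms R by (simp add: left_ergodic_net_def limitin_filtermap)
    then show ?thesis
      unfolding B(3)[symmetric] limitin_filtermap .
  qed
  moreover have "T' ` B \<subseteq> self_power \<tau> closure_of operator_hull (topspace \<tau>) \<S>"
    using assms B(2) by (auto simp: left_ergodic_net_def operator_net_def)
  ultimately have "left_ergodic_net \<tau> \<S> B le' T'"
    using B(1) by (simp add: left_ergodic_net_def operator_net_def)
  from this B(3) show ?thesis by (rule that)
qed

lemma right_ergodic_net_reindex:
  fixes A :: "'i set" and T :: "'i \<Rightarrow> 'y::real_vector \<Rightarrow> 'y"
  assumes "right_ergodic_net \<tau> \<S> A le T"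
  obtains B :: "('y \<Rightarrow> 'y) net_index set" and le' T'
  where "right_ergodic_net \<tau> \<S> B le' T'"
    "filtermap T' (net_filter B le') = filtermap T (net_filter A le)"
proof -
  have "directed_set A le" using assms by (simp add: right_ergodic_net_def operator_net_def)
  then obtain B :: "('y \<Rightarrow> 'y) net_index set" and le' T' where
    B: "directed_set B le'" "T' ` B \<subseteq> T ` A"
       "filtermap T' (net_filter B le') = filtermap T (net_filter A le)"
    by (rule net_reindex)
  have "limitin \<tau> (\<lambda>\<alpha>. T' \<alpha> (y - R y)) 0 (net_filter B le')"
    if R: "R \<in> \<S>" "y \<in> topspace \<tau>" for R y
  proof -
    have "limitin \<tau> (\<lambda>t. t (y - R y)) 0 (filtermap T (net_filter A le))"
      using assms R by (simp add: right_ergodic_net_def limitin_filtermap)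
    then show ?thesis
      unfolding B(3)[symmetric] limitin_filtermap .
  qed
  moreover have "T' ` B \<subseteq> self_power \<tau> closure_of operator_hull (topspace \<tau>) \<S>"
    using assms B(2) by (auto simp: right_ergodic_net_def operator_net_def)
  ultimately have "right_ergodic_net \<tau> \<S> B le' T'"
    using B(1) by (simp add: right_ergodic_net_def operator_net_def)
  from this B(3) show ?thesis by (rule that)
qed


subsection \<open>Spaces of continuous functions and their duals\<close>

text \<open>
  \<open>'a \<Rightarrow>\<^sub>C complex\<close> is \<open>C\<^sub>b\<close> of the space \<open>'a\<close>, and \<open>C(K)\<close> if \<open>'a\<close> is compact. The library only
  provides its real vector space structure.
\<close>

definition scaleC_bcontfun ::
  "complex \<Rightarrow> ('a::topological_space \<Rightarrow>\<^sub>C complex) \<Rightarrow> ('a \<Rightarrow>\<^sub>C complex)" where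
  "scaleC_bcontfun c f = Bcontfun (\<lambda>x. c * apply_bcontfun f x)"

lemma apply_scaleC_bcontfun: "apply_bcontfun (scaleC_bcontfun c f) x = c * apply_bcontfun f x"
proof -
  have "continuous_on UNIV (\<lambda>x. c * apply_bcontfun f x)"
    by (intro continuous_intros continuous_on_apply_bcontfun)
  moreover have "norm (c * apply_bcontfun f x) \<le> norm c * norm f" for x
    by (simp add: norm_mult mult_left_mono norm_bounded)
  ultimately have "(\<lambda>x. c * apply_bcontfun f x) \<in> bcontfun"
    by (rule bcontfun_normI)
  then show ?thesis by (simp add: scaleC_bcontfun_def Bcontfun_inverse)
qed

definition cdual :: "(('a::topological_space \<Rightarrow>\<^sub>C complex) \<Rightarrow>\<^sub>L complex) set" where
  "cdual = {\<phi>. \<forall>c f. blinfun_apply \<phi> (scaleC_bcontfun c f) = c * blinfun_apply \<phi> f}"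

text \<open>\<open>f \<mapsto> f \<circ> h\<close>, meaningful for continuous \<open>h\<close>.\<close>

definition precomp ::
  "('a \<Rightarrow> 'b) \<Rightarrow> ('b::topological_space \<Rightarrow>\<^sub>C complex) \<Rightarrow> ('a::topological_space \<Rightarrow>\<^sub>C complex)" where
  "precomp h f = Bcontfun (\<lambda>x. apply_bcontfun f (h x))"

lemma apply_precomp:
  assumes "continuous_on UNIV h"
  shows "apply_bcontfun (precomp h f) x = apply_bcontfun f (h x)"
proof -
  have "continuous_on UNIV (\<lambda>x. apply_bcontfun f (h x))"
    by (rule continuous_on_compose2[OF continuous_on_apply_bcontfun assms]) auto
  moreover have "norm (apply_bcontfun f (h x)) \<le> norm f" for x
    by (rule norm_bounded)
  ultimately have "(\<lambda>x. apply_bcontfun f (h x)) \<in> bcontfun"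
    by (rule bcontfun_normI)
  then show ?thesis by (simp add: precomp_def Bcontfun_inverse)
qed

lemma bounded_linear_precomp:
  assumes "continuous_on UNIV h"
  shows "bounded_linear (precomp h)"
proof (rule bounded_linear_intro[of _ 1])
  show "norm (precomp h f) \<le> norm f * 1" for f
    by (simp add: norm_bound apply_precomp[OF assms] norm_bounded)
qed (auto intro!: bcontfun_eqI simp: apply_precomp[OF assms])


subsection \<open>Amenable semitopological semigroups\<close>

definition semitopological_semigroup :: "'s::{semigroup_mult,topological_space} itself \<Rightarrow> bool" where
  "semitopological_semigroup _ \<longleftrightarrow>
     (\<forall>s::'s. continuous_on UNIV (\<lambda>t. s * t) \<and> continuous_on UNIV (\<lambda>t. t * s))"

definition invariant_mean ::
  "(('s::{semigroup_mult,topological_space} \<Rightarrow>\<^sub>C complex) \<Rightarrow>\<^sub>L complex) \<Rightarrow> bool" where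
  "invariant_mean m \<longleftrightarrow> m \<in> cdual \<and>
     (\<forall>f. (\<forall>t. apply_bcontfun f t \<in> \<real>\<^sub>\<ge>\<^sub>0) \<longrightarrow> blinfun_apply m f \<in> \<real>\<^sub>\<ge>\<^sub>0) \<and>
     blinfun_apply m (const_bcontfun 1) = 1 \<and>
     (\<forall>s f. blinfun_apply m (precomp (\<lambda>t. s * t) f) = blinfun_apply m f) \<and>
     (\<forall>s f. blinfun_apply m (precomp (\<lambda>t. t * s) f) = blinfun_apply m f)"

definition amenable :: "'s::{semigroup_mult,topological_space} itself \<Rightarrow> bool" where
  "amenable _ \<longleftrightarrow> (\<exists>m :: ('s \<Rightarrow>\<^sub>C complex) \<Rightarrow>\<^sub>L complex. invariant_mean m)"


subsection \<open>Topological dynamical systems\<close>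

definition dynamical_system ::
  "('s::{semigroup_mult,topological_space} \<Rightarrow> 'k::t2_space \<Rightarrow> 'k) \<Rightarrow> bool" where
  "dynamical_system act \<longleftrightarrow> compact (UNIV :: 'k set) \<and> semitopological_semigroup TYPE('s) \<and>
     (\<forall>s t x. act (s * t) x = act s (act t x)) \<and>
     continuous_on UNIV (\<lambda>(s, x). act s x)"

definition metric_system ::
  "('s::{semigroup_mult,topological_space} \<Rightarrow> 'k::t2_space \<Rightarrow> 'k) \<Rightarrow> bool" where
  "metric_system act \<longleftrightarrow> dynamical_system act \<and> metrizable_space (euclidean :: 'k topology)"

definition koopman :: "('s \<Rightarrow> 'k \<Rightarrow> 'k) \<Rightarrow> 's \<Rightarrow> ('k::t2_space \<Rightarrow>\<^sub>C complex) \<Rightarrow> ('k \<Rightarrow>\<^sub>C complex)" where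
  "koopman act s = precomp (act s)"

definition koopman_adjoint ::
  "('s \<Rightarrow> 'k \<Rightarrow> 'k) \<Rightarrow> 's \<Rightarrow> (('k::t2_space \<Rightarrow>\<^sub>C complex) \<Rightarrow>\<^sub>L complex) \<Rightarrow>
     (('k \<Rightarrow>\<^sub>C complex) \<Rightarrow>\<^sub>L complex)" where
  "koopman_adjoint act s \<phi> = Blinfun (\<lambda>f. blinfun_apply \<phi> (koopman act s f))"

lemma continuous_on_act:
  assumes "dynamical_system act"
  shows "continuous_on UNIV (act s)"
proof -
  have "continuous_on UNIV (\<lambda>(s, x). act s x)" using assms by (simp add: dynamical_system_def)
  from continuous_on_compose2[OF this, of UNIV "\<lambda>x. (s, x)"] show ?thesis
    by (simp add: continuous_on_Pair)
qed

lemma apply_koopman: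
  assumes "dynamical_system act"
  shows "apply_bcontfun (koopman act s f) x = apply_bcontfun f (act s x)"
  unfolding koopman_def by (rule apply_precomp[OF continuous_on_act[OF assms]])

lemma apply_koopman_adjoint:
  assumes "dynamical_system act"
  shows "blinfun_apply (koopman_adjoint act s \<phi>) f = blinfun_apply \<phi> (koopman act s f)"
proof -
  have "bounded_linear (koopman act s)"
    unfolding koopman_def by (rule bounded_linear_precomp[OF continuous_on_act[OF assms]])
  then have "bounded_linear (\<lambda>f. blinfun_apply \<phi> (koopman act s f))"
    by (rule bounded_linear_compose[OF blinfun.bounded_linear_right])
  then show ?thesis unfolding koopman_adjoint_def by (simp add: bounded_linear_Blinfun_apply)
qed

lemma koopman_adjoint_cdual:
  assumes "dynamical_system act" "\<phi> \<in> cdual"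
  shows "koopman_adjoint act s \<phi> \<in> cdual"
proof -
  have "koopman act s (scaleC_bcontfun c f) = scaleC_bcontfun c (koopman act s f)" for c f
    by (rule bcontfun_eqI) (simp add: apply_koopman[OF assms(1)] apply_scaleC_bcontfun)
  then show ?thesis
    using assms by (simp add: cdual_def apply_koopman_adjoint)
qed

text \<open>Convergence of functions \<open>'k \<Rightarrow> complex\<close> is convergence in the product topology.\<close>

definition rel_seq_compact :: "'a::topological_space set \<Rightarrow> bool" where
  "rel_seq_compact M \<longleftrightarrow>
     (\<forall>X :: nat \<Rightarrow> 'a. range X \<subseteq> M \<longrightarrow> (\<exists>r l. strict_mono r \<and> (X \<circ> r) \<longlonglongrightarrow> l))"

definition tame :: "('s \<Rightarrow> 'k::t2_space \<Rightarrow> 'k) \<Rightarrow> bool" where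
  "tame act \<longleftrightarrow>
     (\<forall>f :: 'k \<Rightarrow>\<^sub>C complex. rel_seq_compact (range (\<lambda>s. apply_bcontfun (koopman act s f))))"

definition sigma_l1 :: "('k::t2_space \<Rightarrow>\<^sub>C complex) topology" where
  "sigma_l1 = seminorm_topology UNIV
     {\<lambda>f. norm (\<Sum>\<^sub>\<infinity>x. a x * apply_bcontfun f x) |a :: 'k \<Rightarrow> complex.
       (\<lambda>x. norm (a x)) summable_on UNIV}"

definition weak_star :: "(('k::t2_space \<Rightarrow>\<^sub>C complex) \<Rightarrow>\<^sub>L complex) topology" where
  "weak_star = seminorm_topology cdual (range (\<lambda>f \<phi>. norm (blinfun_apply \<phi> f)))"

lemma topspace_seminorm_topology:
  assumes "p \<in> P" "p 0 = 0"
  shows "topspace (seminorm_topology Y P) = Y"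
proof -
  have "y \<in> \<Union>{{y \<in> Y. p (y - y0) < e} |p y0 e. p \<in> P \<and> y0 \<in> Y \<and> e > 0}" if "y \<in> Y" for y
  proof (rule UnionI)
    show "{z \<in> Y. p (z - y) < 1} \<in> {{y \<in> Y. p (y - y0) < e} |p y0 e. p \<in> P \<and> y0 \<in> Y \<and> e > 0}"
      using assms(1) that zero_less_one by blast
    show "y \<in> {z \<in> Y. p (z - y) < 1}" using assms(2) that by simp
  qed
  then show ?thesis
    unfolding seminorm_topology_def topology_generated_by_topspace by blast
qed

lemma topspace_sigma_l1: "topspace sigma_l1 = UNIV"
proof -
  let ?p = "\<lambda>a f. norm (\<Sum>\<^sub>\<infinity>x. a x * apply_bcontfun f x)"
  have "?p (\<lambda>_. 0) \<in> {?p a |a :: 'a \<Rightarrow> complex. (\<lambda>x. norm (a x)) summable_on UNIV}"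
    unfolding mem_Collect_eq by (rule exI[of _ "\<lambda>_. 0"]) simp
  then show ?thesis
    unfolding sigma_l1_def by (rule topspace_seminorm_topology) simp
qed

lemma topspace_weak_star: "topspace weak_star = cdual"
  unfolding weak_star_def
  by (rule topspace_seminorm_topology[OF rangeI[of _ 0]]) simp

definition weak_star_mean_ergodic :: "('s \<Rightarrow> 'k::t2_space \<Rightarrow> 'k) \<Rightarrow> bool" where
  "weak_star_mean_ergodic act \<longleftrightarrow>
     (\<forall>(A :: ((('k \<Rightarrow>\<^sub>C complex) \<Rightarrow>\<^sub>L complex) \<Rightarrow> (('k \<Rightarrow>\<^sub>C complex) \<Rightarrow>\<^sub>L complex)) net_index set) le T.
        left_ergodic_net weak_star (range (koopman_adjoint act)) A le T \<longrightarrow>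
        (\<forall>\<phi>\<in>cdual. \<exists>\<psi>. limitin weak_star (\<lambda>\<alpha>. T \<alpha> \<phi>) \<psi> (net_filter A le)))"

definition invariant_set :: "('s \<Rightarrow> 'k \<Rightarrow> 'k) \<Rightarrow> 'k set \<Rightarrow> bool" where
  "invariant_set act M \<longleftrightarrow> (\<forall>s. act s ` M \<subseteq> M)"

definition minimal_set :: "('s \<Rightarrow> 'k::t2_space \<Rightarrow> 'k) \<Rightarrow> 'k set \<Rightarrow> bool" where
  "minimal_set act M \<longleftrightarrow> M \<noteq> {} \<and> closed M \<and> invariant_set act M \<and>
     (\<forall>N. N \<subseteq> M \<and> closed N \<and> invariant_set act N \<longrightarrow> N = {} \<or> N = M)"

end

theory Submission
  imports Defs
begin

text \<open>
  Everything is reduced to finite means on \<open>S\<close>, that is, to finite convex combinations of point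
  evaluations, and to the averages \<open>L(s \<mapsto> f(s x))\<close> which they define. An operator in the closed
  convex hull of the translations can be replaced by a finite mean as long as only finitely many
  tests are considered, so an ergodic net gives, through compactness, an ultrafilter of finite
  means along which averaging becomes invariant. Conversely, such an ultrafilter is the tail filter
  of an ergodic net. Finite measures appear as positive functionals on the real continuous
  functions; the only fact of integration theory that is needed is bounded convergence, which
  follows from Dini's theorem.

  Suppose that the closure of every orbit contains only one minimal set. The core of the proof is
  that the closure of \<open>S x\<close> then carries only one normalised invariant functional
  (\<open>invariant_functional_unique\<close>). By tameness and bounded convergence, the translates of \<open>f\<close> are
  precompact for each seminorm \<open>\<mu>(\<bar>\<cdot>\<bar>)\<close>, and so are their averages. Hence the averages of \<open>f\<close>
  contain no independent sequence: for a suitable \<open>\<mu>\<close>, a limit of uniform distributions on finite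
  trees of points, such a sequence would stay separated (\<open>no_independence\<close>). One consequence is
  that the mean of \<open>f\<close> along the orbit of \<open>y\<close> is the same for all \<open>y\<close> in a minimal set: the sets of
  points with two different means would both be dense, and this produces independence. Moreover,
  elements of the enveloping semigroup move finitely many points of the orbit closure into the
  minimal set, so averages of \<open>f\<close> come close to this constant on every finite set. An
  invariant functional takes one and the same value at all averages of \<open>f\<close>. If this value were not
  the constant, the difference between the behaviour at single points and the behaviour in the mean
  would again produce independence.

  Uniqueness of the invariant functional gives the convergence of right ergodic nets at each point
  at once. For a left ergodic net and an arbitrary \<open>\<phi>\<close> in the dual space, one extracts sequences of
  averages which are asymptotically invariant almost everywhere for a positive functional that
  dominates \<open>\<phi>\<close>. By the first part they converge almost everywhere to a limit that does not depend
  on the choices (\<open>asymptotic_limit_unique\<close>).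

  For the converse directions, let the closure of \<open>S x\<close> contain two minimal sets. Translating \<open>x\<close>
  towards a point of one of them before averaging gives an ergodic family whose limit at \<open>x\<close> is
  supported by that set. Joining the two families gives an ergodic net without limit.
\<close>

section \<open>Ultrafilters\<close>

definition ultrafilter :: "'a filter \<Rightarrow> bool" where
  "ultrafilter U \<longleftrightarrow> U \<noteq> bot \<and> (\<forall>P. eventually P U \<or> eventually (\<lambda>x. \<not> P x) U)"

text \<open>
  Zorn's lemma for the proper filters below \<open>F\<close>: the infimum of a chain of proper filters is proper,
  because what holds eventually along it holds eventually along a member.
\<close>

lemma ultrafilter_ex:
  assumes "F \<noteq> bot"
  obtains U where "U \<le> F" "ultrafilter U"
proof -
  define A where "A = {G. G \<le> F \<and> G \<noteq> bot}"
  have "\<exists>U\<in>A. \<forall>G\<in>A. G \<le> U \<longrightarrow> G = U"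
  proof (rule predicate_Zorn[of A "\<lambda>x y. y \<le> x", simplified])
    show "partial_order_on A (relation_of (\<lambda>x y. y \<le> x) A)"
      by (rule partial_order_on_relation_ofI) auto
    fix C assume "C \<in> Chains (relation_of (\<lambda>x y. y \<le> x) A)"
    then have CA: "C \<subseteq> A" and ch: "\<And>G H. G \<in> C \<Longrightarrow> H \<in> C \<Longrightarrow> G \<le> H \<or> H \<le> G"
      by (auto simp: Chains_def relation_of_def)
    show "\<exists>u\<in>A. \<forall>a\<in>C. u \<le> a"
    proof (cases "C = {}")
      case True
      then show ?thesis using assms by (auto simp: A_def)
    next
      case False
      have "eventually P (Inf C) \<longleftrightarrow> (\<exists>b\<in>C. eventually P b)" for P
        by (rule eventually_Inf_base[OF False]) (use ch in \<open>fastforce simp: inf_absorb1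
            inf_absorb2\<close>)
      then have "Inf C \<noteq> bot" using CA by (auto simp: trivial_limit_def A_def)
      moreover have "Inf C \<le> F" using False CA
        by (metis (mono_tags, lifting) A_def Inf_lower2 all_not_in_conv mem_Collect_eq subsetD)
      ultimately show ?thesis by (intro bexI[of _ "Inf C"]) (auto simp: A_def Inf_lower)
    qed
  qed
  then obtain U where U: "U \<le> F" "U \<noteq> bot" and
    max: "\<And>G. G \<le> F \<Longrightarrow> G \<noteq> bot \<Longrightarrow> G \<le> U \<Longrightarrow> G = U"
    by (auto simp: A_def)
  have "eventually P U \<or> eventually (\<lambda>x. \<not> P x) U" for P
  proof (rule disjCI)
    assume "\<not> eventually (\<lambda>x. \<not> P x) U"
    then have "inf U (principal {x. P x}) \<noteq> bot"
      by (simp add: trivial_limit_def eventually_inf_principal)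
    then have "inf U (principal {x. P x}) = U"
      using U(1) by (intro max) (auto intro: le_infI1)
    moreover have "eventually P (inf U (principal {x. P x}))"
      by (simp add: eventually_inf_principal)
    ultimately show "eventually P U" by simp
  qed
  with U show ?thesis by (intro that) (auto simp: ultrafilter_def)
qed

lemma ultrafilter_convergent:
  fixes g :: "'a \<Rightarrow> 'b::heine_borel"
  assumes U: "ultrafilter U" and B: "eventually (\<lambda>i. dist a (g i) \<le> B) U"
  obtains l where "(g \<longlongrightarrow> l) U"
proof -
  have "eventually (\<lambda>y. y \<in> cball a B) (filtermap g U)"
    using B by (simp add: eventually_filtermap)
  moreover have "filtermap g U \<noteq> bot" using U by (simp add: ultrafilter_def filtermap_bot_iff)
  ultimately obtain l where l: "inf (nhds l) (filtermap g U) \<noteq> bot"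
    using compact_cball[of a B] unfolding compact_filter by blast
  have "(g \<longlongrightarrow> l) U"
  proof (rule topological_tendstoI)
    fix S assume S: "open S" "l \<in> S"
    show "eventually (\<lambda>x. g x \<in> S) U"
    proof (rule ccontr)
      assume "\<not> eventually (\<lambda>x. g x \<in> S) U"
      then have "eventually (\<lambda>x. g x \<notin> S) U" using U by (auto simp: ultrafilter_def)
      then have "eventually (\<lambda>y. y \<notin> S) (inf (nhds l) (filtermap g U))"
        by (intro filter_leD[OF inf_le2]) (simp add: eventually_filtermap)
      moreover have "eventually (\<lambda>y. y \<in> S) (inf (nhds l) (filtermap g U))"
        using S by (intro filter_leD[OF inf_le1] eventually_nhds_in_open)
      ultimately have "eventually (\<lambda>y. False) (inf (nhds l) (filtermap g U))"
        by eventually_elim auto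
      then show False using l by (simp add: trivial_limit_def)
    qed
  qed
  then show ?thesis by (rule that)
qed

text \<open>
  Ultrafilters replace subnets: a limit exists as soon as it is the only possible limit along finer
  ultrafilters.
\<close>

lemma tendsto_by_ultrafilter:
  assumes "\<And>U. U \<le> F \<Longrightarrow> ultrafilter U \<Longrightarrow> (g \<longlongrightarrow> l) U"
  shows "(g \<longlongrightarrow> l) F"
proof (rule topological_tendstoI, rule ccontr)
  fix S assume S: "open S" "l \<in> S" "\<not> eventually (\<lambda>x. g x \<in> S) F"
  then have "inf F (principal {x. g x \<notin> S}) \<noteq> bot"
    by (simp add: trivial_limit_def eventually_inf_principal)
  then obtain U where U: "U \<le> inf F (principal {x. g x \<notin> S})" "ultrafilter U"
    by (rule ultrafilter_ex)
  then have "(g \<longlongrightarrow> l) U" by (intro assms) auto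
  then have "eventually (\<lambda>x. g x \<in> S) U" using S by (auto dest: topological_tendstoD)
  moreover have "eventually (\<lambda>x. g x \<notin> S) U"
    using U(1) by (simp add: le_principal)
  ultimately have "eventually (\<lambda>x. False) U" by eventually_elim auto
  then show False using U(2) by (simp add: ultrafilter_def trivial_limit_def)
qed

text \<open>
  The compactness principle behind all limits below. Target values that can be approximated on
  each finite set of tests are limits, for all tests simultaneously, along one ultrafilter. The
  approximating objects need no topology.
\<close>

lemma finite_approx_ultrafilter:
  fixes \<tau> :: "'j \<Rightarrow> 'p \<Rightarrow> 'm::metric_space"
  assumes "\<And>J e. finite J \<Longrightarrow> J \<subseteq> I \<Longrightarrow> e > 0 \<Longrightarrow> \<exists>p\<in>P. \<forall>j\<in>J. dist (\<tau> j p) (l j) < e"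
  obtains V where "ultrafilter V" "eventually (\<lambda>p. p \<in> P) V" "\<And>j. j \<in> I \<Longrightarrow> (\<tau> j \<longlongrightarrow> l j) V"
proof -
  define D where "D = (\<lambda>(J, e). {p \<in> P. \<forall>j\<in>J. dist (\<tau> j p) (l j) < (e::real)})"
  define N where "N = {(J, e). finite J \<and> J \<subseteq> I \<and> e > (0::real)}"
  define F where "F = (INF n\<in>N. principal (D n))"
  have ev: "eventually Q F \<longleftrightarrow> (\<exists>n\<in>N. eventually Q (principal (D n)))" for Q
    unfolding F_def
  proof (rule eventually_INF_base)
    show "N \<noteq> {}" unfolding N_def by (auto intro!: exI[of _ "{}"] exI[of _ 1])
    fix a b assume "a \<in> N" "b \<in> N"
    then show "\<exists>x\<in>N. principal (D x) \<le> inf (principal (D a)) (principal (D b))"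
      by (intro bexI[of _ "(fst a \<union> fst b, min (snd a) (snd b))"]) (auto simp: N_def D_def)
  qed
  have "F \<noteq> bot"
    unfolding trivial_limit_def ev eventually_principal
    using assms by (fastforce simp: N_def D_def)
  then obtain V where V: "V \<le> F" "ultrafilter V" by (rule ultrafilter_ex)
  have "eventually (\<lambda>p. p \<in> P) F"
    unfolding ev by (rule bexI[of _ "({}, 1)"]) (auto simp: N_def D_def eventually_principal)
  moreover have "(\<tau> j \<longlongrightarrow> l j) F" if "j \<in> I" for j
  proof (rule tendstoI)
    fix e :: real assume "e > 0"
    with that show "eventually (\<lambda>x. dist (\<tau> j x) (l j) < e) F"
      unfolding ev by (intro bexI[of _ "({j}, e)"]) (auto simp: N_def D_def eventually_principal)
  qed
  ultimately show ?thesis using V by (intro that[of V]) (auto intro: filter_leD tendsto_mono)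
qed

text \<open>
  Limits along an ultrafilter \<open>U\<close> are reproduced by objects in \<open>P\<close> that approximate the members of
  the family on finite sets of tests. Applied to operators in a closed convex hull, this
  replaces them by elements of the hull itself.
\<close>

lemma ultrafilter_transfer:
  fixes \<theta> :: "'j \<Rightarrow> 'i \<Rightarrow> 'm::heine_borel" and \<tau> :: "'j \<Rightarrow> 'p \<Rightarrow> 'm"
  assumes U: "ultrafilter U" and A: "eventually (\<lambda>i. i \<in> A) U"
    and approx: "\<And>i J e. i \<in> A \<Longrightarrow> finite J \<Longrightarrow> J \<subseteq> I \<Longrightarrow> e > 0 \<Longrightarrow> \<exists>p\<in>P. \<forall>j\<in>J. dist (\<tau> j p) (\<theta> j i) < e"
    and bound: "\<And>i j. i \<in> A \<Longrightarrow> j \<in> I \<Longrightarrow> dist a (\<theta> j i) \<le> B j"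
  shows "\<exists>V l. ultrafilter V \<and> eventually (\<lambda>p. p \<in> P) V \<and>
    (\<forall>j\<in>I. (\<theta> j \<longlongrightarrow> l j) U \<and> (\<tau> j \<longlongrightarrow> l j) V)"
proof -
  have Unb: "U \<noteq> bot" using U by (simp add: ultrafilter_def)
  have "\<forall>j\<in>I. \<exists>l. (\<theta> j \<longlongrightarrow> l) U"
  proof
    fix j assume j: "j \<in> I"
    have "eventually (\<lambda>i. dist a (\<theta> j i) \<le> B j) U"
        by (rule eventually_mono[OF A]) (rule bound[OF _ j])
    from ultrafilter_convergent[OF U this] show "\<exists>l. (\<theta> j \<longlongrightarrow> l) U" by metis
  qed
  then obtain l where l: "\<And>j. j \<in> I \<Longrightarrow> (\<theta> j \<longlongrightarrow> l j) U" by metis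
  have *: "\<exists>p\<in>P. \<forall>j\<in>J. dist (\<tau> j p) (l j) < e" if J: "finite J" "J \<subseteq> I" and e: "e > 0" for J e
  proof -
    have e2: "e / 2 > 0" using e by simp
    have "eventually (\<lambda>i. i \<in> A \<and> (\<forall>j\<in>J. dist (\<theta> j i) (l j) < e / 2)) U"
      by (intro eventually_conj A eventually_ball_finite J(1) ballI tendstoD[OF l e2]) (use J(2)
          in blast)
    from eventually_happens'[OF Unb this] obtain i where
      i: "i \<in> A" "\<And>j. j \<in> J \<Longrightarrow> dist (\<theta> j i) (l j) < e / 2" by blast
    from approx[OF i(1) J e2] obtain p where p: "p \<in> P" "\<And>j. j \<in> J \<Longrightarrow> dist (\<tau> j p) (\<theta> j i) < e / 2"
        by blast
    have "dist (\<tau> j p) (l j) < e" if "j \<in> J" for j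
      using dist_triangle_half_r[of "\<theta> j i" "\<tau> j p" e "l j"] p(2)[OF that] i(2)[OF that]
          by (simp add: dist_commute)
    then show ?thesis using p(1) by blast
  qed
  obtain V where "ultrafilter V" "eventually (\<lambda>p. p \<in> P) V" "\<And>j. j \<in> I \<Longrightarrow> (\<tau> j \<longlongrightarrow> l j) V"
    by (rule finite_approx_ultrafilter[of I P \<tau> l, OF *]) auto
  then show ?thesis using l by blast
qed

section \<open>Functionals on real continuous functions\<close>

abbreviation cont :: "('a::topological_space \<Rightarrow> real) \<Rightarrow> bool" where
  "cont f \<equiv> continuous_on UNIV f"

text \<open>
  Functionals are defined on all functions but constrained on continuous ones only. This gives
  pointwise expressions as arguments without wrapping them into a space of continuous functions.
  On a compact space, the functionals satisfying \<open>pos_fun\<close> are the finite measures.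
\<close>

definition lin_fun :: "(('a::topological_space \<Rightarrow> real) \<Rightarrow> real) \<Rightarrow> bool" where
  "lin_fun \<psi> \<longleftrightarrow> (\<forall>f g. cont f \<longrightarrow> cont g \<longrightarrow> \<psi> (\<lambda>x. f x + g x) = \<psi> f + \<psi> g) \<and>
     (\<forall>c f. cont f \<longrightarrow> \<psi> (\<lambda>x. c * f x) = c * \<psi> f)"

definition bdd_fun :: "(('a::topological_space \<Rightarrow> real) \<Rightarrow> real) \<Rightarrow> bool" where
  "bdd_fun \<psi> \<longleftrightarrow> lin_fun \<psi> \<and> (\<exists>B. \<forall>f e. cont f \<longrightarrow> (\<forall>x. \<bar>f x\<bar> \<le> e) \<longrightarrow> \<bar>\<psi> f\<bar> \<le> B * e)"

definition pos_fun :: "(('a::topological_space \<Rightarrow> real) \<Rightarrow> real) \<Rightarrow> bool" where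
  "pos_fun \<mu> \<longleftrightarrow> lin_fun \<mu> \<and> (\<forall>f. cont f \<longrightarrow> (\<forall>x. 0 \<le> f x) \<longrightarrow> 0 \<le> \<mu> f)"

lemma lin_fun_add: "lin_fun \<psi> \<Longrightarrow> cont f \<Longrightarrow> cont g \<Longrightarrow> \<psi> (\<lambda>x. f x + g x) = \<psi> f + \<psi> g"
  by (simp add: lin_fun_def)

lemma lin_fun_scale: "lin_fun \<psi> \<Longrightarrow> cont f \<Longrightarrow> \<psi> (\<lambda>x. c * f x) = c * \<psi> f"
  by (simp add: lin_fun_def)

lemma lin_fun_diff:
  assumes "lin_fun \<psi>" "cont f" "cont g"
  shows "\<psi> (\<lambda>x. f x - g x) = \<psi> f - \<psi> g"
  using lin_fun_add[OF assms(1,2), of "\<lambda>x. -1 * g x"] lin_fun_scale[OF assms(1,3), of "-1"] assms(3)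
  by (simp add: continuous_on_minus)

lemma lin_fun_zero: "lin_fun \<psi> \<Longrightarrow> \<psi> (\<lambda>x. 0) = 0"
  using lin_fun_scale[of \<psi> "\<lambda>_. 0" 0] by simp

lemma lin_fun_const: "lin_fun \<psi> \<Longrightarrow> \<psi> (\<lambda>x. c) = c * \<psi> (\<lambda>_. 1)"
  using lin_fun_scale[of \<psi> "\<lambda>_. 1" c] by simp

lemma lin_fun_sum:
  assumes "lin_fun \<psi>" "finite I" "\<And>i. i \<in> I \<Longrightarrow> cont (f i)"
  shows "\<psi> (\<lambda>x. \<Sum>i\<in>I. f i x) = (\<Sum>i\<in>I. \<psi> (f i))"
  using assms(2,3)
proof (induction I rule: finite_induct)
  case empty
  then show ?case using lin_fun_zero[OF assms(1)] by simp
next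
  case (insert i I)
  then show ?case
    by (simp add: lin_fun_add[OF assms(1)] continuous_on_sum)
qed

lemma pos_fun_lin: "pos_fun \<mu> \<Longrightarrow> lin_fun \<mu>"
  by (simp add: pos_fun_def)

lemma bdd_fun_lin: "bdd_fun \<psi> \<Longrightarrow> lin_fun \<psi>"
  by (simp add: bdd_fun_def)

lemma pos_fun_nonneg: "pos_fun \<mu> \<Longrightarrow> cont f \<Longrightarrow> (\<And>x. 0 \<le> f x) \<Longrightarrow> 0 \<le> \<mu> f"
  by (simp add: pos_fun_def)

lemma pos_fun_mono:
  assumes "pos_fun \<mu>" "cont f" "cont g" "\<And>x. f x \<le> g x"
  shows "\<mu> f \<le> \<mu> g"
proof -
  have "0 \<le> \<mu> (\<lambda>x. g x - f x)"
    using assms by (intro pos_fun_nonneg[OF assms(1)] continuous_intros) auto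
  then show ?thesis using lin_fun_diff[OF pos_fun_lin[OF assms(1)] assms(3,2)] by simp
qed

lemma pos_fun_le_const:
  assumes "pos_fun \<mu>" "cont f" "\<And>x. f x \<le> c"
  shows "\<mu> f \<le> c * \<mu> (\<lambda>_. 1)"
proof -
  have "\<mu> f \<le> \<mu> (\<lambda>_. c)"
    using assms by (intro pos_fun_mono[OF assms(1)]) auto
  also have "\<dots> = c * \<mu> (\<lambda>_. 1)"
    by (rule lin_fun_const[OF pos_fun_lin[OF assms(1)]])
  finally show ?thesis .
qed

lemma pos_fun_abs:
  assumes "pos_fun \<mu>" "cont f"
  shows "\<bar>\<mu> f\<bar> \<le> \<mu> (\<lambda>x. \<bar>f x\<bar>)"
proof -
  have "\<mu> f \<le> \<mu> (\<lambda>x. \<bar>f x\<bar>)" using assms by (intro pos_fun_mono[OF assms(1)] continuous_intros) auto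
  moreover have "\<mu> (\<lambda>x. -1 * f x) \<le> \<mu> (\<lambda>x. \<bar>f x\<bar>)"
    using assms by (intro pos_fun_mono[OF assms(1)] continuous_on_mult_left continuous_intros) auto
  ultimately show ?thesis using lin_fun_scale[OF pos_fun_lin[OF assms(1)] assms(2), of "-1"]
      by linarith
qed

lemma pos_fun_bound:
  assumes "pos_fun \<mu>" "cont f" "\<And>x. \<bar>f x\<bar> \<le> e"
  shows "\<bar>\<mu> f\<bar> \<le> \<mu> (\<lambda>_. 1) * e"
proof -
  have "\<mu> (\<lambda>x. \<bar>f x\<bar>) \<le> e * \<mu> (\<lambda>_. 1)"
    by (rule pos_fun_le_const[OF assms(1) continuous_on_rabs[OF assms(2)] assms(3)])
  then show ?thesis using pos_fun_abs[OF assms(1,2)] by (simp add: mult.commute)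
qed

lemma pos_fun_bdd: "pos_fun \<mu> \<Longrightarrow> bdd_fun \<mu>"
  unfolding bdd_fun_def using pos_fun_lin[of \<mu>] pos_fun_bound[of \<mu>] by blast

text \<open>
  In terms of measures, this is the measure with density \<open>u\<close>.
\<close>

lemma pos_fun_mult:
  assumes "pos_fun \<mu>" "cont u" "\<And>x. 0 \<le> u x"
  shows "pos_fun (\<lambda>f. \<mu> (\<lambda>x. u x * f x))"
  unfolding pos_fun_def lin_fun_def
proof (intro conjI allI impI)
  fix f g :: "'a \<Rightarrow> real" and c assume f: "cont f"
  show "\<mu> (\<lambda>x. u x * (c * f x)) = c * \<mu> (\<lambda>x. u x * f x)"
    using lin_fun_scale[OF pos_fun_lin[OF assms(1)], of "\<lambda>x. u x * f x" c] f assms(2)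
    by (simp add: continuous_on_mult mult.left_commute)
  assume g: "cont g"
  show "\<mu> (\<lambda>x. u x * (f x + g x)) = \<mu> (\<lambda>x. u x * f x) + \<mu> (\<lambda>x. u x * g x)"
    using lin_fun_add[OF pos_fun_lin[OF assms(1)], of "\<lambda>x. u x * f x" "\<lambda>x. u x * g x"] f g assms(2)
    by (simp add: continuous_on_mult distrib_left)
next
  fix f :: "'a \<Rightarrow> real" assume "cont f" "\<forall>x. 0 \<le> f x"
  then show "0 \<le> \<mu> (\<lambda>x. u x * f x)"
    using assms by (intro pos_fun_nonneg[OF assms(1)] continuous_intros) auto
qed

lemma bdd_fun_mult:
  fixes u :: "'a::topological_space \<Rightarrow> real"
  assumes "bdd_fun \<psi>" "cont u" "\<And>x. \<bar>u x\<bar> \<le> B"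
  shows "bdd_fun (\<lambda>f. \<psi> (\<lambda>x. u x * f x))"
proof -
  have l: "lin_fun \<psi>" by (rule bdd_fun_lin[OF assms(1)])
  obtain C where C: "\<And>f e. cont f \<Longrightarrow> (\<And>x. \<bar>f x\<bar> \<le> e) \<Longrightarrow> \<bar>\<psi> f\<bar> \<le> C * e"
    using assms(1) by (auto simp: bdd_fun_def)
  show ?thesis
    unfolding bdd_fun_def lin_fun_def
  proof (intro conjI exI[of _ "C * B"] allI impI)
    fix f g :: "'a \<Rightarrow> real" and c assume f: "cont f"
    show "\<psi> (\<lambda>x. u x * (c * f x)) = c * \<psi> (\<lambda>x. u x * f x)"
      using lin_fun_scale[OF l, of "\<lambda>x. u x * f x" c] f assms(2)
      by (simp add: continuous_on_mult mult.left_commute)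
    assume g: "cont g"
    show "\<psi> (\<lambda>x. u x * (f x + g x)) = \<psi> (\<lambda>x. u x * f x) + \<psi> (\<lambda>x. u x * g x)"
      using lin_fun_add[OF l, of "\<lambda>x. u x * f x" "\<lambda>x. u x * g x"] f g assms(2)
      by (simp add: continuous_on_mult distrib_left)
  next
    fix f :: "'a \<Rightarrow> real" and e assume f: "cont f" "\<forall>x. \<bar>f x\<bar> \<le> e"
    have "\<bar>u x * f x\<bar> \<le> B * e" for x
      using assms(3)[of x] f(2) abs_ge_zero[of "u x"] unfolding abs_mult
      by (intro mult_mono) (auto intro: order_trans[OF abs_ge_zero])
    then show "\<bar>\<psi> (\<lambda>x. u x * f x)\<bar> \<le> C * B * e"
      using C[of "\<lambda>x. u x * f x" "B * e"] f(1) assms(2) by (simp add: continuous_on_mult mult.assoc)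
  qed
qed

lemma cont_bounded:
  fixes f :: "'a::topological_space \<Rightarrow> real"
  assumes "compact (UNIV :: 'a set)" "cont f"
  obtains B where "0 \<le> B" "\<And>x. \<bar>f x\<bar> \<le> B"
proof -
  have "compact (f ` UNIV)" using assms compact_continuous_image by blast
  then obtain B where "\<forall>y\<in>range f. norm y \<le> B"
    unfolding bounded_iff[symmetric] using compact_imp_bounded bounded_iff by metis
  then show ?thesis
    by (intro that[of "max 0 B"]) (auto simp: le_max_iff_disj)
qed

text \<open>
  Weak* compactness of balls in the dual space.
\<close>

lemma ultrafilter_limit_bdd_fun:
  fixes \<Lambda> :: "'i \<Rightarrow> ('a::topological_space \<Rightarrow> real) \<Rightarrow> real"
  assumes K: "compact (UNIV :: 'a set)" and U: "ultrafilter U"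
    and bdd: "eventually (\<lambda>i. lin_fun (\<Lambda> i) \<and> (\<forall>f e. cont f \<longrightarrow> (\<forall>x. \<bar>f x\<bar> \<le> e) \<longrightarrow> \<bar>\<Lambda> i f\<bar> \<le> B * e)) U"
  shows "\<exists>\<nu>. bdd_fun \<nu> \<and> (\<forall>g. cont g \<longrightarrow> ((\<lambda>i. \<Lambda> i g) \<longlongrightarrow> \<nu> g) U)"
proof -
  have Unb: "U \<noteq> bot" using U by (simp add: ultrafilter_def)
  define \<nu> where "\<nu> g = Lim U (\<lambda>i. \<Lambda> i g)" for g
  have lim: "((\<lambda>i. \<Lambda> i g) \<longlongrightarrow> \<nu> g) U" if g: "cont g" for g
  proof -
    obtain C where C: "\<And>x. \<bar>g x\<bar> \<le> C" using cont_bounded[OF K g] by blast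
    have "eventually (\<lambda>i. dist 0 (\<Lambda> i g) \<le> B * C) U"
      by (rule eventually_mono[OF bdd]) (use g C in simp)
    from ultrafilter_convergent[OF U this] obtain l where l: "((\<lambda>i. \<Lambda> i g) \<longlongrightarrow> l) U" .
    then show ?thesis using tendsto_Lim[OF Unb l] by (simp add: \<nu>_def)
  qed
  have \<nu>I: "\<nu> g = l" if "cont g" "((\<lambda>i. \<Lambda> i g) \<longlongrightarrow> l) U" for g l
    by (rule tendsto_unique[OF Unb lim[OF that(1)] that(2)])
  have lin: "eventually (\<lambda>i. lin_fun (\<Lambda> i)) U" by (rule eventually_mono[OF bdd]) simp
  have "bdd_fun \<nu>"
    unfolding bdd_fun_def lin_fun_def
  proof (intro conjI allI impI exI[of _ B])
    fix g g' :: "'a \<Rightarrow> real" and c assume g: "cont g"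
    show "\<nu> (\<lambda>x. c * g x) = c * \<nu> g"
    proof (rule \<nu>I[OF continuous_on_mult_left[OF g]], rule Lim_transform_eventually[OF
        tendsto_mult_left[OF lim[OF g]]])
      show "eventually (\<lambda>i. c * \<Lambda> i g = \<Lambda> i (\<lambda>x. c * g x)) U"
        by (rule eventually_mono[OF lin]) (rule lin_fun_scale[OF _ g, symmetric])
    qed
    assume g': "cont g'"
    show "\<nu> (\<lambda>x. g x + g' x) = \<nu> g + \<nu> g'"
    proof (rule \<nu>I[OF continuous_on_add[OF g g']], rule Lim_transform_eventually[OF tendsto_add[OF
        lim[OF g] lim[OF g']]])
      show "eventually (\<lambda>i. \<Lambda> i g + \<Lambda> i g' = \<Lambda> i (\<lambda>x. g x + g' x)) U"
        by (rule eventually_mono[OF lin]) (rule lin_fun_add[OF _ g g', symmetric])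
    qed
  next
    fix g :: "'a \<Rightarrow> real" and e assume g: "cont g" "\<forall>x. \<bar>g x\<bar> \<le> e"
    show "\<bar>\<nu> g\<bar> \<le> B * e"
      by (rule tendsto_upperbound[OF tendsto_rabs[OF lim[OF g(1)]] eventually_mono[OF bdd] Unb])
          (use g in simp)
  qed
  then show ?thesis using lim by blast
qed

lemma ultrafilter_limit_pos_fun:
  fixes \<Lambda> :: "'i \<Rightarrow> ('a::topological_space \<Rightarrow> real) \<Rightarrow> real"
  assumes K: "compact (UNIV :: 'a set)" and U: "ultrafilter U"
    and pos: "eventually (\<lambda>i. pos_fun (\<Lambda> i) \<and> \<Lambda> i (\<lambda>_. 1) \<le> B) U"
  shows "\<exists>\<nu>. pos_fun \<nu> \<and> (\<forall>g. cont g \<longrightarrow> ((\<lambda>i. \<Lambda> i g) \<longlongrightarrow> \<nu> g) U)"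
proof -
  have Unb: "U \<noteq> bot" using U by (simp add: ultrafilter_def)
  have "eventually (\<lambda>i. lin_fun (\<Lambda> i) \<and> (\<forall>f e. cont f \<longrightarrow> (\<forall>x. \<bar>f x\<bar> \<le> e) \<longrightarrow> \<bar>\<Lambda> i f\<bar> \<le> B * e)) U"
  proof (rule eventually_mono[OF pos], intro conjI allI impI)
    fix i assume i: "pos_fun (\<Lambda> i) \<and> \<Lambda> i (\<lambda>_. 1) \<le> B"
    then show "lin_fun (\<Lambda> i)" by (simp add: pos_fun_lin)
    fix f :: "'a \<Rightarrow> real" and e assume f: "cont f" "\<forall>x. \<bar>f x\<bar> \<le> e"
    have "0 \<le> e" using f(2) abs_ge_zero order_trans by blast
    then have "\<Lambda> i (\<lambda>_. 1) * e \<le> B * e" using i by (intro mult_right_mono) auto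
    moreover have "\<bar>\<Lambda> i f\<bar> \<le> \<Lambda> i (\<lambda>_. 1) * e" using i f by (intro pos_fun_bound) auto
    ultimately show "\<bar>\<Lambda> i f\<bar> \<le> B * e" by linarith
  qed
  from ultrafilter_limit_bdd_fun[OF K U this] obtain \<nu> where
    \<nu>: "bdd_fun \<nu>" "\<And>g. cont g \<Longrightarrow> ((\<lambda>i. \<Lambda> i g) \<longlongrightarrow> \<nu> g) U" by blast
  have "0 \<le> \<nu> f" if f: "cont f" "\<forall>x. 0 \<le> f x" for f
    by (rule tendsto_lowerbound[OF \<nu>(2)[OF f(1)] eventually_mono[OF pos] Unb])
       (use f in \<open>auto intro: pos_fun_nonneg\<close>)
  then have "pos_fun \<nu>" using bdd_fun_lin[OF \<nu>(1)] by (simp add: pos_fun_def)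
  then show ?thesis using \<nu>(2) by blast
qed

lemma Dini_decreasing:
  fixes H :: "nat \<Rightarrow> 'a::topological_space \<Rightarrow> real"
  assumes K: "compact (UNIV :: 'a set)" and H: "\<And>k. cont (H k)"
    and dec: "\<And>k x. H (Suc k) x \<le> H k x" and lim: "\<And>x. \<exists>k. H k x < e"
  shows "\<exists>k. \<forall>x. H k x < e"
proof -
  have "\<exists>C' \<subseteq> range (\<lambda>k. {x. H k x < e}). finite C' \<and> UNIV \<subseteq> \<Union>C'"
  proof (rule compactE[OF K])
    show "UNIV \<subseteq> \<Union>(range (\<lambda>k. {x. H k x < e}))" using lim by auto
    show "open B" if "B \<in> range (\<lambda>k. {x. H k x < e})" for B
      using that H by (auto intro!: open_Collect_less continuous_intros)
  qed auto
  then obtain C' where "C' \<subseteq> range (\<lambda>k. {x. H k x < e})" "finite C'" and C': "UNIV \<subseteq> \<Union>C'" by blast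
  then obtain I where I: "finite I" "C' = (\<lambda>k. {x. H k x < e}) ` I"
    by (meson finite_subset_image)
  have "H (Max I) x < e" for x
  proof -
    obtain k where k: "k \<in> I" "H k x < e" using C' I by auto
    have "H (Max I) x \<le> H k x"
      by (rule lift_Suc_antimono_le[of "\<lambda>k. H k x", OF dec]) (use k(1) I(1) in simp)
    then show ?thesis using k by simp
  qed
  then show ?thesis by blast
qed

fun tail_max :: "(nat \<Rightarrow> 'a \<Rightarrow> real) \<Rightarrow> nat \<Rightarrow> nat \<Rightarrow> 'a \<Rightarrow> real" where
  "tail_max g i 0 x = g i x"
| "tail_max g i (Suc d) x = max (tail_max g i d x) (g (i + Suc d) x)"

lemma tail_max_cont: "(\<And>i. cont (g i)) \<Longrightarrow> cont (tail_max g i d)"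
  by (induction d) (auto intro!: continuous_intros simp: continuous_on_max)

lemma tail_max_ge: "j \<le> d \<Longrightarrow> g (i + j) x \<le> tail_max g i d x"
  by (induction d) (auto simp: le_Suc_eq le_max_iff_disj)

lemma tail_max_attained: "\<exists>j\<le>d. tail_max g i d x = g (i + j) x"
proof (induction d)
  case (Suc d)
  then obtain j where "j \<le> d" "tail_max g i d x = g (i + j) x" by auto
  then show ?case
    by (cases "tail_max g i d x \<le> g (i + Suc d) x")
       (auto simp: max_def intro: exI[of _ "Suc d"] exI[of _ j])
qed auto

fun run_min :: "(nat \<Rightarrow> 'a \<Rightarrow> real) \<Rightarrow> nat \<Rightarrow> 'a \<Rightarrow> real" where
  "run_min g 0 x = g 0 x"
| "run_min g (Suc k) x = min (run_min g k x) (g (Suc k) x)"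

lemma run_min_cont: "(\<And>i. cont (g i)) \<Longrightarrow> cont (run_min g k)"
  by (induction k) (auto intro!: continuous_intros simp: continuous_on_min)

lemma run_min_attained: "\<exists>i\<le>k. run_min g k x = g i x"
proof (induction k)
  case (Suc k)
  then obtain j where "j \<le> k" "run_min g k x = g j x" by auto
  then show ?case
    by (cases "run_min g k x \<le> g (Suc k) x")
       (auto simp: min_def intro: exI[of _ "Suc k"] exI[of _ j])
qed auto

lemma run_min_le: "i \<le> k \<Longrightarrow> run_min g k x \<le> g i x"
  by (induction k) (auto simp: le_Suc_eq min_le_iff_disj)

text \<open>
  Bounded convergence without measure theory. The suprema over the tails of the sequence decrease to
  \<open>0\<close> but need not be continuous. Finite tail maxima \<open>A k\<close> exhaust them up to a small amount as
  far as \<open>\<mu>\<close> is concerned. The running minima \<open>H k\<close> of the \<open>A k\<close> are continuous and decrease to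
  \<open>0\<close>, hence uniformly by Dini's theorem, and passing from \<open>A k\<close> to \<open>H k\<close> costs \<open>\<mu>\<close> only a
  summable amount.
\<close>

lemma pos_fun_bounded_convergence:
  fixes g :: "nat \<Rightarrow> 'a::topological_space \<Rightarrow> real"
  assumes K: "compact (UNIV :: 'a set)" and \<mu>: "pos_fun \<mu>" and g: "\<And>n. cont (g n)"
    and g0: "\<And>n x. 0 \<le> g n x" and gB: "\<And>n x. g n x \<le> B" and lim: "\<And>x. (\<lambda>n. g n x) \<longlonglongrightarrow> 0"
  shows "(\<lambda>n. \<mu> (g n)) \<longlonglongrightarrow> 0"
proof (rule LIMSEQ_I)
  fix r :: real assume r: "r > 0"
  define e where "e = r / 5"
  have e: "e > 0" using r by (simp add: e_def)
  define m1 where "m1 = \<mu> (\<lambda>_. 1)"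
  have m1: "m1 \<ge> 0" unfolding m1_def by (intro pos_fun_nonneg[OF \<mu>]) auto
  note lin = pos_fun_lin[OF \<mu>]
  let ?G = "tail_max g"
  have Gcf: "cont (?G i d)" for i d by (rule tail_max_cont[OF g])
\<comment> \<open>The values of \<open>\<mu>\<close> at the tail maxima are bounded, so a finite one is optimal up to \<open>e / 2 ^ i\<close>.\<close>
  have "\<exists>d. \<forall>d'. \<mu> (?G i d') \<le> \<mu> (?G i d) + e * (1/2)^i" for i
  proof (rule ccontr)
    assume "\<not> ?thesis"
    then have n: "\<And>d. \<exists>d'. \<mu> (?G i d) + e * (1/2)^i < \<mu> (?G i d')" by (auto simp: not_le)
    have "\<exists>d. \<mu> (?G i d) \<ge> real k * (e * (1/2)^i)" for k
    proof (induction k)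
      case 0
      have "0 \<le> \<mu> (?G i 0)" using g0 by (intro pos_fun_nonneg[OF \<mu> Gcf]) auto
      then show ?case by (auto intro: exI[of _ 0])
    next
      case (Suc k)
      then obtain d where "\<mu> (?G i d) \<ge> real k * (e * (1/2)^i)" by auto
      moreover obtain d' where "\<mu> (?G i d) + e * (1/2)^i < \<mu> (?G i d')" using n by blast
      ultimately show ?case by (intro exI[of _ d']) (simp add: algebra_simps)
    qed
    moreover have "\<mu> (?G i d) \<le> B * m1" for d
      unfolding m1_def using tail_max_attained[of d g i] gB
      by (intro pos_fun_le_const[OF \<mu> Gcf]) metis
    ultimately have "real k * (e * (1/2)^i) \<le> B * m1" for k by (meson order_trans)
    then show False using e
      by (metis ex_less_of_nat_mult mult_pos_pos not_le zero_less_divide_1_iff zero_less_numeral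
          zero_less_power)
  qed
  then obtain D where D: "\<And>i d'. \<mu> (?G i d') \<le> \<mu> (?G i (D i)) + e * (1/2)^i" by metis
  define A where "A i = ?G i (D i)" for i
  have Acf: "cont (A i)" for i by (simp add: A_def Gcf)
  define H where "H = run_min A"
  have Hcf: "cont (H k)" for k unfolding H_def by (rule run_min_cont[OF Acf])
\<comment> \<open>\<open>A k\<close> exceeds \<open>A i\<close> only through members of the tail beyond \<open>D i\<close>, which add little to \<open>A i\<close>.\<close>
  have Adiff: "\<mu> (\<lambda>x. max 0 (A k x - A i x)) \<le> e * (1/2)^i" if "i < k" for i k
  proof -
    define d where "d = max (D i) (k - i + D k)"
    have "max 0 (A k x - A i x) \<le> ?G i d x - A i x" for x
    proof -
      obtain j where "j \<le> D k" "A k x = g (k + j) x"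
        using tail_max_attained[of "D k" g k x] by (auto simp: A_def)
      then have "A k x \<le> ?G i d x"
        using tail_max_ge[of "k - i + j" d g i x] that by (simp add: d_def)
      moreover obtain j where "j \<le> D i" "A i x = g (i + j) x"
        using tail_max_attained[of "D i" g i x] by (auto simp: A_def)
      then have "A i x \<le> ?G i d x"
        using tail_max_ge[of j d g i x] by (simp add: d_def)
      ultimately show ?thesis by simp
    qed
    then have "\<mu> (\<lambda>x. max 0 (A k x - A i x)) \<le> \<mu> (\<lambda>x. ?G i d x - A i x)"
      by (intro pos_fun_mono[OF \<mu>] continuous_intros Acf Gcf)
    also have "\<dots> = \<mu> (?G i d) - \<mu> (A i)" by (rule lin_fun_diff[OF lin Gcf Acf])
    also have "\<dots> \<le> e * (1/2)^i" using D[of i d] by (simp add: A_def)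
    finally show ?thesis .
  qed
  have AH: "\<mu> (A k) \<le> \<mu> (H k) + 2 * e" for k
  proof -
    have "A k x - H k x \<le> (\<Sum>i<k. max 0 (A k x - A i x))" for x
    proof -
      obtain i where i: "i \<le> k" "H k x = A i x"
        using run_min_attained[of k A x] by (auto simp: H_def)
      show ?thesis
      proof (cases "i = k")
        case True
        then show ?thesis using i by (simp add: sum_nonneg)
      next
        case False
        then have "max 0 (A k x - A i x) \<le> (\<Sum>i<k. max 0 (A k x - A i x))"
          using i by (intro member_le_sum) auto
        then show ?thesis using i by simp
      qed
    qed
    then have "\<mu> (\<lambda>x. A k x - H k x) \<le> \<mu> (\<lambda>x. \<Sum>i<k. max 0 (A k x - A i x))"
      by (intro pos_fun_mono[OF \<mu>] continuous_intros Acf Hcf)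
    also have "\<dots> = (\<Sum>i<k. \<mu> (\<lambda>x. max 0 (A k x - A i x)))"
      by (intro lin_fun_sum[OF lin] continuous_intros Acf) auto
    also have "\<dots> \<le> (\<Sum>i<k. e * (1/2)^i)" by (intro sum_mono Adiff) auto
    also have "\<dots> = e * (\<Sum>i<k. (1/2)^i)" by (simp add: sum_distrib_left)
    also have "\<dots> \<le> e * 2" using e by (intro mult_left_mono) (auto simp: geometric_sum)
    finally show ?thesis using lin_fun_diff[OF lin Acf Hcf] by simp
  qed
  have "\<exists>k. \<forall>x. H k x < e / (m1 + 1)"
  proof (rule Dini_decreasing[OF K Hcf])
    show "H (Suc k) x \<le> H k x" for k x by (simp add: H_def)
    fix x
    have p: "e / (m1 + 1) > 0" using e m1 by simp
    obtain k where "\<forall>n\<ge>k. norm (g n x - 0) < e / (m1 + 1)"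
      using LIMSEQ_D[OF lim[of x] p] by blast
    then have k: "\<And>n. n \<ge> k \<Longrightarrow> g n x < e / (m1 + 1)" by force
    obtain j where "A k x = g (k + j) x"
      using tail_max_attained[of "D k" g k x] by (auto simp: A_def)
    then have "A k x < e / (m1 + 1)" using k by simp
    then show "\<exists>k. H k x < e / (m1 + 1)"
      unfolding H_def by (meson le_less_trans order_refl run_min_le)
  qed
  then obtain k where k: "\<And>x. H k x < e / (m1 + 1)" by blast
  have "\<mu> (g n) < r" if "n \<ge> k" for n
  proof -
    have "\<mu> (H k) \<le> e / (m1 + 1) * \<mu> (\<lambda>_. 1)"
      by (rule pos_fun_le_const[OF \<mu> Hcf]) (rule less_imp_le[OF k])
    then have "\<mu> (H k) \<le> e / (m1 + 1) * m1" by (simp only: m1_def)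
    also have "\<dots> \<le> e" using e m1 by (simp add: field_simps)
    finally have H: "\<mu> (H k) \<le> e" .
    have "\<mu> (g n) \<le> \<mu> (?G k (n - k))"
      using that tail_max_ge[of "n - k" "n - k" g k] by (intro pos_fun_mono[OF \<mu> g Gcf]) simp
    also have "\<dots> \<le> \<mu> (A k) + e * (1/2)^k" unfolding A_def by (rule D)
    also have "\<dots> \<le> \<mu> (A k) + e" using e by (simp add: power_le_one)
    also have "\<dots> \<le> 4 * e" using AH[of k] H by simp
    finally show ?thesis using r by (simp add: e_def)
  qed
  moreover have "0 \<le> \<mu> (g n)" for n using g0 by (intro pos_fun_nonneg[OF \<mu> g])
  ultimately show "\<exists>no. \<forall>n\<ge>no. norm (\<mu> (g n) - 0) < r" by auto
qed

section \<open>Finite means and averages\<close>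

text \<open>
  Finite convex combinations of point evaluations. Defined inductively instead of by weights, they
  are closed under translation and convex combination without any care about supports, and
  facts about them are proved by induction.
\<close>

inductive_set finite_means :: "(('s \<Rightarrow> real) \<Rightarrow> real) set" where
  finite_mean_point: "(\<lambda>\<phi>. \<phi> s) \<in> finite_means"
| finite_mean_mix: "L \<in> finite_means \<Longrightarrow> L' \<in> finite_means \<Longrightarrow> 0 \<le> t \<Longrightarrow> t \<le> 1 \<Longrightarrow>
    (\<lambda>\<phi>. (1 - t) * L \<phi> + t * L' \<phi>) \<in> finite_means"

lemma finite_mean_add: "L \<in> finite_means \<Longrightarrow> L (\<lambda>s. \<phi> s + \<psi> s) = L \<phi> + L \<psi>"
  by (induction rule: finite_means.induct) (auto simp: algebra_simps)

lemma finite_mean_scale: "L \<in> finite_means \<Longrightarrow> L (\<lambda>s. c * \<phi> s) = c * L \<phi>"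
  by (induction rule: finite_means.induct) (auto simp: algebra_simps)

lemma finite_mean_const: "L \<in> finite_means \<Longrightarrow> L (\<lambda>s. c) = c"
  by (induction rule: finite_means.induct) (auto simp: algebra_simps)

lemma finite_mean_diff: "L \<in> finite_means \<Longrightarrow> L (\<lambda>s. \<phi> s - \<psi> s) = L \<phi> - L \<psi>"
  using finite_mean_add[of L \<phi> "\<lambda>s. - 1 * \<psi> s"] finite_mean_scale[of L "- 1" \<psi>] by simp

lemma finite_mean_mono: "L \<in> finite_means \<Longrightarrow> (\<And>s. \<phi> s \<le> \<psi> s) \<Longrightarrow> L \<phi> \<le> L \<psi>"
  by (induction rule: finite_means.induct) (auto intro!: add_mono mult_left_mono)

lemma finite_mean_abs_le: "L \<in> finite_means \<Longrightarrow> (\<And>s. \<bar>\<phi> s\<bar> \<le> e) \<Longrightarrow> \<bar>L \<phi>\<bar> \<le> e"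
  using finite_mean_mono[of L \<phi> "\<lambda>_. e"] finite_mean_mono[of L "\<lambda>_. - e" \<phi>] finite_mean_const[of L
      e] finite_mean_const[of L "- e"]
  by (simp add: abs_le_iff minus_le_iff)

lemma finite_mean_sum:
  assumes "L \<in> finite_means"
  shows "L (\<lambda>s. \<Sum>i\<in>I. \<phi> i s) = (\<Sum>i\<in>I. L (\<phi> i))"
  by (induction I rule: infinite_finite_induct) (auto simp: finite_mean_const[OF assms]
      finite_mean_add[OF assms])

lemma finite_mean_shift: "L \<in> finite_means \<Longrightarrow> (\<lambda>\<phi>. L (\<lambda>t. \<phi> (t * s))) \<in> finite_means"
  by (induction rule: finite_means.induct) (auto intro: finite_means.intros)

lemma finite_mean_cont: "L \<in> finite_means \<Longrightarrow> (\<And>s. cont (k s)) \<Longrightarrow> cont (\<lambda>x. L (\<lambda>s. k s x))"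
  by (induction rule: finite_means.induct) (auto intro!: continuous_intros)

lemma finite_mean_tendsto:
  "L \<in> finite_means \<Longrightarrow> (\<And>s. ((\<lambda>u. k s u) \<longlongrightarrow> l s) F) \<Longrightarrow> ((\<lambda>u. L (\<lambda>s. k s u)) \<longlongrightarrow> L l) F"
  by (induction rule: finite_means.induct) (auto intro!: tendsto_intros)

lemma finite_mean_commute:
  assumes L: "L \<in> finite_means" and \<psi>: "lin_fun \<psi>" and k: "\<And>s. cont (k s)"
  shows "\<psi> (\<lambda>x. L (\<lambda>s. k s x)) = L (\<lambda>s. \<psi> (k s))"
  using L
proof (induction L rule: finite_means.induct)
  case (finite_mean_point s)
  show ?case by (rule refl)
next
  case (finite_mean_mix L L' t)
  have "cont (\<lambda>x. L (\<lambda>s. k s x))" "cont (\<lambda>x. L' (\<lambda>s. k s x))"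
    using finite_mean_mix.hyps k by (auto intro: finite_mean_cont)
  then show ?case
    using finite_mean_mix.IH by (simp add: lin_fun_add[OF \<psi>] lin_fun_scale[OF \<psi>]
        continuous_on_mult_left)
qed

lemma finite_mean_abs_commute:
  assumes "L \<in> finite_means" "pos_fun \<mu>" "\<And>s. cont (k s)"
  shows "\<mu> (\<lambda>x. \<bar>L (\<lambda>s. k s x)\<bar>) \<le> L (\<lambda>s. \<mu> (\<lambda>x. \<bar>k s x\<bar>))"
proof -
  have "\<mu> (\<lambda>x. \<bar>L (\<lambda>s. k s x)\<bar>) \<le> \<mu> (\<lambda>x. L (\<lambda>s. \<bar>k s x\<bar>))"
  proof (rule pos_fun_mono[OF assms(2)])
    show "\<bar>L (\<lambda>s. k s x)\<bar> \<le> L (\<lambda>s. \<bar>k s x\<bar>)" for x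
      using finite_mean_mono[OF assms(1), of "\<lambda>s. k s x" "\<lambda>s. \<bar>k s x\<bar>"]
        finite_mean_mono[OF assms(1), of "\<lambda>s. - 1 * k s x" "\<lambda>s. \<bar>k s x\<bar>"]
        finite_mean_scale[OF assms(1), of "- 1" "\<lambda>s. k s x"] by (simp add: abs_le_iff)
    show "cont (\<lambda>x. L (\<lambda>s. \<bar>k s x\<bar>))" by (rule finite_mean_cont[OF assms(1)]) (intro
        continuous_intros assms(3))
    have "cont (\<lambda>x. L (\<lambda>s. k s x))" by (rule finite_mean_cont[OF assms(1,3)])
    then show "cont (\<lambda>x. \<bar>L (\<lambda>s. k s x)\<bar>)" by (rule continuous_on_rabs)
  qed
  also have "\<dots> = L (\<lambda>s. \<mu> (\<lambda>x. \<bar>k s x\<bar>))"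
    by (rule finite_mean_commute[OF assms(1) pos_fun_lin[OF assms(2)]]) (intro continuous_intros
        assms)
  finally show ?thesis .
qed

lemma finite_mean_combination:
  fixes c :: "'i \<Rightarrow> real"
  assumes "finite I" "\<And>i. i \<in> I \<Longrightarrow> 0 \<le> c i" "sum c I = 1"
  shows "(\<lambda>\<phi>. \<Sum>i\<in>I. c i * \<phi> (\<sigma> i)) \<in> finite_means"
  using assms
proof (induction I arbitrary: c rule: finite_induct)
  case (insert i I)
  show ?case
  proof (cases "sum c I = 0")
    case True
    then have z: "c j = 0" if "j \<in> I" for j
      using insert.prems(1) insert.hyps that by (subst (asm) sum_nonneg_eq_0_iff) auto
    then show ?thesis using insert finite_mean_point[of "\<sigma> i"] by (simp cong: sum.cong)
  next
    case False
    have nn: "0 \<le> sum c I" using insert.prems by (intro sum_nonneg) auto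
    define t where "t = sum c I"
    have "0 \<le> c i" using insert.prems by simp
    moreover have ci: "c i + t = 1" using insert.prems insert.hyps by (simp add: t_def)
    ultimately have t: "0 < t" "t \<le> 1" "c i = 1 - t"
      using False nn by (auto simp: t_def)
    have "(\<lambda>\<phi>. \<Sum>j\<in>I. (c j / t) * \<phi> (\<sigma> j)) \<in> finite_means"
      using insert.prems t by (intro insert.IH) (auto simp: t_def simp flip: sum_divide_distrib)
    from finite_mean_mix[OF finite_mean_point this, of t "\<sigma> i"] t
    have "(\<lambda>\<phi>. (1 - t) * \<phi> (\<sigma> i) + t * (\<Sum>j\<in>I. (c j / t) * \<phi> (\<sigma> j))) \<in> finite_means" by simp
    moreover have "t * (\<Sum>j\<in>I. (c j / t) * \<phi> (\<sigma> j)) = (\<Sum>j\<in>I. c j * \<phi> (\<sigma> j))" for \<phi>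
      using t by (simp add: sum_distrib_left)
    ultimately show ?thesis using insert.hyps t by simp
  qed
qed auto

abbreviation bounded_cont :: "('s::topological_space \<Rightarrow> real) \<Rightarrow> bool" where
  "bounded_cont \<phi> \<equiv> cont \<phi> \<and> (\<exists>B. \<forall>s. \<bar>\<phi> s\<bar> \<le> B)"

lemma bounded_cont_add: "bounded_cont \<phi> \<Longrightarrow> bounded_cont \<psi> \<Longrightarrow> bounded_cont (\<lambda>s. \<phi> s + \<psi> s)"
  by (auto intro!: continuous_intros) (meson abs_triangle_ineq add_mono order_trans)

lemma bounded_cont_scale: "bounded_cont \<phi> \<Longrightarrow> bounded_cont (\<lambda>s. c * \<phi> s)"
  by (auto intro!: continuous_intros simp: abs_mult) (meson mult_left_mono abs_ge_zero)

lemma bounded_cont_const: "bounded_cont (\<lambda>s. c)"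
  by auto

text \<open>
  The mean is taken on real functions: it stands for the restriction of a complex invariant mean.
\<close>

locale amenable_action =
  fixes act :: "'s::{semigroup_mult,topological_space} \<Rightarrow> 'k::t2_space \<Rightarrow> 'k"
    and mean :: "('s \<Rightarrow> real) \<Rightarrow> real"
  assumes K: "compact (UNIV :: 'k set)"
    and act_mult: "act (s * t) x = act s (act t x)"
    and act_cont: "continuous_on UNIV (\<lambda>(s, x). act s x)"
    and mult_cont1: "continuous_on UNIV (\<lambda>t::'s. s * t)"
    and mult_cont2: "continuous_on UNIV (\<lambda>t::'s. t * s)"
    and mean_add: "bounded_cont \<phi> \<Longrightarrow> bounded_cont \<psi> \<Longrightarrow> mean (\<lambda>s. \<phi> s + \<psi> s) = mean \<phi> + mean \<psi>"
    and mean_scale: "bounded_cont \<phi> \<Longrightarrow> mean (\<lambda>s. c * \<phi> s) = c * mean \<phi>"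
    and mean_pos: "bounded_cont \<phi> \<Longrightarrow> (\<And>s. 0 \<le> \<phi> s) \<Longrightarrow> 0 \<le> mean \<phi>"
    and mean_one: "mean (\<lambda>s. 1) = 1"
    and mean_left: "bounded_cont \<phi> \<Longrightarrow> mean (\<lambda>t. \<phi> (s * t)) = mean \<phi>"
    and mean_right: "bounded_cont \<phi> \<Longrightarrow> mean (\<lambda>t. \<phi> (t * s)) = mean \<phi>"
begin

definition avg :: "(('s \<Rightarrow> real) \<Rightarrow> real) \<Rightarrow> ('k \<Rightarrow> real) \<Rightarrow> 'k \<Rightarrow> real" where
  "avg L f = (\<lambda>x. L (\<lambda>s. f (act s x)))"

lemma act_cont_right: "continuous_on UNIV (act s)"
  using continuous_on_compose2[OF act_cont, of UNIV "\<lambda>x. (s, x)"]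
  by (simp add: continuous_on_Pair)

lemma act_cont_left: "continuous_on UNIV (\<lambda>s. act s x)"
  using continuous_on_compose2[OF act_cont, of UNIV "\<lambda>s. (s, x)"]
  by (simp add: continuous_on_Pair)

lemma cont_act: "cont f \<Longrightarrow> cont (\<lambda>x. f (act s x))"
  by (rule continuous_on_compose2[OF _ act_cont_right]) auto

lemma cont_orbit: "cont f \<Longrightarrow> cont (\<lambda>s. f (act s x))"
  by (rule continuous_on_compose2[OF _ act_cont_left]) auto

lemma bounded_cont_orbit:
  assumes "cont f" shows "bounded_cont (\<lambda>s. f (act s x))"
proof -
  obtain B where "\<And>x. \<bar>f x\<bar> \<le> B" using cont_bounded[OF K assms] by metis
  then show ?thesis using cont_orbit[OF assms] by (auto intro!: exI[of _ B])
qed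

lemma cont_avg: "L \<in> finite_means \<Longrightarrow> cont f \<Longrightarrow> cont (avg L f)"
  unfolding avg_def by (rule finite_mean_cont) (auto intro: cont_act)

lemma avg_abs_le: "L \<in> finite_means \<Longrightarrow> (\<And>x. \<bar>f x\<bar> \<le> B) \<Longrightarrow> \<bar>avg L f x\<bar> \<le> B"
  unfolding avg_def by (rule finite_mean_abs_le)

lemma avg_shift: "avg (\<lambda>\<phi>. L (\<lambda>t. \<phi> (t * s))) f x = avg L f (act s x)"
  by (simp add: avg_def act_mult)

lemma avg_add: "L \<in> finite_means \<Longrightarrow> avg L (\<lambda>x. f x + g x) x = avg L f x + avg L g x"
  unfolding avg_def by (rule finite_mean_add)

lemma avg_diff: "L \<in> finite_means \<Longrightarrow> avg L (\<lambda>x. f x - g x) x = avg L f x - avg L g x"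
  unfolding avg_def by (rule finite_mean_diff)

lemma avg_scale: "L \<in> finite_means \<Longrightarrow> avg L (\<lambda>x. c * f x) x = c * avg L f x"
  unfolding avg_def by (rule finite_mean_scale)

lemma avg_const: "L \<in> finite_means \<Longrightarrow> avg L (\<lambda>x. c) x = c"
  unfolding avg_def by (rule finite_mean_const)

lemma lin_fun_avg: "L \<in> finite_means \<Longrightarrow> lin_fun \<psi> \<Longrightarrow> cont f \<Longrightarrow>
    \<psi> (avg L f) = L (\<lambda>s. \<psi> (\<lambda>x. f (act s x)))"
  unfolding avg_def by (rule finite_mean_commute) (auto intro: cont_act)

lemma pos_fun_avg:
  assumes L: "L \<in> finite_means" shows "pos_fun (\<lambda>g. avg L g x)"
  unfolding pos_fun_def lin_fun_def
proof (intro conjI allI impI)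
  fix g :: "'k \<Rightarrow> real" assume g: "\<forall>x. 0 \<le> g x"
  have "L (\<lambda>_. 0) \<le> avg L g x" unfolding avg_def by (rule finite_mean_mono[OF L]) (simp add: g)
  then show "0 \<le> avg L g x" by (simp add: finite_mean_const[OF L])
qed (simp_all add: avg_add[OF L] avg_scale[OF L])

lemma mean_const: "mean (\<lambda>s. c) = c"
  using mean_scale[OF bounded_cont_const, of c 1] mean_one by simp

lemma mean_sum: "finite I \<Longrightarrow> (\<And>i. i \<in> I \<Longrightarrow> bounded_cont (\<phi> i)) \<Longrightarrow> bounded_cont (\<lambda>s. \<Sum>i\<in>I. \<phi> i s) \<and>
    mean (\<lambda>s. \<Sum>i\<in>I. \<phi> i s) = (\<Sum>i\<in>I. mean (\<phi> i))"
proof (induction I rule: finite_induct)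
  case empty
  then show ?case using mean_const[of 0] bounded_cont_const[of 0] by simp
next
  case (insert i I)
  then have b: "bounded_cont (\<phi> i)" "bounded_cont (\<lambda>s. \<Sum>i\<in>I. \<phi> i s)" by auto
  then show ?case
    using insert bounded_cont_add[OF b] mean_add[OF b] by simp
qed

text \<open>
  Finite means are weak* dense in the means. Let \<open>L\<close> be a finite mean that nearly minimises the
  squared distance \<open>Q\<close> to the mean on the given functions. Moving \<open>L\<close> a small step towards a point
  evaluation cannot decrease \<open>Q\<close> by much, so half the derivative of \<open>Q\<close> in this direction, \<open>A s\<close>, is
  not far below \<open>0\<close>. Applying the mean to \<open>A\<close> yields \<open>- Q L\<close>, hence \<open>Q L\<close> is small.
\<close>

lemma finite_mean_dense:
  assumes "finite \<Phi>" "\<And>\<phi>. \<phi> \<in> \<Phi> \<Longrightarrow> bounded_cont \<phi>" "e > 0"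
  shows "\<exists>L\<in>finite_means. \<forall>\<phi>\<in>\<Phi>. \<bar>L \<phi> - mean \<phi>\<bar> < e"
proof -
  define Q where "Q L = (\<Sum>\<phi>\<in>\<Phi>. (L \<phi> - mean \<phi>)\<^sup>2)" for L
  have Q0: "Q L \<ge> 0" for L by (simp add: Q_def sum_nonneg)
  obtain B where B: "\<And>\<phi> s. \<phi> \<in> \<Phi> \<Longrightarrow> \<bar>\<phi> s\<bar> \<le> B \<phi>" using assms(2) by metis
  define C where "C = 1 + (\<Sum>\<phi>\<in>\<Phi>. (2 * B \<phi>)\<^sup>2)"
  have C: "C > 0" by (simp add: C_def add_pos_nonneg sum_nonneg)
\<comment> \<open>The step \<open>t\<close> makes the quadratic term \<open>t\<^sup>2 * C\<close> small against \<open>t * e\<^sup>2\<close>, and the gap \<open>\<delta>\<close> of the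
  near-minimiser is of the same order.\<close>
  define t where "t = min 1 (e\<^sup>2 / (4 * C))"
  have t: "0 < t" "t \<le> 1" "t * C \<le> e\<^sup>2 / 4"
    using C assms(3) by (auto simp: t_def min_def field_simps)
  define \<delta> where "\<delta> = t * e\<^sup>2 / 4"
  have \<delta>: "\<delta> > 0" using t assms(3) by (simp add: \<delta>_def)
  have "\<exists>L\<in>finite_means. Q L < Inf (Q ` finite_means) + \<delta>"
  proof -
    have "Q (\<lambda>\<phi>. \<phi> undefined) \<in> Q ` finite_means" by (rule imageI[OF finite_mean_point])
    then have "Q ` finite_means \<noteq> {}" by (metis empty_iff)
    moreover have "bdd_below (Q ` finite_means)" using Q0 by (rule bdd_belowI2)
    ultimately show ?thesis using \<delta> cInf_lessD[of "Q ` finite_means" "Inf (Q ` finite_means) + \<delta>"]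
        by auto
  qed
  then obtain L where L: "L \<in> finite_means" "Q L < Inf (Q ` finite_means) + \<delta>" by blast
  have near: "Q L \<le> Q L' + \<delta>" if "L' \<in> finite_means" for L'
    using that L(2) cInf_lower[of "Q L'" "Q ` finite_means"] Q0 by (force intro: bdd_belowI2)
  define A where "A s = (\<Sum>\<phi>\<in>\<Phi>. (L \<phi> - mean \<phi>) * (\<phi> s - L \<phi>))" for s
  have A: "A s \<ge> - (e\<^sup>2 / 4)" for s
  proof -
    define L' where "L' = (\<lambda>\<phi>. (1 - t) * L \<phi> + t * \<phi> s)"
    have L': "L' \<in> finite_means" unfolding L'_def using t L(1)
        by (intro finite_mean_mix finite_mean_point) auto
    have "Q L' = (\<Sum>\<phi>\<in>\<Phi>. (L \<phi> - mean \<phi>)\<^sup>2 + 2 * t * ((L \<phi> - mean \<phi>) * (\<phi> s - L \<phi>)) + t\<^sup>2 *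
        (\<phi> s - L \<phi>)\<^sup>2)"
      unfolding Q_def L'_def by (intro sum.cong) (auto simp: power2_eq_square algebra_simps)
    also have "\<dots> = Q L + 2 * t * A s + t\<^sup>2 * (\<Sum>\<phi>\<in>\<Phi>. (\<phi> s - L \<phi>)\<^sup>2)"
      by (simp add: sum.distrib sum_distrib_left Q_def A_def)
    also have "(\<Sum>\<phi>\<in>\<Phi>. (\<phi> s - L \<phi>)\<^sup>2) \<le> (\<Sum>\<phi>\<in>\<Phi>. (2 * B \<phi>)\<^sup>2)"
    proof (rule sum_mono)
      fix \<phi> assume p: "\<phi> \<in> \<Phi>"
      have "\<bar>L \<phi>\<bar> \<le> B \<phi>" by (rule finite_mean_abs_le[OF L(1) B[OF p]])
      then have "\<bar>\<phi> s - L \<phi>\<bar> \<le> \<bar>2 * B \<phi>\<bar>" using B[OF p, of s] by linarith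
      then show "(\<phi> s - L \<phi>)\<^sup>2 \<le> (2 * B \<phi>)\<^sup>2" by (simp only: abs_le_square_iff)
    qed
    also have "(\<Sum>\<phi>\<in>\<Phi>. (2 * B \<phi>)\<^sup>2) \<le> C" by (simp add: C_def)
    finally have "Q L' \<le> Q L + 2 * t * A s + t\<^sup>2 * C" by (simp add: mult_left_mono)
    then have "0 \<le> 2 * t * A s + t * (t * C) + \<delta>" using near[OF L'] by (simp add: power2_eq_square)
    also have "t * (t * C) \<le> t * (e\<^sup>2 / 4)" using t by (intro mult_left_mono) auto
    finally have "0 \<le> t * (2 * A s + e\<^sup>2 / 4 + e\<^sup>2 / 4)"
      by (simp add: \<delta>_def algebra_simps)
    then have "0 \<le> 2 * A s + e\<^sup>2 / 4 + e\<^sup>2 / 4" using t(1) by (simp add: zero_le_mult_iff)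
    then show ?thesis by simp
  qed
  have bcA: "bounded_cont (\<lambda>s. (L \<phi> - mean \<phi>) * (\<phi> s - L \<phi>))"
    and mnA: "mean (\<lambda>s. (L \<phi> - mean \<phi>) * (\<phi> s - L \<phi>)) = (L \<phi> - mean \<phi>) * (mean \<phi> - L \<phi>)"
    if "\<phi> \<in> \<Phi>" for \<phi>
  proof -
    have b: "bounded_cont (\<lambda>s. \<phi> s + - L \<phi>)" by (intro bounded_cont_add bounded_cont_const
        assms(2) that)
    have m: "mean (\<lambda>s. \<phi> s + - L \<phi>) = mean \<phi> - L \<phi>"
      using mean_add[OF assms(2)[OF that] bounded_cont_const, of "- L \<phi>"] mean_const by simp
    show "bounded_cont (\<lambda>s. (L \<phi> - mean \<phi>) * (\<phi> s - L \<phi>))"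
      using bounded_cont_scale[OF b, of "L \<phi> - mean \<phi>"] by simp
    show "mean (\<lambda>s. (L \<phi> - mean \<phi>) * (\<phi> s - L \<phi>)) = (L \<phi> - mean \<phi>) * (mean \<phi> - L \<phi>)"
      using mean_scale[OF b, of "L \<phi> - mean \<phi>"] m by simp
  qed
  have "bounded_cont A" and "mean A = (\<Sum>\<phi>\<in>\<Phi>. (L \<phi> - mean \<phi>) * (mean \<phi> - L \<phi>))"
    unfolding A_def[abs_def] using mean_sum[OF assms(1) bcA] mnA by auto
  then have mA: "mean A = - Q L"
    by (simp add: Q_def power2_eq_square algebra_simps flip: sum_negf)
  have "bounded_cont (\<lambda>s. A s + e\<^sup>2 / 4)" by (intro bounded_cont_add bounded_cont_const
      \<open>bounded_cont A\<close>)
  moreover have "0 \<le> A s + e\<^sup>2 / 4" for s using A[of s] by simp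
  ultimately have "0 \<le> mean (\<lambda>s. A s + e\<^sup>2 / 4)" by (rule mean_pos)
  also have "\<dots> = - Q L + e\<^sup>2 / 4" using mean_add[OF \<open>bounded_cont A\<close> bounded_cont_const,
      of "e\<^sup>2/4"] mean_const mA by simp
  finally have QL: "Q L \<le> e\<^sup>2 / 4" by simp
  have "\<bar>L \<phi> - mean \<phi>\<bar> < e" if "\<phi> \<in> \<Phi>" for \<phi>
  proof -
    have "(L \<phi> - mean \<phi>)\<^sup>2 \<le> Q L" unfolding Q_def
      using that assms(1) by (intro member_le_sum) auto
    also have "\<dots> < e\<^sup>2"
    proof -
      have "e\<^sup>2 > 0" using assms(3) by simp
      then show ?thesis using QL by linarith
    qed
    finally have "\<bar>L \<phi> - mean \<phi>\<bar>\<^sup>2 < e\<^sup>2" by simp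
    then show ?thesis by (rule power2_less_imp_less) (use assms(3) in simp)
  qed
  then show ?thesis using L(1) by blast
qed

end

section \<open>Averages in tame systems\<close>

locale tame_action = amenable_action act mean
  for act :: "'s::{semigroup_mult,topological_space} \<Rightarrow> 'k::t2_space \<Rightarrow> 'k" and mean +
  assumes tame_subsequence: "cont f \<Longrightarrow> \<exists>r. strict_mono r \<and>
      (\<forall>x. convergent (\<lambda>n. f (act ((s :: nat \<Rightarrow> 's) (r n)) x)))"
begin

text \<open>
  Otherwise there would be a sequence of translates that are \<open>e\<close>-separated in the mean. Tameness
      gives
  a pointwise convergent subsequence, and the differences of its consecutive members tend to \<open>0\<close> in
  the mean by bounded convergence.
\<close>

lemma orbit_finite_net:
  assumes \<mu>: "pos_fun \<mu>" and f: "cont f" and e: "e > 0"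
  shows "\<exists>N. finite N \<and> (\<forall>s. \<exists>t\<in>N. \<mu> (\<lambda>x. \<bar>f (act s x) - f (act t x)\<bar>) < e)"
proof (rule ccontr)
  assume "\<not> ?thesis"
  then have ex: "\<And>N. finite N \<Longrightarrow> \<exists>s. \<forall>t\<in>N. e \<le> \<mu> (\<lambda>x. \<bar>f (act s x) - f (act t x)\<bar>)"
    by (auto simp: not_less)
  have "\<exists>s. \<forall>n::nat. \<forall>m<n. e \<le> \<mu> (\<lambda>x. \<bar>f (act (s n) x) - f (act (s m) x)\<bar>)"
  proof (rule dependent_wellorder_choice)
    fix n :: nat and s :: "nat \<Rightarrow> 's"
    obtain r where "\<forall>t\<in>s ` {..<n}. e \<le> \<mu> (\<lambda>x. \<bar>f (act r x) - f (act t x)\<bar>)"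
      using ex[of "s ` {..<n}"] by blast
    then show "\<exists>r. \<forall>m<n. e \<le> \<mu> (\<lambda>x. \<bar>f (act r x) - f (act (s m) x)\<bar>)"
      by (intro exI[of _ r]) simp
  qed simp
  then obtain s :: "nat \<Rightarrow> 's" where s: "\<forall>n. \<forall>m<n. e \<le>
      \<mu> (\<lambda>x. \<bar>f (act (s n) x) - f (act (s m) x)\<bar>)" ..
  obtain r where r: "strict_mono r" and conv: "\<And>x. convergent (\<lambda>n. f (act (s (r n)) x))"
    using tame_subsequence[OF f, of s] by blast
  define g where "g n x = \<bar>f (act (s (r (Suc n))) x) - f (act (s (r n)) x)\<bar>" for n x
  obtain B where B: "\<And>x. \<bar>f x\<bar> \<le> B" using cont_bounded[OF K f] by blast
  have "(\<lambda>n. \<mu> (g n)) \<longlonglongrightarrow> 0"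
  proof (rule pos_fun_bounded_convergence[OF K \<mu>, where B = "2 * B"])
    show "cont (g n)" for n unfolding g_def by (intro continuous_on_rabs continuous_on_diff
        cont_act[OF f])
    show "g n x \<le> 2 * B" for n x
      unfolding g_def using B[of "act (s (r (Suc n))) x"] B[of "act (s (r n)) x"] by linarith
    show "(\<lambda>n. g n x) \<longlonglongrightarrow> 0" for x
    proof -
      from conv[of x] obtain l where l: "(\<lambda>n. f (act (s (r n)) x)) \<longlonglongrightarrow> l"
        by (auto simp: convergent_def)
      then have "(\<lambda>n. f (act (s (r (Suc n))) x)) \<longlonglongrightarrow> l" by (rule LIMSEQ_Suc)
      from tendsto_rabs[OF tendsto_diff[OF this l]] show ?thesis by (simp add: g_def)
    qed
  qed (simp add: g_def)
  then have "eventually (\<lambda>n. \<mu> (g n) < e) sequentially" by (rule order_tendstoD[OF _ e])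
  then obtain n where "\<mu> (g n) < e" by (auto simp: eventually_sequentially)
  moreover have "r n < r (Suc n)" using r by (simp add: strict_mono_def)
  ultimately show False using s[rule_format, of "r n" "r (Suc n)"] by (simp add: g_def[abs_def])
qed

text \<open>
  Averages inherit the precompactness of the translates. If every translate is replaced by the
  nearest member of a finite net, an average is determined up to a small error by finitely many
  weights, and bounded weights converge along an ultrafilter.
\<close>

lemma finite_mean_Cauchy:
  fixes U :: "'i filter" and \<Lambda> :: "'i \<Rightarrow> ('s \<Rightarrow> real) \<Rightarrow> real"
  assumes U: "ultrafilter U" and finite_means: "eventually (\<lambda>i. \<Lambda> i \<in> finite_means) U"
    and \<mu>: "pos_fun \<mu>" and f: "cont f" and e: "e > 0"
  shows "\<exists>A. eventually A U \<and> (\<forall>i. A i \<longrightarrow> \<Lambda> i \<in> finite_means) \<and>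
    (\<forall>i j. A i \<longrightarrow> A j \<longrightarrow> \<mu> (\<lambda>x. \<bar>avg (\<Lambda> i) f x - avg (\<Lambda> j) f x\<bar>) < e)"
proof -
  note lin = pos_fun_lin[OF \<mu>]
  obtain N where N: "finite N" "\<And>s. \<exists>t\<in>N. \<mu> (\<lambda>x. \<bar>f (act s x) - f (act t x)\<bar>) < e / 4"
    using orbit_finite_net[OF \<mu> f, of "e / 4"] e by auto
  then obtain \<pi> where \<pi>: "\<And>s. \<pi> s \<in> N" "\<And>s. \<mu> (\<lambda>x. \<bar>f (act s x) - f (act (\<pi> s) x)\<bar>) < e / 4"
    by metis
\<comment> \<open>The weight which the finite mean gives to the cell of \<open>t\<close>.\<close>
  define w where "w t i = \<Lambda> i (\<lambda>s. if \<pi> s = t then 1 else 0)" for t i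
  have "\<exists>l. ((\<lambda>i. w t i) \<longlongrightarrow> l) U" for t
  proof -
    have "eventually (\<lambda>i. dist 0 (w t i) \<le> 1) U"
      using finite_means
    proof eventually_elim
      case (elim i)
      have "\<bar>w t i\<bar> \<le> 1" unfolding w_def by (rule finite_mean_abs_le[OF elim]) auto
      then show ?case by simp
    qed
    from ultrafilter_convergent[OF U this] show ?thesis by blast
  qed
  then obtain l where l: "\<And>t. ((\<lambda>i. w t i) \<longlongrightarrow> l t) U" by metis
  define m where "m t = \<mu> (\<lambda>x. \<bar>f (act t x)\<bar>)" for t
  have m: "m t \<ge> 0" for t unfolding m_def
    by (rule pos_fun_nonneg[OF \<mu>]) (intro continuous_on_rabs cont_act[OF f], simp)
  define \<delta> where "\<delta> = e / (8 * (1 + sum m N))"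
  have sm: "sum m N \<ge> 0" by (simp add: sum_nonneg m)
  have \<delta>: "\<delta> > 0" "2 * \<delta> * sum m N \<le> e / 4"
    using e sm by (auto simp: \<delta>_def field_simps)
  define A where "A i \<longleftrightarrow> \<Lambda> i \<in> finite_means \<and> (\<forall>t\<in>N. \<bar>w t i - l t\<bar> < \<delta>)" for i
  have "eventually A U"
    unfolding A_def
  proof (intro eventually_conj finite_means eventually_ball_finite N ballI)
    show "eventually (\<lambda>i. \<bar>w t i - l t\<bar> < \<delta>) U" for t
      using tendstoD[OF l \<delta>(1)] by (simp add: dist_real_def)
  qed
  moreover have "\<mu> (\<lambda>x. \<bar>avg (\<Lambda> i) f x - avg (\<Lambda> j) f x\<bar>) < e" if ij: "A i" "A j" for i j
  proof -
    define p where "p i x = (\<Sum>t\<in>N. w t i * f (act t x))" for i x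
    have pcf: "cont (p i)" for i unfolding p_def
      by (intro continuous_on_sum continuous_on_mult_left cont_act[OF f])
    have near: "\<mu> (\<lambda>x. \<bar>avg (\<Lambda> i) f x - p i x\<bar>) \<le> e / 4" if "A i" for i
    proof -
      have Li: "\<Lambda> i \<in> finite_means" using that by (simp add: A_def)
      have "p i x = \<Lambda> i (\<lambda>s. f (act (\<pi> s) x))" for x
      proof -
        have "p i x = (\<Sum>t\<in>N. \<Lambda> i (\<lambda>s. f (act t x) * (if \<pi> s = t then 1 else 0)))"
          unfolding p_def w_def by (intro sum.cong) (auto simp: finite_mean_scale[OF Li]
              mult.commute)
        also have "\<dots> = \<Lambda> i (\<lambda>s. \<Sum>t\<in>N. f (act t x) * (if \<pi> s = t then 1 else 0))"
          by (rule finite_mean_sum[OF Li, symmetric])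
        also have "(\<lambda>s. \<Sum>t\<in>N. f (act t x) * (if \<pi> s = t then 1 else 0)) = (\<lambda>s. f (act (\<pi> s) x))"
        proof
          fix s
          have "(\<Sum>t\<in>N. f (act t x) * (if \<pi> s = t then 1 else 0)) = (\<Sum>t\<in>N. if \<pi> s =
              t then f (act t x) else 0)"
            by (intro sum.cong) auto
          also have "\<dots> = f (act (\<pi> s) x)" using N(1) \<pi>(1) by simp
          finally show "(\<Sum>t\<in>N. f (act t x) * (if \<pi> s = t then 1 else 0)) = f (act (\<pi> s) x)" .
        qed
        finally show ?thesis .
      qed
      then have "(\<lambda>x. \<bar>avg (\<Lambda> i) f x - p i x\<bar>) = (\<lambda>x. \<bar>\<Lambda> i (\<lambda>s. f (act s x) - f (act (\<pi> s) x))\<bar>)"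
        by (simp add: avg_def finite_mean_diff[OF Li])
      then have "\<mu> (\<lambda>x. \<bar>avg (\<Lambda> i) f x - p i x\<bar>) =
          \<mu> (\<lambda>x. \<bar>\<Lambda> i (\<lambda>s. f (act s x) - f (act (\<pi> s) x))\<bar>)"
        by simp
      also have "\<dots> \<le> \<Lambda> i (\<lambda>s. \<mu> (\<lambda>x. \<bar>f (act s x) - f (act (\<pi> s) x)\<bar>))"
        by (rule finite_mean_abs_commute[OF Li \<mu>]) (intro continuous_on_diff cont_act[OF f])
      also have "\<dots> \<le> \<Lambda> i (\<lambda>s. e / 4)"
        by (rule finite_mean_mono[OF Li]) (rule less_imp_le[OF \<pi>(2)])
      finally show ?thesis by (simp add: finite_mean_const[OF Li])
    qed
    let ?d = "\<lambda>i x. \<bar>avg (\<Lambda> i) f x - p i x\<bar>"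
    have avcf: "cont (avg (\<Lambda> i) f)" "cont (avg (\<Lambda> j) f)" using ij
        by (auto simp: A_def intro: cont_avg[OF _ f])
    have dcf: "cont (?d i)" "cont (?d j)" by (intro continuous_on_rabs continuous_on_diff avcf pcf)+
    have scf: "cont (\<lambda>x. \<Sum>t\<in>N. (2 * \<delta>) * \<bar>f (act t x)\<bar>)"
      by (intro continuous_on_sum continuous_on_mult_left continuous_on_rabs cont_act[OF f])
    have "\<mu> (\<lambda>x. \<bar>avg (\<Lambda> i) f x - avg (\<Lambda> j) f x\<bar>)
        \<le> \<mu> (\<lambda>x. (?d i x + ?d j x) + (\<Sum>t\<in>N. (2 * \<delta>) * \<bar>f (act t x)\<bar>))"
    proof (rule pos_fun_mono[OF \<mu>])
      fix x
      have "\<bar>p i x - p j x\<bar> = \<bar>\<Sum>t\<in>N. (w t i - w t j) * f (act t x)\<bar>"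
        by (simp add: p_def algebra_simps sum_subtractf)
      also have "\<dots> \<le> (\<Sum>t\<in>N. \<bar>(w t i - w t j) * f (act t x)\<bar>)" by (rule sum_abs)
      also have "\<dots> \<le> (\<Sum>t\<in>N. (2 * \<delta>) * \<bar>f (act t x)\<bar>)"
      proof (rule sum_mono)
        fix t assume "t \<in> N"
        then have "\<bar>w t i - l t\<bar> < \<delta>" "\<bar>w t j - l t\<bar> < \<delta>" using ij by (auto simp: A_def)
        then have "\<bar>w t i - w t j\<bar> \<le> 2 * \<delta>" by linarith
        then show "\<bar>(w t i - w t j) * f (act t x)\<bar> \<le> 2 * \<delta> * \<bar>f (act t x)\<bar>"
          unfolding abs_mult by (intro mult_right_mono) auto
      qed
      finally show "\<bar>avg (\<Lambda> i) f x - avg (\<Lambda> j) f x\<bar>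
          \<le> (?d i x + ?d j x) + (\<Sum>t\<in>N. (2 * \<delta>) * \<bar>f (act t x)\<bar>)" by linarith
    qed (intro continuous_on_add continuous_on_rabs continuous_on_diff avcf dcf scf)+
    also have "\<dots> = \<mu> (?d i) + \<mu> (?d j) + \<mu> (\<lambda>x. \<Sum>t\<in>N. (2 * \<delta>) * \<bar>f (act t x)\<bar>)"
      using lin_fun_add[OF lin continuous_on_add[OF dcf] scf] lin_fun_add[OF lin dcf] by simp
    also have "\<mu> (\<lambda>x. \<Sum>t\<in>N. (2 * \<delta>) * \<bar>f (act t x)\<bar>) = (\<Sum>t\<in>N. \<mu> (\<lambda>x. (2 * \<delta>) * \<bar>f (act t x)\<bar>))"
      by (rule lin_fun_sum[OF lin N(1)]) (intro continuous_on_mult_left continuous_on_rabs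
          cont_act[OF f])
    also have "\<dots> = 2 * \<delta> * sum m N"
      unfolding sum_distrib_left m_def
      by (intro sum.cong refl lin_fun_scale[OF lin] continuous_on_rabs cont_act[OF f])
    finally show ?thesis using near[OF ij(1)] near[OF ij(2)] \<delta>(2) e by linarith
  qed
  moreover have "\<Lambda> i \<in> finite_means" if "A i" for i using that by (simp add: A_def)
  ultimately show ?thesis by (intro exI[of _ A]) simp
qed

text \<open>
  The averages of a continuous function contain no independent sequence. The family \<open>\<U>\<close> stands for
  the pieces of the space that can still be split, a piece being described
      by a nonnegative function.
  The splitting property yields averages \<open>h 0, h 1, \<dots>\<close> such that every pattern of the
  conditions \<open>h i < a\<close> and \<open>h i > b\<close> for \<open>i < N\<close> is realised by a point. Let \<open>\<mu>\<close> be a limit of the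
  uniform distributions on these \<open>2 ^ N\<close> points. Half of the patterns treat \<open>n\<close> and \<open>m\<close>
  differently, so \<open>h n\<close> and \<open>h m\<close> have distance at least \<open>(b - a) / 2\<close> with respect to \<open>\<mu>\<close>, which is
  excluded by the previous lemma.
\<close>

lemma no_independence:
  assumes f: "cont f" and ab: "a < b" and u0: "u0 \<in> \<U>"
    and pos: "\<And>u. u \<in> \<U> \<Longrightarrow> \<exists>x. 0 < u x"
    and split: "\<And>V. finite V \<Longrightarrow> V \<subseteq> \<U> \<Longrightarrow> \<exists>L\<in>finite_means. \<forall>u\<in>V.
      (\<lambda>x. u x * max 0 (a - avg L f x)) \<in> \<U> \<and> (\<lambda>x. u x * max 0 (avg L f x - b)) \<in> \<U>"
  shows False
proof -
  define v where "v L \<beta> x = (if \<beta> then max 0 (a - avg L f x) else max 0 (avg L f x - b))" for L \<beta> x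
  have v0: "0 \<le> v L \<beta> x" for L \<beta> x by (simp add: v_def)
\<comment> \<open>The part of the initial piece on which the first \<open>n\<close> averages follow the pattern \<open>\<sigma>\<close>.\<close>
  define node where "node Ls \<sigma> n x = u0 x * (\<Prod>i<n. v (Ls i) (i \<in> \<sigma>) x)" for Ls \<sigma> and n :: nat and x
  have node_cong: "node Ls \<sigma> n = node Ls (\<sigma> \<inter> {..<n}) n" for Ls \<sigma> and n :: nat
    unfolding node_def by (intro ext arg_cong2[where f = "(*)"] refl prod.cong) auto
  have "\<exists>Ls. \<forall>n::nat. Ls n \<in> finite_means \<and> (\<forall>\<sigma> \<beta>. (\<lambda>x. node Ls \<sigma> n x * v (Ls n) \<beta> x) \<in> \<U>)"
  proof (rule dependent_wellorder_choice)
    fix r n and Ls Ls' :: "nat \<Rightarrow> ('s \<Rightarrow> real) \<Rightarrow> real"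
    assume "\<And>m. m < n \<Longrightarrow> Ls m = Ls' m"
    then have "node Ls \<sigma> n = node Ls' \<sigma> n" for \<sigma>
      unfolding node_def by (intro ext arg_cong2[where f = "(*)"] refl prod.cong) auto
    then show "(r \<in> finite_means \<and> (\<forall>\<sigma> \<beta>. (\<lambda>x. node Ls \<sigma> n x * v r \<beta> x) \<in> \<U>)) =
        (r \<in> finite_means \<and> (\<forall>\<sigma> \<beta>. (\<lambda>x. node Ls' \<sigma> n x * v r \<beta> x) \<in> \<U>))" by simp
  next
    fix n and Ls :: "nat \<Rightarrow> ('s \<Rightarrow> real) \<Rightarrow> real"
    assume IH: "\<And>m. m < n \<Longrightarrow> Ls m \<in> finite_means \<and> (\<forall>\<sigma> \<beta>. (\<lambda>x. node Ls \<sigma> m x * v (Ls m) \<beta> x) \<in> \<U>)"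
    have inU: "node Ls \<sigma> n \<in> \<U>" for \<sigma>
    proof (cases n)
      case 0
      then show ?thesis using u0 by (simp add: node_def[abs_def])
    next
      case (Suc m)
      have "node Ls \<sigma> n = (\<lambda>x. node Ls \<sigma> m x * v (Ls m) (m \<in> \<sigma>) x)"
        by (simp add: node_def[abs_def] Suc mult.assoc)
      then show ?thesis using IH[of m] Suc by auto
    qed
    define V where "V = (\<lambda>\<sigma>. node Ls \<sigma> n) ` Pow {..<n}"
    have "finite V" "V \<subseteq> \<U>" unfolding V_def using inU by auto
    from split[OF this] obtain L where L: "L \<in> finite_means"
      "\<And>u. u \<in> V \<Longrightarrow> (\<lambda>x. u x * max 0 (a - avg L f x)) \<in> \<U> \<and> (\<lambda>x. u x * max 0 (avg L f x - b)) \<in> \<U>"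
      by blast
    have "(\<lambda>x. node Ls \<sigma> n x * v L \<beta> x) \<in> \<U>" for \<sigma> \<beta>
    proof -
      have "node Ls \<sigma> n \<in> V" unfolding V_def node_cong[of Ls \<sigma>] by auto
      from L(2)[OF this] show ?thesis by (cases \<beta>) (auto simp: v_def)
    qed
    then show "\<exists>r. r \<in> finite_means \<and> (\<forall>\<sigma> \<beta>. (\<lambda>x. node Ls \<sigma> n x * v r \<beta> x) \<in> \<U>)" using L(1) by blast
  qed
  then obtain Ls where Ls: "\<And>n. Ls n \<in> finite_means"
      "\<And>n \<sigma> \<beta>. (\<lambda>x. node Ls \<sigma> n x * v (Ls n) \<beta> x) \<in> \<U>"
    by blast
  define h where "h n = avg (Ls n) f" for n
  have hcf: "cont (h n)" for n unfolding h_def by (rule cont_avg[OF Ls(1) f])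
  have "\<exists>x. \<forall>i<N. if i \<in> \<sigma> then h i x < a else h i x > b" for N \<sigma>
  proof -
    from pos[OF Ls(2)[of \<sigma> N True]] obtain x where x: "0 < node Ls \<sigma> N x * v (Ls N) True x" by blast
    have "(\<Prod>i<N. v (Ls i) (i \<in> \<sigma>) x) \<noteq> 0"
    proof
      assume "(\<Prod>i<N. v (Ls i) (i \<in> \<sigma>) x) = 0"
      with x show False unfolding node_def by simp
    qed
    then have "\<forall>i<N. v (Ls i) (i \<in> \<sigma>) x \<noteq> 0" by auto
    then show ?thesis by (intro exI[of _ x]) (auto simp: v_def h_def split: if_splits)
  qed
  then obtain p where p: "\<And>N \<sigma> i. i < N \<Longrightarrow> if i \<in> \<sigma> then h i (p N \<sigma>) < a else h i (p N \<sigma>) > b"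
    by metis
  define M where "M N g = (\<Sum>\<sigma>\<in>Pow {..<N}. g (p N \<sigma>)) / 2 ^ N" for N :: nat and g :: "'k \<Rightarrow> real"
  obtain U where U: "U \<le> sequentially" "ultrafilter U"
      by (rule ultrafilter_ex[of sequentially]) auto
  have Unb: "U \<noteq> bot" using U by (simp add: ultrafilter_def)
  have "pos_fun (M N)" for N
    unfolding pos_fun_def lin_fun_def
    by (auto simp: M_def sum.distrib add_divide_distrib sum_distrib_left sum_nonneg)
  moreover have "M N (\<lambda>_. 1) = 1" for N by (simp add: M_def card_Pow)
  ultimately have "eventually (\<lambda>N. pos_fun (M N) \<and> M N (\<lambda>_. 1) \<le> 1) U" by simp
  from ultrafilter_limit_pos_fun[OF K U(2) this] obtain \<mu> where \<mu>: "pos_fun \<mu>"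
    and lim: "\<And>g. cont g \<Longrightarrow> ((\<lambda>N. M N g) \<longlongrightarrow> \<mu> g) U" by blast
  have sep: "\<mu> (\<lambda>x. \<bar>h n x - h m x\<bar>) \<ge> (b - a) / 2" if nm: "n < m" for n m
  proof -
    have "M N (\<lambda>x. \<bar>h n x - h m x\<bar>) \<ge> (b - a) / 2" if N: "m < N" for N
    proof -
      define F where "F \<sigma> = \<bar>h n (p N \<sigma>) - h m (p N \<sigma>)\<bar>" for \<sigma>
\<comment> \<open>Flipping the entry \<open>n\<close> pairs the patterns that treat \<open>n\<close> and \<open>m\<close> alike with those that do not.\<close>
      define \<tau> where "\<tau> \<sigma> = (if n \<in> \<sigma> then \<sigma> - {n} else insert n \<sigma>)" for \<sigma> :: "nat set"
      have "bij_betw \<tau> (Pow {..<N}) (Pow {..<N})"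
        by (rule bij_betw_byWitness[of _ \<tau>]) (use nm N in \<open>auto simp: \<tau>_def split: if_splits\<close>)
      then have "(\<Sum>\<sigma>\<in>Pow {..<N}. F (\<tau> \<sigma>)) = (\<Sum>\<sigma>\<in>Pow {..<N}. F \<sigma>)"
        by (rule sum.reindex_bij_betw)
      then have "2 * (\<Sum>\<sigma>\<in>Pow {..<N}. F \<sigma>) = (\<Sum>\<sigma>\<in>Pow {..<N}. F \<sigma> + F (\<tau> \<sigma>))"
        by (simp add: sum.distrib)
      also have "\<dots> \<ge> (\<Sum>\<sigma>\<in>Pow {..<N}. b - a)"
      proof (rule sum_mono)
        fix \<sigma>
        have big: "F \<sigma> \<ge> b - a" if "(n \<in> \<sigma>) \<noteq> (m \<in> \<sigma>)" for \<sigma>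
        proof -
          have "n < N" using nm N by simp
          note pn = p[OF this, of \<sigma>] and pm = p[OF N, of \<sigma>]
          show ?thesis
          proof (cases "n \<in> \<sigma>")
            case True
            then have "h n (p N \<sigma>) < a" "h m (p N \<sigma>) > b" using that pn pm by simp_all
            then show ?thesis unfolding F_def by linarith
          next
            case False
            then have "h m (p N \<sigma>) < a" "h n (p N \<sigma>) > b" using that pn pm by simp_all
            then show ?thesis unfolding F_def by linarith
          qed
        qed
        have "F \<sigma> \<ge> b - a \<or> F (\<tau> \<sigma>) \<ge> b - a"
        proof (cases "(n \<in> \<sigma>) = (m \<in> \<sigma>)")
          case True
          then have "(n \<in> \<tau> \<sigma>) \<noteq> (m \<in> \<tau> \<sigma>)" using nm by (simp add: \<tau>_def)
          then show ?thesis using big by blast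
        qed (use big in blast)
        moreover have "F \<sigma> \<ge> 0" "F (\<tau> \<sigma>) \<ge> 0" by (auto simp: F_def)
        ultimately show "b - a \<le> F \<sigma> + F (\<tau> \<sigma>)" by linarith
      qed
      finally show ?thesis by (simp add: M_def F_def[symmetric] card_Pow field_simps)
    qed
    moreover have "eventually (\<lambda>N. m < N) U" by (rule filter_leD[OF U(1) eventually_gt_at_top])
    ultimately have "eventually (\<lambda>N. (b - a) / 2 \<le> M N (\<lambda>x. \<bar>h n x - h m x\<bar>)) U"
      by (auto elim: eventually_mono)
    then show ?thesis
      by (rule tendsto_lowerbound[OF lim _ Unb, rotated]) (intro continuous_on_rabs
          continuous_on_diff hcf)
  qed
  have ev: "eventually (\<lambda>n. Ls n \<in> finite_means) U" using Ls(1) by simp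
  have pos_ba: "(b - a) / 2 > 0" using ab by simp
  obtain A where A: "eventually A U \<and> (\<forall>i. A i \<longrightarrow> Ls i \<in> finite_means) \<and>
    (\<forall>i j. A i \<longrightarrow> A j \<longrightarrow> \<mu> (\<lambda>x. \<bar>avg (Ls i) f x - avg (Ls j) f x\<bar>) < (b - a) / 2)"
    using finite_mean_Cauchy[OF U(2) ev \<mu> f pos_ba] ..
  then have evA: "eventually A U" and A2: "\<forall>i j. A i \<longrightarrow> A j \<longrightarrow>
      \<mu> (\<lambda>x. \<bar>avg (Ls i) f x - avg (Ls j) f x\<bar>) < (b - a) / 2"
    by simp_all
  obtain n where n: "A n" using eventually_happens'[OF Unb evA] ..
  have "eventually (\<lambda>m. n < m \<and> A m) U"
    by (intro eventually_conj evA filter_leD[OF U(1) eventually_gt_at_top])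
  then obtain m where m: "n < m \<and> A m" using eventually_happens'[OF Unb] by blast
  then show False using sep[of n m] A2[rule_format, OF n, of m] by (simp add: h_def)
qed

end

section \<open>Invariant functionals\<close>

text \<open>
  A nonzero positive functional has a point in its support. If there were none, finitely many
  nonnegative functions with value \<open>0\<close> under \<open>\<rho>\<close> would have a sum that is bounded below on \<open>X\<close>.
\<close>

lemma pos_fun_support:
  fixes \<rho> :: "('a::t2_space \<Rightarrow> real) \<Rightarrow> real"
  assumes K: "compact (UNIV :: 'a set)" and X: "closed X" and \<rho>: "pos_fun \<rho>"
    and supp: "\<And>v. cont v \<Longrightarrow> (\<And>x. x \<in> X \<Longrightarrow> v x = 0) \<Longrightarrow> \<rho> v = 0" and one: "\<rho> (\<lambda>_. 1) > 0"
  shows "\<exists>x\<in>X. \<forall>v. cont v \<longrightarrow> (\<forall>y. 0 \<le> v y) \<longrightarrow> 0 < v x \<longrightarrow> 0 < \<rho> v"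
proof (rule ccontr)
  assume "\<not> ?thesis"
  then have "\<forall>x\<in>X. \<exists>v. cont v \<and> (\<forall>y. 0 \<le> v y) \<and> 0 < v x \<and> \<not> 0 < \<rho> v" by blast
  then obtain v where v: "\<forall>x\<in>X. cont (v x) \<and> (\<forall>y. 0 \<le> v x y) \<and> 0 < v x x \<and> \<not> 0 < \<rho> (v x)"
    using bchoice[of X] by metis
  have cX: "compact X" using compact_Int_closed[OF K X] by simp
  have "X \<subseteq> (\<Union>x\<in>X. {y. 0 < v x y})" using v by auto
  then obtain I where I: "I \<subseteq> X" "finite I" "X \<subseteq> (\<Union>x\<in>I. {y. 0 < v x y})"
    by (rule compactE_image[OF cX, rotated]) (use v in \<open>auto intro!: open_Collect_less\<close>)
  define V where "V y = (\<Sum>x\<in>I. v x y)" for y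
  have vcf: "cont (v x)" if "x \<in> I" for x using that I v by blast
  have Vcf: "cont V" unfolding V_def by (intro continuous_on_sum vcf)
  have "\<rho> V = (\<Sum>x\<in>I. \<rho> (v x))" unfolding V_def
    by (rule lin_fun_sum[OF pos_fun_lin[OF \<rho>] I(2) vcf])
  also have "\<dots> \<le> 0" using v I(1) by (intro sum_nonpos) (auto simp: not_less)
  finally have \<rho>V: "\<rho> V \<le> 0" .
  have Vpos: "0 < V y" if "y \<in> X" for y
  proof -
    obtain x where "x \<in> I" "0 < v x y" using I(3) \<open>y \<in> X\<close> by auto
    then show ?thesis unfolding V_def using v I by (intro sum_pos2[of I x]) auto
  qed
  have "X \<noteq> {}" using supp[of "\<lambda>_. 1"] one by auto
  then obtain y0 where y0: "y0 \<in> X" "\<And>y. y \<in> X \<Longrightarrow> V y0 \<le> V y"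
    using continuous_attains_inf[OF cX] continuous_on_subset[OF Vcf] by (metis subset_UNIV)
  define d where "d = V y0"
  have d: "d > 0" using Vpos y0 by (simp add: d_def)
  let ?k = "\<lambda>y. max 0 (1 - (1/d) * V y)"
  have kcf: "cont ?k"
    by (intro continuous_on_max continuous_on_const continuous_on_diff continuous_on_mult_left Vcf)
  have "\<rho> ?k = 0"
  proof (rule supp[OF kcf])
    show "?k y = 0" if "y \<in> X" for y
      using y0(2)[OF that] d by (simp add: d_def field_simps)
  qed
  have "\<rho> (\<lambda>_. 1) \<le> \<rho> (\<lambda>y. (1/d) * V y + ?k y)"
    by (rule pos_fun_mono[OF \<rho> continuous_on_const])
       (intro continuous_on_add continuous_on_mult_left Vcf kcf, auto)
  also have "\<dots> = \<rho> (\<lambda>y. (1/d) * V y) + \<rho> ?k"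
    by (rule lin_fun_add[OF pos_fun_lin[OF \<rho>] _ kcf]) (intro continuous_on_mult_left Vcf)
  also have "\<dots> = (1/d) * \<rho> V" using \<open>\<rho> ?k = 0\<close> lin_fun_scale[OF pos_fun_lin[OF \<rho>] Vcf, of "1/d"]
      by simp
  also have "\<dots> \<le> 0" using \<rho>V d by (simp add: mult_nonneg_nonpos divide_nonpos_pos)
  finally show False using one by simp
qed

lemma minimal_set_exists:
  fixes C :: "'k::t2_space set"
  assumes K: "compact (UNIV :: 'k set)" and C: "closed C" "C \<noteq> {}" "invariant_set act C"
  obtains M where "minimal_set act M" "M \<subseteq> C"
proof -
  define \<A> where "\<A> = {D. D \<subseteq> C \<and> closed D \<and> D \<noteq> {} \<and> invariant_set act D}"
  have "\<exists>M\<in>\<A>. \<forall>D\<in>\<A>. D \<subseteq> M \<longrightarrow> D = M"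
  proof (rule predicate_Zorn[of \<A> "\<lambda>x y. y \<subseteq> x", simplified])
    show "partial_order_on \<A> (relation_of (\<lambda>x y. y \<subseteq> x) \<A>)"
      by (rule partial_order_on_relation_ofI) auto
    fix \<C> assume "\<C> \<in> Chains (relation_of (\<lambda>x y. y \<subseteq> x) \<A>)"
    then have CA: "\<C> \<subseteq> \<A>" and ch: "\<And>G H. G \<in> \<C> \<Longrightarrow> H \<in> \<C> \<Longrightarrow> G \<subseteq> H \<or> H \<subseteq> G"
      by (auto simp: Chains_def relation_of_def)
    show "\<exists>u\<in>\<A>. \<forall>a\<in>\<C>. u \<subseteq> a"
    proof (cases "\<C> = {}")
      case True
      then show ?thesis using C by (auto simp: \<A>_def)
    next
      case False
      have fin: "\<Inter>F \<in> \<C>" if "finite F" "F \<noteq> {}" "F \<subseteq> \<C>" for F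
        using that
      proof (induction F rule: finite_ne_induct)
        case (insert x F)
        then have "x \<in> \<C>" "\<Inter>F \<in> \<C>" by auto
        with ch[of x "\<Inter>F"] show ?case by (auto simp: Int_absorb1 Int_absorb2)
      qed auto
      have "UNIV \<inter> \<Inter>\<C> \<noteq> {}"
      proof (rule compact_imp_fip[OF K])
        show "closed T" if "T \<in> \<C>" for T using that CA by (auto simp: \<A>_def)
        show "UNIV \<inter> \<Inter>F \<noteq> {}" if "finite F" "F \<subseteq> \<C>" for F
          using fin[of F] that CA by (cases "F = {}") (auto simp: \<A>_def)
      qed
      moreover have "\<Inter>\<C> \<subseteq> C" using False CA by (auto simp: \<A>_def)
      moreover have "closed (\<Inter>\<C>)" using CA by (intro closed_Inter) (auto simp: \<A>_def)
      moreover have "invariant_set act (\<Inter>\<C>)" using CA unfolding invariant_set_def \<A>_def by blast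
      ultimately show ?thesis by (intro bexI[of _ "\<Inter>\<C>"]) (auto simp: \<A>_def)
    qed
  qed
  then obtain M where M: "M \<in> \<A>" "\<And>D. D \<in> \<A> \<Longrightarrow> D \<subseteq> M \<Longrightarrow> D = M" by blast
  have "minimal_set act M"
    unfolding minimal_set_def using M unfolding \<A>_def by blast
  with M(1) show ?thesis by (intro that) (auto simp: \<A>_def)
qed

context amenable_action
begin

text \<open>
  The mean of \<open>f\<close> along the orbit of \<open>x\<close>. Left invariance of the mean makes it an invariant
      functional
  of \<open>f\<close>, and right invariance makes it an invariant function of \<open>x\<close>.
\<close>

definition mean_at :: "('k \<Rightarrow> real) \<Rightarrow> 'k \<Rightarrow> real" where
  "mean_at f x = mean (\<lambda>s. f (act s x))"

lemma mean_at_orbit: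
  assumes "cont f"
  shows "mean_at f (act s x) = mean_at f x"
  unfolding mean_at_def act_mult[symmetric] by (rule mean_right[OF bounded_cont_orbit[OF assms]])

lemma mean_ultrafilter:
  "\<exists>V. ultrafilter V \<and> eventually (\<lambda>L. L \<in> finite_means) V \<and> (\<forall>\<phi>. bounded_cont \<phi> \<longrightarrow>
      ((\<lambda>L. L \<phi>) \<longlongrightarrow> mean \<phi>) V)"
proof -
  have *: "\<exists>L\<in>finite_means. \<forall>\<phi>\<in>J. dist (L \<phi>) (mean \<phi>) < e" if "finite J" "J \<subseteq> {\<phi>. bounded_cont \<phi>}"
      "e > 0" for J e
    unfolding dist_real_def by (rule finite_mean_dense[OF that(1) _ that(3)]) (use that(2) in auto)
  obtain V where "ultrafilter V" "eventually (\<lambda>L. L \<in> finite_means) V"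
    "\<And>\<phi>. \<phi> \<in> {\<phi>. bounded_cont \<phi>} \<Longrightarrow> ((\<lambda>L. L \<phi>) \<longlongrightarrow> mean \<phi>) V"
    by (rule finite_approx_ultrafilter[of "{\<phi>. bounded_cont \<phi>}" finite_means "\<lambda>\<phi> L. L \<phi>" mean,
        OF *]) auto
  then show ?thesis by (intro exI[of _ V]) simp
qed

abbreviation "orbit_closure x \<equiv> closure (range (\<lambda>s. act s x))"

lemma orbit_closure_minimum: "closed C \<Longrightarrow> invariant_set act C \<Longrightarrow> x \<in> C \<Longrightarrow> orbit_closure x \<subseteq> C"
  by (rule closure_minimal) (auto simp: invariant_set_def)

lemma orbit_closure_invariant: "invariant_set act (orbit_closure x)"
  unfolding invariant_set_def
proof
  fix s
  have "act s ` orbit_closure x \<subseteq> closure (act s ` range (\<lambda>s. act s x))"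
    by (rule continuous_image_closure_subset[OF act_cont_right]) auto
  also have "\<dots> \<subseteq> orbit_closure x" by (rule closure_mono) (auto simp flip: act_mult)
  finally show "act s ` orbit_closure x \<subseteq> orbit_closure x" .
qed

lemma minimal_set_dense_orbit:
  assumes "minimal_set act M" "y \<in> M"
  shows "orbit_closure y = M"
proof -
  have "orbit_closure y \<subseteq> M" using assms by (intro orbit_closure_minimum) (auto simp:
      minimal_set_def)
  moreover have "orbit_closure y \<noteq> {}" by simp
  ultimately show ?thesis
    using assms(1) orbit_closure_invariant[of y] unfolding minimal_set_def by blast
qed

text \<open>
  The Ellis semigroup of the action, as a set of arbitrary self-maps with the topology of pointwise
  convergence.
\<close>

definition enveloping :: "('k \<Rightarrow> 'k) set" where
  "enveloping = closure (range act)"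

lemma enveloping_maps:
  assumes "p \<in> enveloping" "closed C" "invariant_set act C" "x \<in> C"
  shows "p x \<in> C"
proof -
  have "closed ((\<lambda>p. p x) -` C)"
    by (rule closed_vimage[OF assms(2) continuous_on_product_coordinates])
  then have "enveloping \<subseteq> (\<lambda>p. p x) -` C"
    unfolding enveloping_def by (rule closure_minimal[rotated]) (use assms in \<open>auto simp:
        invariant_set_def\<close>)
  then show ?thesis using assms(1) by auto
qed

text \<open>
  Composition is continuous in its outer argument, but in its inner argument only if the outer one
  is a translation. The closure is therefore taken in two steps.
\<close>

lemma enveloping_comp:
  assumes p: "p \<in> enveloping" and q: "q \<in> enveloping"
  shows "(\<lambda>x. q (p x)) \<in> enveloping"
proof -
  have 1: "(\<lambda>x. act s (p x)) \<in> enveloping" for s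
  proof -
    have "closed ((\<lambda>p x. act s (p x)) -` enveloping)"
      by (intro closed_vimage continuous_on_coordinatewise_then_product
          continuous_on_compose2[OF act_cont_right continuous_on_product_coordinates]) (auto simp:
              enveloping_def)
    then have "enveloping \<subseteq> (\<lambda>p x. act s (p x)) -` enveloping"
      unfolding enveloping_def
    proof (rule closure_minimal[rotated])
      have "(\<lambda>x. act s (act t x)) = act (s * t)" for t by (simp add: act_mult fun_eq_iff)
      then show "range act \<subseteq> (\<lambda>p x. act s (p x)) -` closure (range act)"
        using subsetD[OF closure_subset rangeI[of act]] by (auto simp: enveloping_def)
    qed
    then show ?thesis using p by auto
  qed
  have "closed ((\<lambda>q x. q (p x)) -` enveloping)"
    by (intro closed_vimage continuous_on_coordinatewise_then_product
        continuous_on_product_coordinates) (auto simp: enveloping_def)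
  then have "enveloping \<subseteq> (\<lambda>q x. q (p x)) -` enveloping"
    unfolding enveloping_def by (rule closure_minimal[rotated]) (use 1 in \<open>auto simp:
        enveloping_def\<close>)
  then show ?thesis using q by auto
qed

lemma enveloping_hits:
  assumes "y \<in> orbit_closure x"
  obtains p where "p \<in> enveloping" "p x = y"
proof -
  have "compact (UNIV :: ('k \<Rightarrow> 'k) set)"
    using compact_space_product_topology[of "\<lambda>_::'k. euclidean :: 'k topology" UNIV] K
    by (simp add: euclidean_product_topology compact_space_def)
  then have "compact enveloping" unfolding enveloping_def using compact_Int_closed[of UNIV]
      by fastforce
  then have "compact ((\<lambda>p. p x) ` enveloping)"
    by (intro compact_continuous_image continuous_on_subset[OF continuous_on_product_coordinates])
        auto
  then have "orbit_closure x \<subseteq> (\<lambda>p. p x) ` enveloping"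
    by (intro closure_minimal compact_imp_closed) (use closure_subset[of "range act"] in \<open>auto
        simp: enveloping_def\<close>)
  then show ?thesis using assms that by auto
qed

lemma enveloping_approx:
  assumes "p \<in> enveloping" "finite Z" "cont g" "e > 0"
  shows "\<exists>s. \<forall>z\<in>Z. \<bar>g (act s z) - g (p z)\<bar> < e"
proof -
  define W where "W = (\<Inter>z\<in>Z. {q. \<bar>g (q z) - g (p z)\<bar> < e})"
  have "open W"
    unfolding W_def using assms(2)
    by (intro open_INT ballI open_Collect_less continuous_on_rabs continuous_on_diff
        continuous_on_const
        continuous_on_compose2[OF assms(3) continuous_on_product_coordinates]) auto
  moreover have "p \<in> W" using assms(4) by (simp add: W_def)
  ultimately have "W \<inter> range act \<noteq> {}"
    using assms(1) open_Int_closure_eq_empty[of W "range act"] by (auto simp: enveloping_def)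
  then show ?thesis by (auto simp: W_def)
qed

end

context tame_action
begin

text \<open>
  Orbits are dense in a minimal set, and the mean is constant along orbits. Two different means
  would give, inside every nonempty open piece, points at which all late averages are below \<open>a\<close> and
  points at which they are above \<open>b\<close>, so every piece could be split.
\<close>

lemma mean_at_not_less_minimal:
  assumes M: "minimal_set act M" and y: "y1 \<in> M" "y2 \<in> M" and f: "cont f"
  shows "\<not> mean_at f y1 < mean_at f y2"
proof
  assume lt: "mean_at f y1 < mean_at f y2"
  define a where "a = (2 * mean_at f y1 + mean_at f y2) / 3"
  define b where "b = (mean_at f y1 + 2 * mean_at f y2) / 3"
  have ab: "mean_at f y1 < a" "a < b" "b < mean_at f y2" using lt
      by (auto simp: a_def b_def field_simps)
  obtain V where "ultrafilter V \<and> eventually (\<lambda>L. L \<in> finite_means) V \<and> (\<forall>\<phi>. bounded_cont \<phi> \<longrightarrow>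
      ((\<lambda>L. L \<phi>) \<longlongrightarrow> mean \<phi>) V)"
    using mean_ultrafilter ..
  then have V: "ultrafilter V" "eventually (\<lambda>L. L \<in> finite_means) V"
      "\<And>\<phi>. bounded_cont \<phi> \<Longrightarrow> ((\<lambda>L. L \<phi>) \<longlongrightarrow> mean \<phi>) V"
    by simp_all
  have lim: "((\<lambda>L. avg L f x) \<longlongrightarrow> mean_at f x) V" for x
    unfolding avg_def mean_at_def by (rule V(3)[OF bounded_cont_orbit[OF f]])
  have inv: "act s ` M \<subseteq> M" for s using M by (auto simp: minimal_set_def invariant_set_def)
  define \<U> where "\<U> = {u. cont u \<and> (\<exists>y\<in>M. 0 < u y)}"
  have dense: "\<exists>s. 0 < u (act s y)" if "u \<in> \<U>" "y \<in> M" for u y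
  proof -
    obtain z where z: "z \<in> M" "0 < u z" using \<open>u \<in> \<U>\<close> by (auto simp: \<U>_def)
    have "open {x. 0 < u x}" using \<open>u \<in> \<U>\<close> by (intro open_Collect_less) (auto simp: \<U>_def)
    moreover have "z \<in> {x. 0 < u x} \<inter> orbit_closure y"
        using z minimal_set_dense_orbit[OF M \<open>y \<in> M\<close>] by simp
    ultimately have "{x. 0 < u x} \<inter> range (\<lambda>s. act s y) \<noteq> {}"
      using open_Int_closure_eq_empty by blast
    then show ?thesis by auto
  qed
  show False
  proof (rule no_independence[OF f ab(2), of "\<lambda>_. 1" \<U>])
    show "(\<lambda>_. 1) \<in> \<U>" using y by (auto simp: \<U>_def)
    show "\<exists>x. 0 < u x" if "u \<in> \<U>" for u using that by (auto simp: \<U>_def)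
    fix W assume W: "finite W" "W \<subseteq> \<U>"
    have "\<forall>u\<in>W. \<exists>s t. 0 < u (act s y1) \<and> 0 < u (act t y2)" using dense y W by blast
    then obtain s t where st: "\<forall>u\<in>W. 0 < u (act (s u) y1) \<and> 0 < u (act (t u) y2)" by metis
    have "eventually (\<lambda>L. L \<in> finite_means \<and> (\<forall>u\<in>W. avg L f (act (s u) y1) < a \<and>
        b < avg L f (act (t u) y2))) V"
    proof (intro eventually_conj V(2) eventually_ball_finite W(1) ballI)
      fix u
      have "((\<lambda>L. avg L f (act (s u) y1)) \<longlongrightarrow> mean_at f y1) V" using lim[of "act (s u) y1"]
          by (simp add: mean_at_orbit[OF f])
      then show "eventually (\<lambda>L. avg L f (act (s u) y1) < a) V" using ab
          by (auto dest: order_tendstoD)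
      have "((\<lambda>L. avg L f (act (t u) y2)) \<longlongrightarrow> mean_at f y2) V" using lim[of "act (t u) y2"]
          by (simp add: mean_at_orbit[OF f])
      then show "eventually (\<lambda>L. b < avg L f (act (t u) y2)) V" using ab
          by (auto dest: order_tendstoD)
    qed
    moreover have "V \<noteq> bot" using V(1) by (simp add: ultrafilter_def)
    ultimately obtain L where L: "L \<in> finite_means"
        "\<forall>u\<in>W. avg L f (act (s u) y1) < a \<and> b < avg L f (act (t u) y2)"
      by (auto dest!: eventually_happens')
    show "\<exists>L\<in>finite_means. \<forall>u\<in>W. (\<lambda>x. u x * max 0 (a - avg L f x)) \<in> \<U> \<and>
        (\<lambda>x. u x * max 0 (avg L f x - b)) \<in> \<U>"
    proof (intro bexI[OF _ L(1)] ballI conjI)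
      fix u assume u: "u \<in> W"
      then have ucf: "cont u" using W by (auto simp: \<U>_def)
      note c = continuous_on_mult[OF ucf continuous_on_max[OF continuous_on_const
          continuous_on_diff]]
      note avc = cont_avg[OF L(1) f]
      have "act (s u) y1 \<in> M" "act (t u) y2 \<in> M" using inv y by auto
      moreover have "0 < u (act (s u) y1) * max 0 (a - avg L f (act (s u) y1))"
        "0 < u (act (t u) y2) * max 0 (avg L f (act (t u) y2) - b)"
        using st L(2) u by (auto intro!: mult_pos_pos)
      ultimately show "(\<lambda>x. u x * max 0 (a - avg L f x)) \<in> \<U>"
          "(\<lambda>x. u x * max 0 (avg L f x - b)) \<in> \<U>"
        unfolding \<U>_def using c avc continuous_on_const by blast+
    qed
  qed
qed

lemma mean_at_const_minimal:
  "minimal_set act M \<Longrightarrow> y1 \<in> M \<Longrightarrow> y2 \<in> M \<Longrightarrow> cont f \<Longrightarrow> mean_at f y1 = mean_at f y2"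
  using mean_at_not_less_minimal[of M y1 y2 f] mean_at_not_less_minimal[of M y2 y1 f] by linarith

text \<open>
  A suitable element \<open>p\<close> of the enveloping semigroup moves the points of \<open>Z\<close> into \<open>M\<close>, one after the
  other: a point that has arrived in \<open>M\<close> stays there. On \<open>M\<close> the mean of \<open>f\<close> is constant,
      so an average
  of \<open>f\<close> is close to it on the finite set \<open>p ` Z\<close>. A translation close to \<open>p\<close> on \<open>Z\<close> takes this
  back to \<open>Z\<close>.
\<close>

lemma finite_collapse:
  assumes uni: "\<And>M'. minimal_set act M' \<Longrightarrow> M' \<subseteq> orbit_closure x \<Longrightarrow> M' = M"
      and M: "minimal_set act M" "M \<subseteq> orbit_closure x"
    and y: "y \<in> M" and Z: "finite Z" "Z \<subseteq> orbit_closure x" and f: "cont f" and e: "e > 0"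
  shows "\<exists>L\<in>finite_means. \<forall>z\<in>Z. \<bar>avg L f z - mean_at f y\<bar> < e"
proof -
  have Mci: "closed M" "invariant_set act M" using M(1) by (auto simp: minimal_set_def)
  have hit: "\<exists>q\<in>enveloping. q u \<in> M" if u: "u \<in> orbit_closure x" for u
  proof -
    obtain M' where M': "minimal_set act M'" "M' \<subseteq> orbit_closure u"
      by (rule minimal_set_exists[OF K, of "orbit_closure u" act]) (use orbit_closure_invariant in
          auto)
    moreover have "orbit_closure u \<subseteq> orbit_closure x"
        by (rule orbit_closure_minimum[OF _ orbit_closure_invariant u]) simp
    ultimately have "M' = M" using uni by blast
    then have "y \<in> orbit_closure u" using M' y by blast
    then show ?thesis using y by (metis enveloping_hits)
  qed
  have "\<exists>p\<in>enveloping. \<forall>z\<in>Z. p z \<in> M"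
    using Z
  proof (induction Z rule: finite_induct)
    case empty
    have "act undefined \<in> enveloping" using closure_subset[of "range act"]
        by (auto simp: enveloping_def)
    then show ?case by auto
  next
    case (insert u Z)
    then obtain p where p: "p \<in> enveloping" "\<forall>z\<in>Z. p z \<in> M" by auto
    have "p u \<in> orbit_closure x" using insert.prems
        by (intro enveloping_maps[OF p(1) _ orbit_closure_invariant]) auto
    from hit[OF this] obtain q where q: "q \<in> enveloping" "q (p u) \<in> M" by blast
    have "q (p z) \<in> M" if "z \<in> Z" for z using enveloping_maps[OF q(1) Mci] p(2) that by blast
    then show ?case using enveloping_comp[OF p(1) q(1)] q(2)
        by (intro bexI[of _ "\<lambda>x. q (p x)"]) auto
  qed
  then obtain p where p: "p \<in> enveloping" "\<forall>z\<in>Z. p z \<in> M" by blast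
  obtain V where "ultrafilter V \<and> eventually (\<lambda>L. L \<in> finite_means) V \<and> (\<forall>\<phi>. bounded_cont \<phi> \<longrightarrow>
      ((\<lambda>L. L \<phi>) \<longlongrightarrow> mean \<phi>) V)"
    using mean_ultrafilter ..
  then have V: "ultrafilter V" "eventually (\<lambda>L. L \<in> finite_means) V"
      "\<And>\<phi>. bounded_cont \<phi> \<Longrightarrow> ((\<lambda>L. L \<phi>) \<longlongrightarrow> mean \<phi>) V"
    by simp_all
  have e2: "e / 2 > 0" using e by simp
  have "eventually (\<lambda>L. L \<in> finite_means \<and> (\<forall>z\<in>Z. \<bar>avg L f (p z) - mean_at f y\<bar> < e / 2)) V"
  proof (intro eventually_conj V(2) eventually_ball_finite Z(1) ballI)
    fix z assume z: "z \<in> Z"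
    have "((\<lambda>L. avg L f (p z)) \<longlongrightarrow> mean_at f (p z)) V"
      unfolding avg_def mean_at_def by (rule V(3)[OF bounded_cont_orbit[OF f]])
    moreover have "mean_at f (p z) = mean_at f y" using p(2) z y
        by (intro mean_at_const_minimal[OF M(1) _ _ f]) auto
    ultimately have "((\<lambda>L. avg L f (p z)) \<longlongrightarrow> mean_at f y) V" by simp
    from tendstoD[OF this e2] show "eventually (\<lambda>L. \<bar>avg L f (p z) - mean_at f y\<bar> < e / 2) V"
      by (simp only: dist_real_def)
  qed
  moreover have "V \<noteq> bot" using V(1) by (simp add: ultrafilter_def)
  ultimately obtain L where L: "L \<in> finite_means" "\<forall>z\<in>Z. \<bar>avg L f (p z) - mean_at f y\<bar> < e / 2"
    by (auto dest!: eventually_happens')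
  obtain s where s: "\<forall>z\<in>Z. \<bar>avg L f (act s z) - avg L f (p z)\<bar> < e / 2"
    using enveloping_approx[OF p(1) Z(1) cont_avg[OF L(1) f] e2] by blast
  show ?thesis
  proof (intro bexI[OF _ finite_mean_shift[OF L(1)]] ballI)
    fix z assume "z \<in> Z"
    then show "\<bar>avg (\<lambda>\<phi>. L (\<lambda>t. \<phi> (t * s))) f z - mean_at f y\<bar> < e"
      using L(2) s unfolding avg_shift by (smt (verit) field_sum_of_halves)
  qed
qed

text \<open>
  All averages of \<open>f\<close> have the same value \<open>\<nu> f\<close> under \<open>\<nu>\<close>. Suppose that it is positive, although
  averages tend to \<open>0\<close> at each point of \<open>X\<close> along an ultrafilter. Let \<open>\<rho>\<close> be the limit of the
  functionals with densities \<open>(avg L f - e)\<^sup>+\<close>, which is not zero. A piece with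
  positive \<open>\<rho>\<close> can be split by a late average. On the one hand, averages are above \<open>b\<close> wherever
  \<open>\<rho>\<close> has its mass, because late averages differ little in the mean. On the other hand, at a point
  of the support of \<open>\<rho>\<close> they are eventually below \<open>a\<close>, hence also nearby. This contradicts the
  absence of independence.
\<close>

lemma pointwise_null_imp_nonpos:
  assumes X: "closed X" and \<nu>: "pos_fun \<nu>"
    and supp: "\<And>v. cont v \<Longrightarrow> (\<And>x. x \<in> X \<Longrightarrow> v x = 0) \<Longrightarrow> \<nu> v = 0"
    and inv: "\<And>g s. cont g \<Longrightarrow> \<nu> (\<lambda>x. g (act s x)) = \<nu> g"
    and f: "cont f"
    and null: "\<And>Z e. finite Z \<Longrightarrow> Z \<subseteq> X \<Longrightarrow> e > 0 \<Longrightarrow> \<exists>L\<in>finite_means. \<forall>z\<in>Z. \<bar>avg L f z\<bar> < e"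
  shows "\<nu> f \<le> 0"
proof (rule ccontr)
  assume "\<not> \<nu> f \<le> 0"
  then have \<nu>f: "\<nu> f > 0" by simp
  note lin = pos_fun_lin[OF \<nu>]
  define n1 where "n1 = \<nu> (\<lambda>_. 1)"
  have n1: "n1 \<ge> 0" unfolding n1_def by (rule pos_fun_nonneg[OF \<nu>]) auto
\<comment> \<open>The mass \<open>n1\<close> of \<open>\<nu>\<close> is arbitrary; this level leaves at least half of the value \<open>\<nu> f\<close> above it.\<close>
  define e where "e = \<nu> f / (2 * (n1 + 1))"
  have e: "e > 0" "e * n1 \<le> \<nu> f / 2" using \<nu>f n1 by (auto simp: e_def field_simps)
  have *: "\<exists>L\<in>finite_means. \<forall>z\<in>J. dist (avg L f z) 0 < d" if "finite J" "J \<subseteq> X" "d > 0" for J d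
    unfolding dist_real_def using null[OF that] by simp
  obtain V where V: "ultrafilter V" "eventually (\<lambda>L. L \<in> finite_means) V"
    "\<And>z. z \<in> X \<Longrightarrow> ((\<lambda>L. avg L f z) \<longlongrightarrow> 0) V"
    by (rule finite_approx_ultrafilter[of X finite_means "\<lambda>z L. avg L f z" "\<lambda>_. 0", OF *]) auto
  have Vnb: "V \<noteq> bot" using V(1) by (simp add: ultrafilter_def)
  obtain B where B: "0 \<le> B" "\<And>x. \<bar>f x\<bar> \<le> B" using cont_bounded[OF K f] by blast
  define w where "w L x = max 0 (avg L f x - e)" for L x
  have wcf: "cont (w L)" if "L \<in> finite_means" for L
    unfolding w_def by (intro continuous_on_max continuous_on_const continuous_on_diff cont_avg[OF
        that f])
  have w0: "0 \<le> w L x" for L x by (simp add: w_def)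
  have wB: "w L x \<le> B" if "L \<in> finite_means" for L x
  proof -
    have "\<bar>avg L f x\<bar> \<le> B" by (rule avg_abs_le[OF that B(2)])
    then show ?thesis using B(1) e(1) by (auto simp: w_def)
  qed
  have pw: "pos_fun (\<lambda>u. \<nu> (\<lambda>x. w L x * u x))" if "L \<in> finite_means" for L
    by (rule pos_fun_mult[OF \<nu> wcf[OF that] w0])
  have "eventually (\<lambda>L. pos_fun (\<lambda>u. \<nu> (\<lambda>x. w L x * u x)) \<and> \<nu> (\<lambda>x. w L x * 1) \<le> B * n1) V"
  proof (rule eventually_mono[OF V(2)])
    fix L :: "('s \<Rightarrow> real) \<Rightarrow> real" assume L: "L \<in> finite_means"
    have "\<nu> (w L) \<le> B * n1" unfolding n1_def by (rule pos_fun_le_const[OF \<nu> wcf[OF L] wB[OF L]])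
    then show "pos_fun (\<lambda>u. \<nu> (\<lambda>x. w L x * u x)) \<and> \<nu> (\<lambda>x. w L x * 1) \<le> B * n1"
      using pw[OF L] by simp
  qed
  from ultrafilter_limit_pos_fun[OF K V(1) this] obtain \<rho> where \<rho>: "pos_fun \<rho>"
    and lim: "\<And>u. cont u \<Longrightarrow> ((\<lambda>L. \<nu> (\<lambda>x. w L x * u x)) \<longlongrightarrow> \<rho> u) V" by blast
  have \<rho>I: "\<rho> u = l" if "cont u" "((\<lambda>L. \<nu> (\<lambda>x. w L x * u x)) \<longlongrightarrow> l) V" for u l
    using tendsto_unique[OF Vnb lim[OF that(1)] that(2)] .
  have \<rho>supp: "\<rho> v = 0" if v: "cont v" "\<And>x. x \<in> X \<Longrightarrow> v x = 0" for v
  proof (rule \<rho>I[OF v(1)])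
    have "eventually (\<lambda>L. 0 = \<nu> (\<lambda>x. w L x * v x)) V"
      using V(2)
    proof eventually_elim
      case (elim L)
      have "\<nu> (\<lambda>x. w L x * v x) = 0"
        by (rule supp) (intro continuous_on_mult wcf elim v, simp add: v)
      then show ?case by simp
    qed
    then show "((\<lambda>L. \<nu> (\<lambda>x. w L x * v x)) \<longlongrightarrow> 0) V"
      by (rule Lim_transform_eventually[OF tendsto_const])
  qed
  have \<rho>1: "\<rho> (\<lambda>_. 1) > 0"
  proof -
    have "eventually (\<lambda>L. \<nu> f / 2 \<le> \<nu> (\<lambda>x. w L x * 1)) V"
      using V(2)
    proof eventually_elim
      case (elim L)
      have "\<nu> (avg L f) = \<nu> f"
        using lin_fun_avg[OF elim lin f] by (simp add: inv[OF f] finite_mean_const[OF elim])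
      then have "\<nu> (\<lambda>x. avg L f x - e) = \<nu> f - e * n1"
        using lin_fun_diff[OF lin cont_avg[OF elim f] continuous_on_const,
            of e] lin_fun_const[OF lin, of e]
        by (simp add: n1_def)
      moreover have "\<nu> (\<lambda>x. avg L f x - e) \<le> \<nu> (w L)"
        by (rule pos_fun_mono[OF \<nu> _ wcf[OF elim]])
           (intro continuous_on_diff continuous_on_const cont_avg[OF elim f], simp add: w_def)
      ultimately show ?case using e(2) by simp
    qed
    then have "\<nu> f / 2 \<le> \<rho> (\<lambda>_. 1)" by (rule tendsto_lowerbound[OF lim[OF continuous_on_const] _
        Vnb])
    then show ?thesis using \<nu>f by simp
  qed
  define a where "a = e / 3"
  define b where "b = 2 * e / 3"
  have ab: "0 < a" "a < b" "0 < e - b" using e by (auto simp: a_def b_def)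
  define \<U> where "\<U> = {u. cont u \<and> (\<forall>x. 0 \<le> u x) \<and> 0 < \<rho> u}"
  have low: "eventually (\<lambda>L. (\<lambda>x. u x * max 0 (a - avg L f x)) \<in> \<U>) V" if "u \<in> \<U>" for u
  proof -
    have u: "cont u" "\<And>x. 0 \<le> u x" "0 < \<rho> u" using that by (auto simp: \<U>_def)
    have "\<exists>x\<in>X. \<forall>v. cont v \<longrightarrow> (\<forall>y. 0 \<le> v y) \<longrightarrow> 0 < v x \<longrightarrow> 0 < \<rho> (\<lambda>x. u x * v x)"
    proof (rule pos_fun_support[OF K X pos_fun_mult[OF \<rho> u(1,2)]])
      show "\<rho> (\<lambda>x. u x * v x) = 0" if "cont v" "\<And>x. x \<in> X \<Longrightarrow> v x = 0" for v
        by (rule \<rho>supp) (intro continuous_on_mult u that, simp add: that)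
    qed (use u in simp)
    then obtain x where x: "x \<in> X"
      "\<And>v. cont v \<Longrightarrow> (\<And>y. 0 \<le> v y) \<Longrightarrow> 0 < v x \<Longrightarrow> 0 < \<rho> (\<lambda>x. u x * v x)" by blast
    have "eventually (\<lambda>L. avg L f x < a) V" using V(3)[OF x(1)] ab(1) by (rule order_tendstoD)
    with V(2) show ?thesis
    proof eventually_elim
      case (elim L)
      have c: "cont (\<lambda>x. max 0 (a - avg L f x))"
        by (intro continuous_on_max continuous_on_const continuous_on_diff cont_avg[OF elim(1) f])
      have "0 < \<rho> (\<lambda>x. u x * max 0 (a - avg L f x))" by (rule x(2)[OF c]) (use elim in auto)
      moreover have "cont (\<lambda>x. u x * max 0 (a - avg L f x))" by (intro continuous_on_mult u c)
      ultimately show ?case by (simp add: \<U>_def u)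
    qed
  qed
  have high: "eventually (\<lambda>L. (\<lambda>x. u x * max 0 (avg L f x - b)) \<in> \<U>) V" if "u \<in> \<U>" for u
  proof -
    have u: "cont u" "\<And>x. 0 \<le> u x" "0 < \<rho> u" using that by (auto simp: \<U>_def)
    obtain C where C: "0 \<le> C" "\<And>x. \<bar>u x\<bar> \<le> C" using cont_bounded[OF K u(1)] by blast
\<comment> \<open>The error \<open>B * C * d\<close> from exchanging one late average for another has to stay below
  \<open>(e - b) * \<rho> u\<close>, the mass of the upper part.\<close>
    define d where "d = (e - b) * \<rho> u / (2 * (1 + B * C))"
    have BC: "0 \<le> B * C" using B C by simp
    have d: "d > 0" "B * C * d < (e - b) * \<rho> u"
    proof -
      have p: "0 < (e - b) * \<rho> u" using ab u by simp
      then show "d > 0" unfolding d_def using BC by (intro divide_pos_pos) auto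
      have "B * C * d \<le> (1 + B * C) * d" using \<open>d > 0\<close> by (intro mult_right_mono) auto
      also have "\<dots> = (e - b) * \<rho> u / 2" using BC by (simp add: d_def field_simps)
      also have "\<dots> < (e - b) * \<rho> u" using p by linarith
      finally show "B * C * d < (e - b) * \<rho> u" .
    qed
    obtain A where A: "eventually A V \<and> (\<forall>i. A i \<longrightarrow> i \<in> finite_means) \<and>
      (\<forall>i j. A i \<longrightarrow> A j \<longrightarrow> \<nu> (\<lambda>x. \<bar>avg i f x - avg j f x\<bar>) < d)"
      using finite_mean_Cauchy[OF V(1) V(2) \<nu> f d(1)] ..
    then have evA: "eventually A V" by simp
    from evA show ?thesis
    proof eventually_elim
      case (elim L)
      have L: "L \<in> finite_means" using A elim by blast
      have c: "cont (\<lambda>x. max 0 (avg L f x - b))"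
        by (intro continuous_on_max continuous_on_const continuous_on_diff cont_avg[OF L f])
      have uc: "cont (\<lambda>x. u x * max 0 (avg L f x - b))" by (intro continuous_on_mult u c)
      have "eventually (\<lambda>L'. (e - b) * \<nu> (\<lambda>x. w L' x * u x) - B * C * d
          \<le> \<nu> (\<lambda>x. w L' x * (u x * max 0 (avg L f x - b)))) V"
        using evA
      proof eventually_elim
        case (elim L')
        have L': "L' \<in> finite_means" using A elim by blast
        have dd: "\<nu> (\<lambda>x. \<bar>avg L f x - avg L' f x\<bar>) < d" using A elim \<open>A L\<close> by blast
        have c1: "cont (\<lambda>x. w L' x * u x)" by (intro continuous_on_mult wcf L' u)
        have c2: "cont (\<lambda>x. \<bar>avg L f x - avg L' f x\<bar>)"
          by (intro continuous_on_rabs continuous_on_diff cont_avg L L' f)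
        have c3: "cont (\<lambda>x. w L' x * (u x * max 0 (avg L f x - b)))"
            by (intro continuous_on_mult wcf L' uc)
        have "(e - b) * (w L' x * u x) \<le> w L' x * (u x * max 0 (avg L f x - b)) + (B * C) *
            \<bar>avg L f x - avg L' f x\<bar>" for x
        proof -
          let ?l = "avg L f x" and ?l' = "avg L' f x"
          have "(e - b) * w L' x \<le> w L' x * max 0 (?l' - b)"
            unfolding w_def using ab by (cases "?l' \<le>
                e") (auto simp: max_def mult.commute intro!: mult_right_mono)
          also have "\<dots> \<le> w L' x * (max 0 (?l - b) + \<bar>?l - ?l'\<bar>)"
            by (intro mult_left_mono w0) auto
          finally have "u x * ((e - b) * w L' x) \<le> u x * (w L' x * (max 0 (?l - b) + \<bar>?l - ?l'\<bar>))"
            by (rule mult_left_mono[OF _ u(2)])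
          also have "\<dots> = w L' x * (u x * max 0 (?l - b)) + (w L' x * u x) * \<bar>?l - ?l'\<bar>"
            by (simp add: algebra_simps)
          also have "(w L' x * u x) * \<bar>?l - ?l'\<bar> \<le> (B * C) * \<bar>?l - ?l'\<bar>"
            using wB[OF L', of x] C(2)[of x] u(2)[of x] w0 B(1)
                by (intro mult_right_mono mult_mono) auto
          finally show ?thesis by (simp add: algebra_simps)
        qed
        then have "\<nu> (\<lambda>x. (e - b) * (w L' x * u x))
            \<le> \<nu> (\<lambda>x. w L' x * (u x * max 0 (avg L f x - b)) + (B * C) * \<bar>avg L f x - avg L' f x\<bar>)"
          by (intro pos_fun_mono[OF \<nu>] continuous_on_add continuous_on_mult_left c1 c2 c3)
        also have "\<dots> = \<nu> (\<lambda>x. w L' x * (u x * max 0 (avg L f x - b))) + B * C *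
            \<nu> (\<lambda>x. \<bar>avg L f x - avg L' f x\<bar>)"
          using lin_fun_add[OF lin c3 continuous_on_mult_left[OF c2]] lin_fun_scale[OF lin c2]
              by simp
        also have "B * C * \<nu> (\<lambda>x. \<bar>avg L f x - avg L' f x\<bar>) \<le> B * C * d"
          using dd BC by (intro mult_left_mono) auto
        finally show ?case using lin_fun_scale[OF lin c1, of "e - b"] by simp
      qed
      then have "(e - b) * \<rho> u - B * C * d \<le> \<rho> (\<lambda>x. u x * max 0 (avg L f x - b))"
        by (rule tendsto_le[OF Vnb lim[OF uc] tendsto_diff[OF tendsto_mult_left[OF lim[OF u(1)]]
            tendsto_const]])
      then have "0 < \<rho> (\<lambda>x. u x * max 0 (avg L f x - b))" using d(2) by simp
      then show ?case using uc by (simp add: \<U>_def u)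
    qed
  qed
  show False
  proof (rule no_independence[OF f ab(2), of "\<lambda>_. 1" \<U>])
    show "(\<lambda>_. 1) \<in> \<U>" using \<rho>1 by (simp add: \<U>_def)
    show "\<exists>x. 0 < u x" if "u \<in> \<U>" for u
    proof (rule ccontr)
      assume "\<nexists>x. 0 < u x"
      then have "u = (\<lambda>_. 0)" using \<open>u \<in> \<U>\<close> by (auto simp: \<U>_def fun_eq_iff not_less antisym)
      then show False using \<open>u \<in> \<U>\<close> lin_fun_zero[OF pos_fun_lin[OF \<rho>]] by (simp add: \<U>_def)
    qed
    fix W assume W: "finite W" "W \<subseteq> \<U>"
    have "eventually (\<lambda>L. L \<in> finite_means \<and> (\<forall>u\<in>W. (\<lambda>x. u x * max 0 (a - avg L f x)) \<in> \<U> \<and>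
        (\<lambda>x. u x * max 0 (avg L f x - b)) \<in> \<U>)) V"
      by (intro eventually_conj V(2) eventually_ball_finite W(1) ballI low high) (use W(2) in auto)
    from eventually_happens'[OF Vnb this]
    show "\<exists>L\<in>finite_means. \<forall>u\<in>W. (\<lambda>x. u x * max 0 (a - avg L f x)) \<in> \<U> \<and>
        (\<lambda>x. u x * max 0 (avg L f x - b)) \<in> \<U>"
      by blast
  qed
qed

text \<open>
  The averages of \<open>f\<close> come close to the constant on finite sets, so the previous lemma applies to
      the
  difference of \<open>f\<close> and the constant, with either sign.
\<close>

theorem invariant_functional_unique:
  assumes uni: "\<And>M'. minimal_set act M' \<Longrightarrow> M' \<subseteq> orbit_closure x \<Longrightarrow> M' = M"
      and M: "minimal_set act M" "M \<subseteq> orbit_closure x"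
    and y: "y \<in> M" and \<nu>: "pos_fun \<nu>" and one: "\<nu> (\<lambda>_. 1) = 1"
    and supp: "\<And>v. cont v \<Longrightarrow> (\<And>z. z \<in> orbit_closure x \<Longrightarrow> v z = 0) \<Longrightarrow> \<nu> v = 0"
    and inv: "\<And>g s. cont g \<Longrightarrow> \<nu> (\<lambda>x. g (act s x)) = \<nu> g"
    and f: "cont f"
  shows "\<nu> f = mean_at f y"
proof -
  note lin = pos_fun_lin[OF \<nu>]
  have c: "\<nu> (\<lambda>_. mean_at f y) = mean_at f y" using lin_fun_const[OF lin, of "mean_at f y"] one
      by simp
  have "\<nu> (\<lambda>x. f x - mean_at f y) \<le> 0"
  proof (rule pointwise_null_imp_nonpos[OF closed_closure \<nu> supp inv])
    fix Z and e :: real assume "finite Z" "Z \<subseteq> orbit_closure x" "e > 0"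
    then obtain L where L: "L \<in> finite_means" "\<forall>z\<in>Z. \<bar>avg L f z - mean_at f y\<bar> < e"
      using finite_collapse[OF uni M y _ _ f] by blast
    then show "\<exists>L\<in>finite_means. \<forall>z\<in>Z. \<bar>avg L (\<lambda>x. f x - mean_at f y) z\<bar> < e"
      by (intro bexI[OF _ L(1)]) (simp add: avg_diff avg_const)
  qed (auto intro!: continuous_on_diff f)
  moreover have "\<nu> (\<lambda>x. mean_at f y - f x) \<le> 0"
  proof (rule pointwise_null_imp_nonpos[OF closed_closure \<nu> supp inv])
    fix Z and e :: real assume "finite Z" "Z \<subseteq> orbit_closure x" "e > 0"
    then obtain L where L: "L \<in> finite_means" "\<forall>z\<in>Z. \<bar>avg L f z - mean_at f y\<bar> < e"
      using finite_collapse[OF uni M y _ _ f] by blast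
    then show "\<exists>L\<in>finite_means. \<forall>z\<in>Z. \<bar>avg L (\<lambda>x. mean_at f y - f x) z\<bar> < e"
      by (intro bexI[OF _ L(1)]) (simp add: avg_diff avg_const abs_minus_commute)
  qed (auto intro!: continuous_on_diff f)
  ultimately show ?thesis
    using lin_fun_diff[OF lin f continuous_on_const, of "mean_at f y"]
      lin_fun_diff[OF lin continuous_on_const f, of "mean_at f y"] c by simp
qed

end

section \<open>Asymptotically invariant ultrafilters\<close>

text \<open>
  The total variation of \<open>\<psi>\<close>. For a nonnegative function it is the supremum \<open>P\<close> of the values of
  \<open>\<psi>\<close> at dominated functions. It is additive since a function dominated by \<open>f + g\<close> splits
  into its truncation \<open>k1\<close> at \<open>f\<close> and a rest dominated by \<open>g\<close>; differences of nonnegative functions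
  then give the linear extension.
\<close>

lemma dominating_pos_fun:
  fixes \<psi> :: "('a::topological_space \<Rightarrow> real) \<Rightarrow> real"
  assumes K: "compact (UNIV :: 'a set)" and \<psi>: "bdd_fun \<psi>"
  obtains \<mu> where "pos_fun \<mu>" "\<And>g. cont g \<Longrightarrow> \<bar>\<psi> g\<bar> \<le> \<mu> (\<lambda>x. \<bar>g x\<bar>)"
proof -
  note lin = bdd_fun_lin[OF \<psi>]
  define P where "P f = Sup (\<psi> ` {g. cont g \<and> (\<forall>x. \<bar>g x\<bar> \<le> f x)})" for f :: "'a \<Rightarrow> real"
  have upper: "\<psi> g \<le> P f" if fg: "cont f" "cont g" "\<And>x. \<bar>g x\<bar> \<le> f x" for f g
  proof -
    obtain B where B: "\<And>g e. cont g \<Longrightarrow> (\<And>x. \<bar>g x\<bar> \<le> e) \<Longrightarrow> \<bar>\<psi> g\<bar> \<le> B * e"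
      using \<psi> by (auto simp: bdd_fun_def)
    obtain C where C: "\<And>x. \<bar>f x\<bar> \<le> C" using cont_bounded[OF K fg(1)] by blast
    have "bdd_above (\<psi> ` {g. cont g \<and> (\<forall>x. \<bar>g x\<bar> \<le> f x)})"
    proof (rule bdd_aboveI2)
      fix g assume g: "g \<in> {g. cont g \<and> (\<forall>x. \<bar>g x\<bar> \<le> f x)}"
      have "\<bar>g x\<bar> \<le> C" for x using g C[of x] by (metis (mono_tags,
          lifting) abs_ge_self mem_Collect_eq order_trans)
      with B[of g C] g show "\<psi> g \<le> B * C" by auto
    qed
    then show ?thesis unfolding P_def using fg by (intro cSup_upper) auto
  qed
  have least: "P f \<le> c" if "\<And>x. 0 \<le> f x" "\<And>g. cont g \<Longrightarrow> (\<And>x. \<bar>g x\<bar> \<le> f x) \<Longrightarrow> \<psi> g \<le> c" for f c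
    unfolding P_def
  proof (rule cSup_least)
    have "(\<lambda>_. 0) \<in> {g. cont g \<and> (\<forall>x. \<bar>g x\<bar> \<le> f x)}" using that(1) by simp
    then show "\<psi> ` {g. cont g \<and> (\<forall>x. \<bar>g x\<bar> \<le> f x)} \<noteq> {}" by blast
  qed (use that(2) in auto)
  have P0: "0 \<le> P f" if "cont f" "\<And>x. 0 \<le> f x" for f
    using upper[OF that(1), of "\<lambda>_. 0"] that(2) lin_fun_zero[OF lin] by simp
  have Padd: "P (\<lambda>x. f x + g x) = P f + P g"
    if f: "cont f" "\<And>x. 0 \<le> f x" and g: "cont g" "\<And>x. 0 \<le> g x" for f g
  proof (rule antisym)
    show "P (\<lambda>x. f x + g x) \<le> P f + P g"
    proof (rule least)
      show "0 \<le> f x + g x" for x using f g by (simp add: add_nonneg_nonneg)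
      fix k assume k: "cont k" "\<And>x. \<bar>k x\<bar> \<le> f x + g x"
      define k1 where "k1 x = max (min (k x) (f x)) (- f x)" for x
      have k1: "cont k1" unfolding k1_def by (intro continuous_on_max continuous_on_min
          continuous_on_minus f k)
      have "\<bar>k1 x\<bar> \<le> f x" for x using f(2)[of x] by (auto simp: k1_def)
      then have "\<psi> k1 \<le> P f" by (rule upper[OF f(1) k1])
      moreover have "\<bar>k x - k1 x\<bar> \<le> g x" for x using k(2)[of x] f(2)[of x] g(2)[of x]
          by (auto simp: k1_def max_def min_def)
      then have "\<psi> (\<lambda>x. k x - k1 x) \<le> P g" by (rule upper[OF g(1) continuous_on_diff[OF k(1) k1]])
      ultimately show "\<psi> k \<le> P f + P g" using lin_fun_diff[OF lin k(1) k1] by simp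
    qed
    have "P f \<le> P (\<lambda>x. f x + g x) - \<psi> k" if k: "cont k" "\<And>x. \<bar>k x\<bar> \<le> g x" for k
    proof (rule least[OF f(2)])
      fix l assume l: "cont l" "\<And>x. \<bar>l x\<bar> \<le> f x"
      have "\<psi> (\<lambda>x. l x + k x) \<le> P (\<lambda>x. f x + g x)"
      proof (rule upper)
        show "\<bar>l x + k x\<bar> \<le> f x + g x" for x using l(2)[of x] k(2)[of x] by linarith
      qed (intro continuous_on_add l k f g)+
      then show "\<psi> l \<le> P (\<lambda>x. f x + g x) - \<psi> k" using lin_fun_add[OF lin l(1) k(1)] by simp
    qed
    then have "P g \<le> P (\<lambda>x. f x + g x) - P f" by (intro least g) (simp add: algebra_simps)
    then show "P f + P g \<le> P (\<lambda>x. f x + g x)" by simp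
  qed
  have Ple: "P (\<lambda>x. c * f x) \<le> c * P f" if f: "cont f" "\<And>x. 0 \<le> f x" and c: "0 < c" for f c
  proof (rule least)
    show "0 \<le> c * f x" for x using f c by simp
    fix g assume g: "cont g" "\<And>x. \<bar>g x\<bar> \<le> c * f x"
    have gc: "cont (\<lambda>x. (1/c) * g x)" by (intro continuous_on_mult_left g)
    have "\<psi> (\<lambda>x. (1/c) * g x) \<le> P f"
    proof (rule upper[OF f(1) gc])
      show "\<bar>(1/c) * g x\<bar> \<le> f x" for x using g(2)[of x] c by (simp add: abs_mult field_simps)
    qed
    then have "(1/c) * \<psi> g \<le> P f" unfolding lin_fun_scale[OF lin g(1)] .
    then show "\<psi> g \<le> c * P f" using c by (simp add: pos_divide_le_eq mult.commute)
  qed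
  have Pscale: "P (\<lambda>x. c * f x) = c * P f" if f: "cont f" "\<And>x. 0 \<le> f x" and c: "0 < c" for f c
  proof (rule antisym[OF Ple[OF f c]])
    have "P (\<lambda>x. (1/c) * (c * f x)) \<le> (1/c) * P (\<lambda>x. c * f x)"
      by (rule Ple) (use f c in \<open>auto intro: continuous_on_mult_left\<close>)
    then show "c * P f \<le> P (\<lambda>x. c * f x)" using c by (simp add: field_simps)
  qed
  define \<mu> where "\<mu> f = P (\<lambda>x. max 0 (f x)) - P (\<lambda>x. max 0 (- f x))" for f
  have key: "\<mu> (\<lambda>x. a x - b x) = P a - P b"
    if a: "cont a" "\<And>x. 0 \<le> a x" and b: "cont b" "\<And>x. 0 \<le> b x" for a b
  proof -
    have "P (\<lambda>x. max 0 (a x - b x) + b x) = P (\<lambda>x. max 0 (- (a x - b x)) + a x)"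
      by (rule arg_cong[of _ _ P]) (auto simp: max_def)
    moreover have "P (\<lambda>x. max 0 (a x - b x) + b x) = P (\<lambda>x. max 0 (a x - b x)) + P b"
      by (intro Padd b continuous_on_max continuous_on_const continuous_on_diff a) auto
    moreover have "P (\<lambda>x. max 0 (- (a x - b x)) + a x) = P (\<lambda>x. max 0 (- (a x - b x))) + P a"
      by (intro Padd b continuous_on_max continuous_on_const continuous_on_minus
          continuous_on_diff a) auto
    ultimately show ?thesis by (simp add: \<mu>_def)
  qed
  have pn: "cont (\<lambda>x. max 0 (f x))" "cont (\<lambda>x. max 0 (- f x))" if "cont f" for f :: "'a \<Rightarrow> real"
    by (intro continuous_on_max continuous_on_const that,
        intro continuous_on_max continuous_on_const continuous_on_minus that)
  have \<mu>pos: "\<mu> f = P f" if "cont f" "\<And>x. 0 \<le> f x" for f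
  proof -
    have "P (\<lambda>_. 0) = 0"
      using Padd[of "\<lambda>_. 0" "\<lambda>_. 0"] by simp
    then show ?thesis using key[OF that, of "\<lambda>_. 0"] by simp
  qed
  have "pos_fun \<mu>"
    unfolding pos_fun_def lin_fun_def
  proof (intro conjI allI impI)
    fix f g :: "'a \<Rightarrow> real" and c assume f: "cont f"
    show "\<mu> (\<lambda>x. c * f x) = c * \<mu> f"
    proof (cases c "0::real" rule: linorder_cases)
      case less
      have "\<mu> (\<lambda>x. c * f x) = \<mu> (\<lambda>x. (- c) * max 0 (- f x) - (- c) * max 0 (f x))"
        by (rule arg_cong[of _ _ \<mu>]) (auto simp: max_def)
      also have "\<dots> = P (\<lambda>x. (- c) * max 0 (- f x)) - P (\<lambda>x. (- c) * max 0 (f x))"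
        using less by (intro key continuous_on_mult_left pn f mult_nonneg_nonneg) auto
      also have "\<dots> = (- c) * P (\<lambda>x. max 0 (- f x)) - (- c) * P (\<lambda>x. max 0 (f x))"
        using less by (intro arg_cong2[where f = "(-)"] Pscale pn f) auto
      finally show ?thesis by (simp add: \<mu>_def algebra_simps)
    next
      case equal
      then show ?thesis using \<mu>pos[of "\<lambda>_. 0"] Padd[of "\<lambda>_. 0" "\<lambda>_. 0"] by simp
    next
      case greater
      have "\<mu> (\<lambda>x. c * f x) = \<mu> (\<lambda>x. c * max 0 (f x) - c * max 0 (- f x))"
        by (rule arg_cong[of _ _ \<mu>]) (auto simp: max_def)
      also have "\<dots> = P (\<lambda>x. c * max 0 (f x)) - P (\<lambda>x. c * max 0 (- f x))"
        using greater by (intro key continuous_on_mult_left pn f mult_nonneg_nonneg) auto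
      also have "\<dots> = c * P (\<lambda>x. max 0 (f x)) - c * P (\<lambda>x. max 0 (- f x))"
        using greater by (intro arg_cong2[where f = "(-)"] Pscale pn f) auto
      finally show ?thesis by (simp add: \<mu>_def algebra_simps)
    qed
    assume g: "cont g"
    have "\<mu> (\<lambda>x. f x + g x) = \<mu> (\<lambda>x. (max 0 (f x) + max 0 (g x)) - (max 0 (- f x) + max 0 (- g x)))"
      by (rule arg_cong[of _ _ \<mu>]) (auto simp: max_def)
    also have "\<dots> = P (\<lambda>x. max 0 (f x) + max 0 (g x)) - P (\<lambda>x. max 0 (- f x) + max 0 (- g x))"
      by (intro key continuous_on_add pn f g add_nonneg_nonneg) auto
    also have "P (\<lambda>x. max 0 (f x) + max 0 (g x)) = P (\<lambda>x. max 0 (f x)) + P (\<lambda>x. max 0 (g x))"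
      by (intro Padd pn f g) auto
    also have "P (\<lambda>x. max 0 (- f x) + max 0 (- g x)) =
        P (\<lambda>x. max 0 (- f x)) + P (\<lambda>x. max 0 (- g x))"
      by (intro Padd pn f g) auto
    finally show "\<mu> (\<lambda>x. f x + g x) = \<mu> f + \<mu> g" by (simp add: \<mu>_def)
  next
    fix f :: "'a \<Rightarrow> real" assume "cont f" "\<forall>x. 0 \<le> f x"
    then show "0 \<le> \<mu> f" using \<mu>pos P0 by simp
  qed
  moreover have "\<bar>\<psi> g\<bar> \<le> \<mu> (\<lambda>x. \<bar>g x\<bar>)" if g: "cont g" for g
  proof -
    have a: "cont (\<lambda>x. \<bar>g x\<bar>)" by (intro continuous_on_rabs g)
    have m: "cont (\<lambda>x. - 1 * g x)" by (intro continuous_on_mult_left g)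
    have "\<psi> g \<le> P (\<lambda>x. \<bar>g x\<bar>)" by (rule upper[OF a g]) simp
    moreover have "\<psi> (\<lambda>x. - 1 * g x) \<le> P (\<lambda>x. \<bar>g x\<bar>)" by (rule upper[OF a m]) simp
    ultimately have "\<bar>\<psi> g\<bar> \<le> P (\<lambda>x. \<bar>g x\<bar>)" using lin_fun_scale[OF lin g, of "- 1"] by simp
    then show ?thesis using \<mu>pos[OF a] by simp
  qed
  ultimately show ?thesis by (rule that)
qed

text \<open>
  Spaces of continuous functions are hereditarily separable. A finite cover by basic open sets,
  with a rational number for each of them, describes a function up to \<open>2 / Suc n\<close>. There are only
  countably many such descriptions, and it suffices to choose one function in \<open>\<G>\<close> for each of those
  that occur.
\<close>

lemma countable_uniformly_dense:
  fixes \<G> :: "('a::topological_space \<Rightarrow> real) set" and \<B> :: "'a set set"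
  assumes K: "compact (UNIV :: 'a set)" and \<B>: "countable \<B>" "\<And>B. B \<in> \<B> \<Longrightarrow> open B"
      "\<And>U x. open U \<Longrightarrow> x \<in> U \<Longrightarrow> \<exists>B\<in>\<B>. x \<in> B \<and> B \<subseteq> U"
    and \<G>: "\<And>g. g \<in> \<G> \<Longrightarrow> cont g" "\<G> \<noteq> {}"
  obtains h :: "nat \<Rightarrow> 'a \<Rightarrow> real" where "range h \<subseteq> \<G>"
    "\<And>g e. g \<in> \<G> \<Longrightarrow> e > 0 \<Longrightarrow> \<exists>i. \<forall>x. \<bar>g x - h i x\<bar> < e"
proof -
  define N where "N = {W. finite W \<and> W \<subseteq> \<B> \<times> (UNIV :: rat set)} \<times> (UNIV :: nat set)"
  define P where "P = (\<lambda>(W :: ('a set \<times> rat) set, n :: nat) g. (\<forall>x::'a. \<exists>(B, q)\<in>W. x \<in> B) \<and>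
    (\<forall>(B, q)\<in>W. \<forall>x\<in>B. \<bar>g x - of_rat q\<bar> < (1::real) / real (Suc n)))"
  define pick where "pick = (\<lambda>w. SOME g. g \<in> \<G> \<and> P w g)"
  define D where "D = pick ` {w \<in> N. \<exists>g\<in>\<G>. P w g}"
  have pick: "pick w \<in> \<G> \<and> P w (pick w)" if "\<exists>g\<in>\<G>. P w g" for w
    unfolding pick_def using that by (intro someI_ex[of "\<lambda>g. g \<in> \<G> \<and> P w g"]) blast
  have "countable (\<B> \<times> (UNIV :: rat set))" by (rule countable_SIGMA[OF \<B>(1)]) simp
  then have "countable N"
    unfolding N_def by (rule countable_SIGMA[OF countable_Collect_finite_subset]) simp
  then have "countable {w \<in> N. \<exists>g\<in>\<G>. P w g}" by (rule countable_subset[rotated]) auto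
  then have cD: "countable D" unfolding D_def by (rule countable_image)
  have DG: "D \<subseteq> \<G>" using pick by (auto simp: D_def)
  have dense: "\<exists>k\<in>D. \<forall>x. \<bar>g x - k x\<bar> < e" if g: "g \<in> \<G>" and e: "e > 0" for g e
  proof -
    obtain n where n: "1 / real (Suc n) < e / 2" using e nat_approx_posE[of "e / 2"] by auto
    let ?d = "1 / real (Suc n)"
    have "\<exists>B q. B \<in> \<B> \<and> x \<in> B \<and> (\<forall>y\<in>B. \<bar>g y - of_rat q\<bar> < ?d)" for x
    proof -
      obtain q where q: "g x - ?d < of_rat q" "of_rat q < g x"
        using of_rat_dense[of "g x - ?d" "g x"] by auto
      have "open {y. \<bar>g y - of_rat q\<bar> < ?d}"
        by (intro open_Collect_less continuous_on_rabs continuous_on_diff continuous_on_const \<G> g)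
      from \<B>(3)[OF this, of x] q show ?thesis by (fastforce simp: abs_less_iff)
    qed
    then obtain Bx qx where Bq: "\<And>x. Bx x \<in> \<B>" "\<And>x. x \<in> Bx x"
        "\<And>x y. y \<in> Bx x \<Longrightarrow> \<bar>g y - of_rat (qx x)\<bar> < ?d"
      by metis
    have "(UNIV :: 'a set) \<subseteq> (\<Union>x\<in>UNIV. Bx x)" using Bq(2) by auto
    then obtain I where I: "finite I" "(UNIV :: 'a set) \<subseteq> (\<Union>x\<in>I. Bx x)"
      using compactE_image[OF K, of UNIV Bx] Bq(1) \<B>(2) by metis
    define W where "W = (\<lambda>x. (Bx x, qx x)) ` I"
    have "(W, n) \<in> N" using I(1) Bq(1) by (auto simp: N_def W_def)
    moreover have Pg: "P (W, n) g" unfolding P_def W_def using I(2) Bq(3) by auto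
    ultimately have "pick (W, n) \<in> D" using g by (auto simp: D_def)
    moreover have Pk: "P (W, n) (pick (W, n))" using pick Pg g by blast
    moreover have "\<bar>g x - pick (W, n) x\<bar> < e" for x
    proof -
      have "\<exists>(B, q)\<in>W. x \<in> B" using Pg unfolding P_def prod.case by blast
      then obtain B q where Bq: "(B, q) \<in> W" "x \<in> B" by auto
      have "\<bar>g x - of_rat q\<bar> < ?d" "\<bar>pick (W, n) x - of_rat q\<bar> < ?d"
        using Pg Pk Bq by (auto simp: P_def)
      then show ?thesis using n by linarith
    qed
    ultimately show ?thesis by blast
  qed
  obtain g0 where "g0 \<in> \<G>" using \<G>(2) by blast
  from dense[OF this, of 1] have "D \<noteq> {}" by auto
  then have r: "range (from_nat_into D) = D" using cD by (rule range_from_nat_into)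
  show ?thesis
  proof (rule that[of "from_nat_into D"])
    show "range (from_nat_into D) \<subseteq> \<G>" using r DG by simp
    fix g and e :: real assume "g \<in> \<G>" "e > 0"
    from dense[OF this] obtain k where "k \<in> D" "\<forall>x. \<bar>g x - k x\<bar> < e" by blast
    then show "\<exists>i. \<forall>x. \<bar>g x - from_nat_into D i x\<bar> < e" using r by (metis rangeE)
  qed
qed

context amenable_action
begin

text \<open>
  Joint continuity of the action and compactness of the space make \<open>s \<mapsto> (x \<mapsto> f (s x))\<close> continuous
  for the supremum norm.
\<close>

lemma orbit_functional_cont:
  assumes \<psi>: "bdd_fun \<psi>" and f: "cont f"
  shows "bounded_cont (\<lambda>s. \<psi> (\<lambda>x. f (act s x)))"
proof -
  obtain B where B: "\<And>f e. cont f \<Longrightarrow> (\<And>x. \<bar>f x\<bar> \<le> e) \<Longrightarrow> \<bar>\<psi> f\<bar> \<le> B * e"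
    using \<psi> by (auto simp: bdd_fun_def)
  obtain C where C: "\<And>x. \<bar>f x\<bar> \<le> C" using cont_bounded[OF K f] by blast
  have "\<bar>\<psi> (\<lambda>x. f (act s x))\<bar> \<le> B * C" for s by (rule B[OF cont_act[OF f] C])
  moreover have "cont (\<lambda>s. \<psi> (\<lambda>x. f (act s x)))"
    unfolding continuous_on_def
  proof (intro ballI, rule tendstoI)
    fix s and e :: real assume e: "e > 0"
    define d where "d = e / (2 * (\<bar>B\<bar> + 1))"
    have d: "d > 0" "B * d < e"
    proof -
      show "d > 0" using e by (simp add: d_def)
      have "B * d \<le> (\<bar>B\<bar> + 1) * d" using \<open>d > 0\<close> by (intro mult_right_mono) auto
      also have "\<dots> = e / 2" by (simp add: d_def field_simps)
      finally show "B * d < e" using e by simp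
    qed
    have "continuous_on (UNIV \<times> UNIV) (\<lambda>p. f (case p of (s, x) \<Rightarrow> act s x))"
      using continuous_on_compose2[OF f act_cont] by simp
    from continuous_on_prod_compactE[OF this K UNIV_I[of s] d(1)]
    obtain X where X: "s \<in> X" "open X" "\<forall>t\<in>X \<inter> UNIV. \<forall>x\<in>UNIV. dist (f (act t x)) (f (act s x)) \<le> d"
      unfolding prod.case by blast
    have "dist (\<psi> (\<lambda>x. f (act t x))) (\<psi> (\<lambda>x. f (act s x))) < e" if "t \<in> X" for t
    proof -
      have "\<bar>\<psi> (\<lambda>x. f (act t x) - f (act s x))\<bar> \<le> B * d"
      proof (rule B)
        show "cont (\<lambda>x. f (act t x) - f (act s x))" by (intro continuous_on_diff cont_act[OF f])
        show "\<bar>f (act t x) - f (act s x)\<bar> \<le> d" for x using X(3) that by (simp add: dist_real_def)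
      qed
      then show ?thesis
        using d lin_fun_diff[OF bdd_fun_lin[OF \<psi>] cont_act[OF f] cont_act[OF f], of t s]
            by (simp add: dist_real_def)
    qed
    then show "eventually (\<lambda>t. dist (\<psi> (\<lambda>x. f (act t x))) (\<psi> (\<lambda>x. f (act s x))) < e) (at s within
        UNIV)"
      using X(1,2) by (auto simp: eventually_at_topological)
  qed
  ultimately show ?thesis by blast
qed

text \<open>
  Averaging along such an ultrafilter becomes invariant in the weak topology of \<open>C(K)\<close>. Both kinds
      of
  ergodic nets are obtained from it.
\<close>

definition asymptotic :: "(('s \<Rightarrow> real) \<Rightarrow> real) filter \<Rightarrow> bool" where
  "asymptotic V \<longleftrightarrow> ultrafilter V \<and> eventually (\<lambda>L. L \<in> finite_means) V \<and>
    (\<forall>\<psi> g t. bdd_fun \<psi> \<longrightarrow> cont g \<longrightarrow> ((\<lambda>L. \<psi> (avg L (\<lambda>x. g x - g (act t x)))) \<longlongrightarrow> 0) V)"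

text \<open>
  Let \<open>u x\<close> tend to \<open>y\<close>. Averaging after the translation
      by \<open>u\<close> gives at \<open>x\<close>, in the limit of \<open>u\<close>, the
  averages at \<open>y\<close>. The iterated limit, first in \<open>u\<close>
      and then along the mean, is invariant because the
  mean is, and it is attained by finite means since only finitely many tests have to be met at a
  time.
\<close>

lemma asymptotic_ultrafilter:
  assumes y: "y \<in> orbit_closure x"
  shows "\<exists>V. asymptotic V \<and> (\<forall>f. cont f \<longrightarrow> ((\<lambda>L. avg L f x) \<longlongrightarrow> mean_at f y) V)"
proof -
  have ne: "filtercomap (\<lambda>s. act s x) (nhds y) \<noteq> bot"
  proof
    assume "filtercomap (\<lambda>s. act s x) (nhds y) = bot"
    then have "eventually (\<lambda>_. False) (filtercomap (\<lambda>s. act s x) (nhds y))" by simp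
    then obtain S where S: "open S" "y \<in> S" "\<And>s. act s x \<notin> S"
      by (auto simp: eventually_filtercomap_nhds)
    then have "S \<inter> range (\<lambda>s. act s x) = {}" by auto
    then show False using S y open_Int_closure_eq_empty by blast
  qed
  then obtain U where U: "U \<le> filtercomap (\<lambda>s. act s x) (nhds y)" "ultrafilter U"
      by (rule ultrafilter_ex)
  have Unb: "U \<noteq> bot" using U by (simp add: ultrafilter_def)
  have Uy: "((\<lambda>s. act s x) \<longlongrightarrow> y) U"
    by (rule filterlim_mono[OF filterlim_filtercomap order_refl U(1)])
  have "\<exists>\<nu>. bdd_fun \<nu> \<and> (\<forall>g. cont g \<longrightarrow> ((\<lambda>u. \<psi> (\<lambda>x. g (act u x))) \<longlongrightarrow> \<nu> g) U)" if \<psi>: "bdd_fun \<psi>" for \<psi>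
  proof -
    note lin = bdd_fun_lin[OF \<psi>]
    obtain B where B: "\<And>f e. cont f \<Longrightarrow> (\<And>x. \<bar>f x\<bar> \<le> e) \<Longrightarrow> \<bar>\<psi> f\<bar> \<le> B * e"
      using \<psi> by (auto simp: bdd_fun_def)
    have "lin_fun (\<lambda>g. \<psi> (\<lambda>x. g (act u x)))" for u
      unfolding lin_fun_def by (simp add: lin_fun_add[OF lin cont_act cont_act] lin_fun_scale[OF
          lin cont_act])
    moreover have "\<bar>\<psi> (\<lambda>x. g (act u x))\<bar> \<le> B * e" if "cont g" "\<forall>x. \<bar>g x\<bar> \<le> e" for g u e
      by (rule B[OF cont_act[OF that(1)]]) (use that(2) in simp)
    ultimately show ?thesis by (intro ultrafilter_limit_bdd_fun[OF K U(2), of _ B]) simp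
  qed
  then obtain q where qbdd: "\<And>\<psi>. bdd_fun \<psi> \<Longrightarrow> bdd_fun (q \<psi>)"
    and qlim: "\<And>\<psi> g. bdd_fun \<psi> \<Longrightarrow> cont g \<Longrightarrow> ((\<lambda>u. \<psi> (\<lambda>x. g (act u x))) \<longlongrightarrow> q \<psi> g) U" by metis
  define l where "l = (\<lambda>(\<psi>, f). mean (\<lambda>s. q \<psi> (\<lambda>x. f (act s x))))"
  define I where "I = {(\<psi> :: ('k \<Rightarrow> real) \<Rightarrow> real, f :: 'k \<Rightarrow> real). bdd_fun \<psi> \<and> cont f}"
  have bcq: "bounded_cont (\<lambda>s. q \<psi> (\<lambda>x. f (act s x)))" if "bdd_fun \<psi>" "cont f" for \<psi> f
    by (rule orbit_functional_cont[OF qbdd[OF that(1)] that(2)])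
\<comment> \<open>The finite mean \<open>L\<close> is chosen before the translation \<open>u\<close>, in accordance with the iterated limit.\<close>
  have approx: "\<exists>L\<in>finite_means. \<forall>j\<in>J. dist (case j of (\<psi>, f) \<Rightarrow> \<psi> (avg L f)) (l j) < e"
    if J: "finite J" "J \<subseteq> I" and e: "e > 0" for J e
  proof -
    have e2: "e / 2 > 0" using e by simp
    have "\<exists>L\<in>finite_means. \<forall>\<phi>\<in>(\<lambda>(\<psi>, f) s. q \<psi> (\<lambda>x. f (act s x))) ` J. \<bar>L \<phi> - mean \<phi>\<bar> < e / 2"
      using J by (intro finite_mean_dense e2) (auto simp: I_def split: prod.splits intro!: bcq)
    then obtain L where L: "L \<in> finite_means"
      "\<And>\<psi> f. (\<psi>, f) \<in> J \<Longrightarrow> \<bar>L (\<lambda>s. q \<psi> (\<lambda>x. f (act s x))) - l (\<psi>, f)\<bar> < e / 2"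
      by (force simp: l_def)
    have "eventually (\<lambda>u. \<forall>j\<in>J. dist (case j of (\<psi>, f) \<Rightarrow> \<psi> (\<lambda>x. avg L f (act u x))) (l j) < e) U"
    proof (intro eventually_ball_finite J(1) ballI)
      fix j assume j: "j \<in> J"
      obtain \<psi> f where jj: "j = (\<psi>, f)" by (cases j)
      have \<psi>: "bdd_fun \<psi>" and f: "cont f" using j J(2) jj by (auto simp: I_def)
      have "((\<lambda>u. L (\<lambda>s. \<psi> (\<lambda>x. f (act s (act u x))))) \<longlongrightarrow> L (\<lambda>s. q \<psi> (\<lambda>x. f (act s x)))) U"
        by (rule finite_mean_tendsto[OF L(1)]) (rule qlim[OF \<psi> cont_act[OF f]])
      moreover have "L (\<lambda>s. \<psi> (\<lambda>x. f (act s (act u x)))) = \<psi> (\<lambda>x. avg L f (act u x))" for u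
        unfolding avg_def
        by (rule finite_mean_commute[OF L(1) bdd_fun_lin[OF \<psi>],
            symmetric]) (rule cont_act[OF cont_act[OF f]])
      ultimately have "((\<lambda>u. \<psi> (\<lambda>x. avg L f (act u x))) \<longlongrightarrow> L (\<lambda>s. q \<psi> (\<lambda>x. f (act s x)))) U" by simp
      from tendstoD[OF this e2]
      show "eventually (\<lambda>u. dist (case j of (\<psi>, f) \<Rightarrow> \<psi> (\<lambda>x. avg L f (act u x))) (l j) < e) U"
      proof eventually_elim
        case (elim u)
        moreover have "\<bar>L (\<lambda>s. q \<psi> (\<lambda>x. f (act s x))) - l j\<bar> < e / 2" using L(2)[of \<psi> f] j jj
            by simp
        ultimately show ?case unfolding jj prod.case dist_real_def by linarith
      qed
    qed
    from eventually_happens'[OF Unb this] obtain u where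
      u: "\<forall>j\<in>J. dist (case j of (\<psi>, f) \<Rightarrow> \<psi> (\<lambda>x. avg L f (act u x))) (l j) < e" ..
    have "avg (\<lambda>\<phi>. L (\<lambda>t. \<phi> (t * u))) f = (\<lambda>x. avg L f (act u x))" for f
      by (rule ext) (rule avg_shift)
    with u show ?thesis by (intro bexI[OF _ finite_mean_shift[OF L(1), of u]]) simp
  qed
  obtain V where V: "ultrafilter V" "eventually (\<lambda>L. L \<in> finite_means) V"
    "\<And>j. j \<in> I \<Longrightarrow> ((\<lambda>L. case j of (\<psi>, f) \<Rightarrow> \<psi> (avg L f)) \<longlongrightarrow> l j) V"
    by (rule finite_approx_ultrafilter[of I finite_means "\<lambda>j L. case j of (\<psi>, f) \<Rightarrow> \<psi> (avg L f)" l,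
        OF approx]) auto
  have Vlim: "((\<lambda>L. \<psi> (avg L f)) \<longlongrightarrow> mean (\<lambda>s. q \<psi> (\<lambda>x. f (act s x)))) V" if "bdd_fun \<psi>" "cont f"
      for \<psi> f
    using V(3)[of "(\<psi>, f)"] that by (simp add: I_def l_def)
  have inv: "((\<lambda>L. \<psi> (avg L (\<lambda>x. g x - g (act t x)))) \<longlongrightarrow> 0) V" if \<psi>: "bdd_fun \<psi>" and g: "cont g"
      for \<psi> g t
  proof -
    have "mean (\<lambda>s. q \<psi> (\<lambda>x. g (act t (act s x)))) = mean (\<lambda>s. q \<psi> (\<lambda>x. g (act s x)))"
      using mean_left[OF bcq[OF \<psi> g], of t] by (simp add: act_mult)
    then have "((\<lambda>L. \<psi> (avg L g) - \<psi> (avg L (\<lambda>x. g (act t x)))) \<longlongrightarrow> 0) V"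
      using tendsto_diff[OF Vlim[OF \<psi> g] Vlim[OF \<psi> cont_act[OF g, of t]]] by simp
    moreover have "eventually (\<lambda>L. \<psi> (avg L g) - \<psi> (avg L (\<lambda>x. g (act t x))) =
        \<psi> (avg L (\<lambda>x. g x - g (act t x)))) V"
    proof (rule eventually_mono[OF V(2)])
      fix L :: "('s \<Rightarrow> real) \<Rightarrow> real" assume L: "L \<in> finite_means"
      have "avg L (\<lambda>x. g x - g (act t x)) = (\<lambda>x. avg L g x - avg L (\<lambda>x. g (act t x)) x)"
        by (rule ext) (rule avg_diff[OF L])
      then show "\<psi> (avg L g) - \<psi> (avg L (\<lambda>x. g (act t x))) = \<psi> (avg L (\<lambda>x. g x - g (act t x)))"
        using lin_fun_diff[OF bdd_fun_lin[OF \<psi>] cont_avg[OF L g] cont_avg[OF L cont_act[OF g,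
            of t]]] by simp
    qed
    ultimately show ?thesis by (rule Lim_transform_eventually)
  qed
  have "asymptotic V" unfolding asymptotic_def using V(1,2) inv by simp
  moreover have "((\<lambda>L. avg L f x) \<longlongrightarrow> mean_at f y) V" if f: "cont f" for f
  proof -
    have \<delta>: "bdd_fun (\<lambda>f. f x)" unfolding bdd_fun_def lin_fun_def by (auto intro!: exI[of _ 1])
    have "q (\<lambda>f. f x) g = g y" if g: "cont g" for g
    proof (rule tendsto_unique[OF Unb qlim[OF \<delta> g]])
      have "isCont g y" using g by (simp add: continuous_on_eq_continuous_at)
      then show "((\<lambda>u. g (act u x)) \<longlongrightarrow> g y) U" by (rule isCont_tendsto_compose[OF _ Uy])
    qed
    then show ?thesis using Vlim[OF \<delta> f] by (simp add: mean_at_def cont_act[OF f])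
  qed
  ultimately show ?thesis by (intro exI[of _ V]) simp
qed

end

section \<open>Uniqueness of ergodic limits\<close>

context tame_action
begin

text \<open>
  A limit of averages at \<open>x\<close> along an ultrafilter is a normalised positive functional that lives on
  the orbit closure of \<open>x\<close>. If it is invariant, it is determined.
\<close>

lemma avg_tendsto_mean_at:
  fixes F :: "'i filter" and \<Lambda> :: "'i \<Rightarrow> ('s \<Rightarrow> real) \<Rightarrow> real"
  assumes finite_means: "eventually (\<lambda>i. \<Lambda> i \<in> finite_means) F"
    and inv: "\<And>g t. cont g \<Longrightarrow> ((\<lambda>i. avg (\<Lambda> i) (\<lambda>x. g x - g (act t x)) x) \<longlongrightarrow> 0) F"
    and uni: "\<And>M'. minimal_set act M' \<Longrightarrow> M' \<subseteq> orbit_closure x \<Longrightarrow> M' = M"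
        and M: "minimal_set act M" "M \<subseteq> orbit_closure x"
    and y: "y \<in> M" and f: "cont f"
  shows "((\<lambda>i. avg (\<Lambda> i) f x) \<longlongrightarrow> mean_at f y) F"
proof (rule tendsto_by_ultrafilter)
  fix U assume UF: "U \<le> F" and U: "ultrafilter U"
  have Unb: "U \<noteq> bot" using U by (simp add: ultrafilter_def)
  have FMU: "eventually (\<lambda>i. \<Lambda> i \<in> finite_means) U" by (rule filter_leD[OF UF finite_means])
  have "eventually (\<lambda>i. pos_fun (\<lambda>g. avg (\<Lambda> i) g x) \<and> avg (\<Lambda> i) (\<lambda>_. 1) x \<le> 1) U"
    by (rule eventually_mono[OF FMU]) (simp add: pos_fun_avg avg_const)
  from ultrafilter_limit_pos_fun[OF K U this] obtain \<nu> where \<nu>: "pos_fun \<nu>"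
    and lim: "\<And>g. cont g \<Longrightarrow> ((\<lambda>i. avg (\<Lambda> i) g x) \<longlongrightarrow> \<nu> g) U" by blast
  have \<nu>I: "\<nu> g = l" if "cont g" "((\<lambda>i. avg (\<Lambda> i) g x) \<longlongrightarrow> l) U" for g l
    by (rule tendsto_unique[OF Unb lim[OF that(1)] that(2)])
  have "\<nu> f = mean_at f y"
  proof (rule invariant_functional_unique[OF uni M y \<nu> _ _ _ f])
    show "\<nu> (\<lambda>_. 1) = 1"
    proof (rule \<nu>I[OF continuous_on_const], rule Lim_transform_eventually[OF tendsto_const])
      show "eventually (\<lambda>i. 1 = avg (\<Lambda> i) (\<lambda>_. 1) x) U"
        by (rule eventually_mono[OF FMU]) (rule avg_const[symmetric])
    qed
    show "\<nu> v = 0" if v: "cont v" "\<And>z. z \<in> orbit_closure x \<Longrightarrow> v z = 0" for v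
    proof (rule \<nu>I[OF v(1)], rule Lim_transform_eventually[OF tendsto_const])
      have "v (act s x) = 0" for s by (rule v(2)) (rule subsetD[OF closure_subset rangeI])
      then have z: "(\<lambda>s. v (act s x)) = (\<lambda>s. 0)" by simp
      show "eventually (\<lambda>i. 0 = avg (\<Lambda> i) v x) U"
        unfolding avg_def z by (rule eventually_mono[OF FMU]) (rule finite_mean_const[symmetric])
    qed
    show "\<nu> (\<lambda>x. g (act t x)) = \<nu> g" if g: "cont g" for g t
    proof (rule \<nu>I[OF cont_act[OF g]])
      have "((\<lambda>i. avg (\<Lambda> i) g x - avg (\<Lambda> i) (\<lambda>x. g x - g (act t x)) x) \<longlongrightarrow> \<nu> g - 0) U"
        by (intro tendsto_diff lim[OF g] tendsto_mono[OF UF inv[OF g]])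
      then have "((\<lambda>i. avg (\<Lambda> i) g x - avg (\<Lambda> i) (\<lambda>x. g x - g (act t x)) x) \<longlongrightarrow> \<nu> g) U" by simp
      then show "((\<lambda>i. avg (\<Lambda> i) (\<lambda>x. g (act t x)) x) \<longlongrightarrow> \<nu> g) U"
      proof (rule Lim_transform_eventually)
        show "eventually (\<lambda>i. avg (\<Lambda> i) g x - avg (\<Lambda> i) (\<lambda>x. g x - g (act t x)) x =
            avg (\<Lambda> i) (\<lambda>x. g (act t x)) x) U"
          by (rule eventually_mono[OF FMU]) (simp add: avg_diff)
      qed
    qed
  qed
  then show "((\<lambda>i. avg (\<Lambda> i) f x) \<longlongrightarrow> mean_at f y) U" using lim[OF f] by simp
qed

text \<open>
  Weak convergence to \<open>0\<close> improves to convergence in square mean. Late averages are close to each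
  other in the mean, so one factor of the square can be kept fixed while the other one tends to
  \<open>0\<close> weakly.
\<close>

lemma null_in_square_mean:
  assumes V: "ultrafilter V" "eventually (\<lambda>L. L \<in> finite_means) V" and \<mu>: "pos_fun \<mu>"
      and h: "cont h"
    and null: "\<And>\<psi>. bdd_fun \<psi> \<Longrightarrow> ((\<lambda>L. \<psi> (avg L h)) \<longlongrightarrow> 0) V" and e: "e > 0"
  shows "eventually (\<lambda>L. \<mu> (\<lambda>x. (avg L h x)\<^sup>2) < e) V"
proof -
  have Vnb: "V \<noteq> bot" using V by (simp add: ultrafilter_def)
  note lin = pos_fun_lin[OF \<mu>]
  obtain B where B: "0 \<le> B" "\<And>x. \<bar>h x\<bar> \<le> B" using cont_bounded[OF K h] by blast
  define d where "d = e / (2 * (B + 1))"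
  have d: "d > 0" "B * d \<le> e / 2" using e B(1) by (auto simp: d_def field_simps)
  obtain A where A: "eventually A V \<and> (\<forall>i. A i \<longrightarrow> i \<in> finite_means) \<and>
      (\<forall>i j. A i \<longrightarrow> A j \<longrightarrow> \<mu> (\<lambda>x. \<bar>avg i h x - avg j h x\<bar>) < d)"
    using finite_mean_Cauchy[OF V(1) V(2) \<mu> h d(1)] ..
  then have evA: "eventually A V" by simp
  show ?thesis
  proof (rule eventually_mono[OF evA])
    fix L assume AL: "A L"
    then have L: "L \<in> finite_means" using A by blast
    have Lcf: "cont (avg L h)" by (rule cont_avg[OF L h])
    have LB: "\<bar>avg L h x\<bar> \<le> B" for x by (rule avg_abs_le[OF L B(2)])
    have "((\<lambda>L'. \<mu> (\<lambda>x. avg L h x * avg L' h x)) \<longlongrightarrow> 0) V"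
      by (rule null[OF bdd_fun_mult[OF pos_fun_bdd[OF \<mu>] Lcf LB]])
    moreover have "e / 2 > 0" using e by simp
    ultimately have "eventually (\<lambda>L'. \<mu> (\<lambda>x. avg L h x * avg L' h x) < e / 2) V"
        by (rule order_tendstoD)
    with evA have "eventually (\<lambda>L'. A L' \<and> \<mu> (\<lambda>x. avg L h x * avg L' h x) < e / 2) V"
        by (rule eventually_conj)
    from eventually_happens'[OF Vnb this] obtain L' where
      L': "A L'" "\<mu> (\<lambda>x. avg L h x * avg L' h x) < e / 2" by blast
    then have "L' \<in> finite_means" using A by blast
    then have L'cont: "cont (avg L' h)" by (rule cont_avg[OF _ h])
    have close: "\<mu> (\<lambda>x. \<bar>avg L h x - avg L' h x\<bar>) < d" using A AL L'(1) by blast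
    have c1: "cont (\<lambda>x. avg L h x * avg L' h x)" by (intro continuous_on_mult Lcf L'cont)
    have c2: "cont (\<lambda>x. \<bar>avg L h x - avg L' h x\<bar>)"
        by (intro continuous_on_rabs continuous_on_diff Lcf L'cont)
    have "\<mu> (\<lambda>x. (avg L h x)\<^sup>2) \<le> \<mu> (\<lambda>x. avg L h x * avg L' h x + B * \<bar>avg L h x - avg L' h x\<bar>)"
    proof (rule pos_fun_mono[OF \<mu>])
      fix x
      have "(avg L h x)\<^sup>2 = avg L h x * avg L' h x + avg L h x * (avg L h x - avg L' h x)"
        by (simp add: power2_eq_square algebra_simps)
      also have "avg L h x * (avg L h x - avg L' h x) \<le> \<bar>avg L h x\<bar> * \<bar>avg L h x - avg L' h x\<bar>"
        by (metis abs_ge_self abs_mult)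
      also have "\<dots> \<le> B * \<bar>avg L h x - avg L' h x\<bar>" by (rule mult_right_mono[OF LB]) simp
      finally show "(avg L h x)\<^sup>2 \<le> avg L h x * avg L' h x + B * \<bar>avg L h x - avg L' h x\<bar>" by simp
    qed (intro continuous_on_power Lcf, intro continuous_on_add continuous_on_mult_left c1 c2)
    also have "\<dots> = \<mu> (\<lambda>x. avg L h x * avg L' h x) + B * \<mu> (\<lambda>x. \<bar>avg L h x - avg L' h x\<bar>)"
      using lin_fun_add[OF lin c1 continuous_on_mult_left[OF c2]] lin_fun_scale[OF lin c2] by simp
    also have "B * \<mu> (\<lambda>x. \<bar>avg L h x - avg L' h x\<bar>) \<le> B * d" using close B(1)
        by (intro mult_left_mono) auto
    finally show "\<mu> (\<lambda>x. (avg L h x)\<^sup>2) < e" using L'(2) d(2) by linarith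
  qed
qed

text \<open>
  The points at which \<open>w\<close> is not summable form a null set. In the absence of null sets, a small
  multiple of the partial sums of \<open>w\<close> is subtracted from \<open>k n\<close>: where the sums diverge, the positive
  part of the difference vanishes eventually, and elsewhere it tends to \<open>0\<close>. Since \<open>\<mu>\<close> is bounded on
  the partial sums, little is lost.
\<close>

lemma almost_everywhere_convergence:
  fixes w k :: "nat \<Rightarrow> 'k \<Rightarrow> real"
  assumes \<mu>: "pos_fun \<mu>" and w: "\<And>n. cont (w n)" "\<And>n x. 0 \<le> w n x" "\<And>n. \<mu> (w n) \<le> (1/2)^n"
    and k: "\<And>n. cont (k n)" "\<And>n x. 0 \<le> k n x" "\<And>n x. k n x \<le> B"
    and conv: "\<And>x. summable (\<lambda>n. w n x) \<Longrightarrow> (\<lambda>n. k n x) \<longlonglongrightarrow> 0"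
  shows "(\<lambda>n. \<mu> (k n)) \<longlonglongrightarrow> 0"
proof (rule LIMSEQ_I)
  note lin = pos_fun_lin[OF \<mu>]
  fix r :: real assume r: "r > 0"
  define \<eta> where "\<eta> = r / 4"
  have \<eta>: "\<eta> > 0" using r by (simp add: \<eta>_def)
  define s where "s n x = (\<Sum>j<n. w j x)" for n x
  have scf: "cont (s n)" for n unfolding s_def by (intro continuous_on_sum w)
  have s0: "0 \<le> s n x" for n x unfolding s_def by (intro sum_nonneg w)
  define k' where "k' n x = max 0 (k n x - \<eta> * s n x)" for n x
  have k'cont: "cont (k' n)" for n unfolding k'_def
    by (intro continuous_on_max continuous_on_const continuous_on_diff continuous_on_mult_left k
        scf)
  have k'le: "k' n x \<le> k n x" for n x using k(2)[of n x] s0[of n x] \<eta> by (auto simp: k'_def)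
  have k'0: "0 \<le> k' n x" for n x by (simp add: k'_def)
  have "(\<lambda>n. \<mu> (k' n)) \<longlonglongrightarrow> 0"
  proof (rule pos_fun_bounded_convergence[OF K \<mu> k'cont k'0])
    show "k' n x \<le> B" for n x using k'le[of n x] k(3)[of n x] by simp
    show "(\<lambda>n. k' n x) \<longlonglongrightarrow> 0" for x
    proof (cases "summable (\<lambda>n. w n x)")
      case True
      show ?thesis
        by (rule tendsto_sandwich[OF _ _ tendsto_const conv[OF True]]) (simp_all add: k'0 k'le)
    next
      case False
      have "\<not> (\<forall>n. s n x \<le> B / \<eta>)"
        using False summableI_nonneg_bounded[of "\<lambda>n. w n x" "B / \<eta>"] w(2) by (auto simp: s_def)
      then obtain N where N: "B / \<eta> < s N x" by (auto simp: not_le)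
      have "k' n x = 0" if "n \<ge> N" for n
      proof -
        have "s N x \<le> s n x" unfolding s_def using that by (intro sum_mono2 w) auto
        then have "B \<le> \<eta> * s n x" using N \<eta> by (simp add: pos_divide_less_eq mult.commute) (smt
            (verit) mult_left_mono)
        then show ?thesis using k(3)[of n x] by (simp add: k'_def)
      qed
      then show ?thesis by (intro tendsto_eventually) (auto simp: eventually_sequentially)
    qed
  qed
  then have "eventually (\<lambda>n. \<mu> (k' n) < \<eta>) sequentially" by (rule order_tendstoD[OF _ \<eta>])
  then obtain N where N: "\<And>n. n \<ge> N \<Longrightarrow> \<mu> (k' n) < \<eta>" by (auto simp: eventually_sequentially)
  have "norm (\<mu> (k n) - 0) < r" if "n \<ge> N" for n
  proof -
    have "\<mu> (k n) \<le> \<mu> (\<lambda>x. k' n x + \<eta> * s n x)"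
      by (rule pos_fun_mono[OF \<mu> k(1)]) (intro continuous_on_add continuous_on_mult_left k'cont
          scf, simp add: k'_def)
    also have "\<dots> = \<mu> (k' n) + \<eta> * \<mu> (s n)"
      using lin_fun_add[OF lin k'cont continuous_on_mult_left[OF scf]] lin_fun_scale[OF lin scf]
          by simp
    also have "\<mu> (s n) = (\<Sum>j<n. \<mu> (w j))" unfolding s_def by (rule lin_fun_sum[OF lin _ w(1)]) simp
    also have "\<dots> \<le> (\<Sum>j<n. (1/2)^j)" by (intro sum_mono w)
    also have "\<dots> \<le> 2" by (simp add: geometric_sum)
    finally have "\<mu> (k n) \<le> \<mu> (k' n) + \<eta> * 2" using \<eta> by (simp add: mult_left_mono)
    then have "\<mu> (k n) < r" using N[OF that] r by (simp add: \<eta>_def)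
    moreover have "0 \<le> \<mu> (k n)" by (rule pos_fun_nonneg[OF \<mu> k(1,2)])
    ultimately show ?thesis by simp
  qed
  then show "\<exists>no. \<forall>n\<ge>no. norm (\<mu> (k n) - 0) < r" by blast
qed

text \<open>
  From the two ultrafilters one selects sequences \<open>C\<close> and \<open>D\<close> of finite means whose averages of the
  functions \<open>g - g \<circ> t\<close>, or rather of a countable dense set \<open>h\<close> of them, tend to \<open>0\<close> in square mean
  so fast that the squares are summable. At a point where they are summable, both sequences are
  asymptotically invariant, so the averages of \<open>f\<close> along them have the same limit. By the preceding
  lemma, their difference tends to \<open>0\<close> in the mean with respect to a functional dominating \<open>\<psi>\<close>.
\<close>

theorem asymptotic_limit_unique:
  assumes \<B>: "countable \<B>" "\<And>B :: 'k set. B \<in> \<B> \<Longrightarrow> open B"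
      "\<And>(U :: 'k set) x. open U \<Longrightarrow> x \<in> U \<Longrightarrow> \<exists>B\<in>\<B>. x \<in> B \<and> B \<subseteq> U"
    and uni: "\<And>x. \<exists>!M. minimal_set act M \<and> M \<subseteq> orbit_closure x"
    and V: "asymptotic V" and V': "asymptotic V'" and \<psi>: "bdd_fun \<psi>" and f: "cont f"
    and c: "((\<lambda>L. \<psi> (avg L f)) \<longlongrightarrow> c) V" and c': "((\<lambda>L. \<psi> (avg L f)) \<longlongrightarrow> c') V'"
  shows "c = c'"
proof -
  obtain \<mu> where \<mu>: "pos_fun \<mu>" "\<And>g. cont g \<Longrightarrow> \<bar>\<psi> g\<bar> \<le> \<mu> (\<lambda>x. \<bar>g x\<bar>)"
    using dominating_pos_fun[OF K \<psi>] by blast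
  note lin = pos_fun_lin[OF \<mu>(1)]
  define \<G> where "\<G> = {(\<lambda>x. g x - g (act t x)) |g t. cont g}"
  have \<G>cont: "cont g" if "g \<in> \<G>" for g
    using that by (auto simp: \<G>_def intro!: continuous_on_diff cont_act)
  have "(\<lambda>x. g x - g (act undefined x)) \<in> \<G>" if "cont g" for g
    unfolding \<G>_def using that by blast
  from this[OF continuous_on_const] have "\<G> \<noteq> {}" by blast
  from countable_uniformly_dense[OF K \<B> \<G>cont this] obtain h :: "nat \<Rightarrow> 'k \<Rightarrow> real" where
    h: "range h \<subseteq> \<G>" "\<And>g e. g \<in> \<G> \<Longrightarrow> e > 0 \<Longrightarrow> \<exists>i. \<forall>x. \<bar>g x - h i x\<bar> < e"
    by metis
  have hcf: "cont (h i)" for i using h(1) \<G>cont by blast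
\<comment> \<open>The bound for the squares is divided by \<open>2 * Suc n\<close> because \<open>w n\<close> below collects \<open>Suc n\<close> of
    them from
  each of the two sequences.\<close>
  have seq: "\<exists>C. \<forall>n::nat. C n \<in> finite_means \<and> \<bar>\<psi> (avg (C n) f) - c\<bar> < 1 / real (Suc n) \<and>
      (\<forall>i\<le>n. \<mu> (\<lambda>x. (avg (C n) (h i) x)\<^sup>2) < (1/2)^n / (2 * real (Suc n)))"
    if V: "asymptotic V" and c: "((\<lambda>L. \<psi> (avg L f)) \<longlongrightarrow> c) V" for V c
  proof (rule choice, rule allI)
    fix n :: nat
    have u: "ultrafilter V" "eventually (\<lambda>L. L \<in> finite_means) V" using V
        by (auto simp: asymptotic_def)
    have nb: "V \<noteq> bot" using u by (simp add: ultrafilter_def)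
    have "eventually (\<lambda>L. L \<in> finite_means \<and> \<bar>\<psi> (avg L f) - c\<bar> < 1 / real (Suc n) \<and>
      (\<forall>i\<in>{..n}. \<mu> (\<lambda>x. (avg L (h i) x)\<^sup>2) < (1/2)^n / (2 * real (Suc n)))) V"
    proof (intro eventually_conj u(2) eventually_ball_finite ballI)
      have "1 / real (Suc n) > 0" by simp
      from tendstoD[OF c this] show "eventually (\<lambda>L. \<bar>\<psi> (avg L f) - c\<bar> < 1 / real (Suc n)) V"
        by (simp only: dist_real_def)
      fix i
      show "eventually (\<lambda>L. \<mu> (\<lambda>x. (avg L (h i) x)\<^sup>2) < (1/2)^n / (2 * real (Suc n))) V"
      proof (rule null_in_square_mean[OF u \<mu>(1) hcf])
        have "h i \<in> \<G>" using h(1) by blast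
        then obtain g t where gt: "h i = (\<lambda>x. g x - g (act t x))" "cont g" by (auto simp: \<G>_def)
        show "((\<lambda>L. \<psi> (avg L (h i))) \<longlongrightarrow> 0) V" if "bdd_fun \<psi>" for \<psi>
          unfolding gt(1) using V that gt(2) by (simp add: asymptotic_def)
      qed simp
    qed simp
    from eventually_happens'[OF nb this]
    show "\<exists>L. L \<in> finite_means \<and> \<bar>\<psi> (avg L f) - c\<bar> < 1 / real (Suc n) \<and>
      (\<forall>i\<le>n. \<mu> (\<lambda>x. (avg L (h i) x)\<^sup>2) < (1/2)^n / (2 * real (Suc n)))" by auto
  qed
  obtain C where C: "\<And>n::nat. C n \<in> finite_means" "\<And>n. \<bar>\<psi> (avg (C n) f) - c\<bar> < 1 / real (Suc n)"
    "\<And>n i. i \<le> n \<Longrightarrow> \<mu> (\<lambda>x. (avg (C n) (h i) x)\<^sup>2) < (1/2)^n / (2 * real (Suc n))"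
    using seq[OF V c] by auto
  obtain D where D: "\<And>n::nat. D n \<in> finite_means" "\<And>n. \<bar>\<psi> (avg (D n) f) - c'\<bar> < 1 / real (Suc n)"
    "\<And>n i. i \<le> n \<Longrightarrow> \<mu> (\<lambda>x. (avg (D n) (h i) x)\<^sup>2) < (1/2)^n / (2 * real (Suc n))"
    using seq[OF V' c'] by auto
  define w where "w n x = (\<Sum>i\<le>n. (avg (C n) (h i) x)\<^sup>2 + (avg (D n) (h i) x)\<^sup>2)" for n x
  have sqcf: "cont (\<lambda>x. (avg (C n) (h i) x)\<^sup>2)" "cont (\<lambda>x. (avg (D n) (h i) x)\<^sup>2)" for n i
    by (intro continuous_on_power cont_avg C D hcf)+
  have wcf: "cont (w n)" for n unfolding w_def by (intro continuous_on_sum continuous_on_add sqcf)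
  have w0: "0 \<le> w n x" for n x unfolding w_def by (intro sum_nonneg) simp
  have w\<mu>: "\<mu> (w n) \<le> (1/2)^n" for n
  proof -
    have "\<mu> (w n) = (\<Sum>i\<le>n. \<mu> (\<lambda>x. (avg (C n) (h i) x)\<^sup>2 + (avg (D n) (h i) x)\<^sup>2))"
      unfolding w_def by (rule lin_fun_sum[OF lin]) (simp, intro continuous_on_add sqcf)
    also have "\<dots> \<le> (\<Sum>i\<le>n. (1/2)^n / real (Suc n))"
    proof (rule sum_mono)
      fix i assume "i \<in> {..n}"
      then have i: "i \<le> n" by simp
      have "a / r = a / (2 * r) + a / (2 * r)" for a r :: real
        by (cases "r = 0") (simp_all add: field_simps)
      from this[of "(1/2)^n" "real (Suc n)"]
      have "(1/2)^n / real (Suc n) = (1/2)^n / (2 * real (Suc n)) + (1/2)^n / (2 * real (Suc n))" .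
      then show "\<mu> (\<lambda>x. (avg (C n) (h i) x)\<^sup>2 + (avg (D n) (h i) x)\<^sup>2) \<le> (1/2)^n / real (Suc n)"
        using lin_fun_add[OF lin sqcf] C(3)[OF i] D(3)[OF i] by simp
    qed
    also have "\<dots> = (1/2)^n" by simp
    finally show ?thesis .
  qed
  define k where "k n x = \<bar>avg (C n) f x - avg (D n) f x\<bar>" for n x
  have kcf: "cont (k n)" for n unfolding k_def
      by (intro continuous_on_rabs continuous_on_diff cont_avg C D f)
  obtain B where B: "\<And>x. \<bar>f x\<bar> \<le> B" using cont_bounded[OF K f] by blast
  have kB: "k n x \<le> 2 * B" for n x
  proof -
    have "\<bar>avg (C n) f x\<bar> \<le> B" "\<bar>avg (D n) f x\<bar> \<le> B"
      by (rule avg_abs_le[OF C(1) B], rule avg_abs_le[OF D(1) B])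
    then show ?thesis unfolding k_def by linarith
  qed
  have k0: "(\<lambda>n. \<mu> (k n)) \<longlonglongrightarrow> 0"
  proof (rule almost_everywhere_convergence[OF \<mu>(1) wcf w0 w\<mu> kcf _ kB])
    show "0 \<le> k n x" for n x by (simp add: k_def)
    fix x assume "summable (\<lambda>n. w n x)"
    then have wx: "(\<lambda>n. w n x) \<longlonglongrightarrow> 0" by (rule summable_LIMSEQ_zero)
    obtain M where M: "minimal_set act M" "M \<subseteq> orbit_closure x"
      "\<And>M'. minimal_set act M' \<Longrightarrow> M' \<subseteq> orbit_closure x \<Longrightarrow> M' = M" using uni[of x] by blast
    obtain y where y: "y \<in> M" using M(1) by (auto simp: minimal_set_def)
    have lim: "(\<lambda>n. avg (E n) f x) \<longlonglongrightarrow> mean_at f y"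
      if E: "\<And>n. E n \<in> finite_means" "\<And>n i. i \<le> n \<Longrightarrow> (avg (E n) (h i) x)\<^sup>2 \<le> w n x" for E
    proof (rule avg_tendsto_mean_at[OF _ _ M(3,1,2) y f])
      show "eventually (\<lambda>n. E n \<in> finite_means) sequentially" using E(1) by simp
      fix g :: "'k \<Rightarrow> real" and t assume g: "cont g"
      define gt where "gt = (\<lambda>x. g x - g (act t x))"
      have gtG: "gt \<in> \<G>" using g by (auto simp: \<G>_def gt_def)
      have hi: "(\<lambda>n. avg (E n) (h i) x) \<longlonglongrightarrow> 0" for i
      proof -
        have "(\<lambda>n. (avg (E n) (h i) x)\<^sup>2) \<longlonglongrightarrow> 0"
        proof (rule tendsto_sandwich[OF _ _ tendsto_const wx])
          show "eventually (\<lambda>n. (avg (E n) (h i) x)\<^sup>2 \<le> w n x) sequentially"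
            using E(2) by (auto simp: eventually_sequentially)
        qed simp
        from tendsto_real_sqrt[OF this] have "(\<lambda>n. \<bar>avg (E n) (h i) x\<bar>) \<longlonglongrightarrow> 0" by simp
        then show ?thesis by (rule tendsto_rabs_zero_cancel)
      qed
      have "(\<lambda>n. avg (E n) gt x) \<longlonglongrightarrow> 0"
      proof (rule tendstoI)
        fix e :: real assume e: "e > 0"
        then have e2: "e / 2 > 0" by simp
        from h(2)[OF gtG e2] obtain i where i: "\<And>x. \<bar>gt x - h i x\<bar> < e / 2" by blast
        show "eventually (\<lambda>n. dist (avg (E n) gt x) 0 < e) sequentially"
        proof (rule eventually_mono[OF tendstoD[OF hi[of i] e2]])
          fix n assume n: "dist (avg (E n) (h i) x) 0 < e / 2"
          have "\<bar>avg (E n) (\<lambda>x. gt x - h i x) x\<bar> \<le> e / 2"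
            by (rule avg_abs_le[OF E(1)]) (rule less_imp_le[OF i])
          then have "\<bar>avg (E n) gt x - avg (E n) (h i) x\<bar> \<le> e / 2" by (simp only: avg_diff[OF E(1)])
          then show "dist (avg (E n) gt x) 0 < e" using n unfolding dist_real_def by linarith
        qed
      qed
      then show "(\<lambda>n. avg (E n) (\<lambda>x. g x - g (act t x)) x) \<longlonglongrightarrow> 0" by (simp only: gt_def)
    qed
    have mem: "(avg (C n) (h i) x)\<^sup>2 + (avg (D n) (h i) x)\<^sup>2 \<le> w n x" if "i \<le> n" for n i
      unfolding w_def using that
      by (intro member_le_sum[of i "{..n}" "\<lambda>i. (avg (C n) (h i) x)\<^sup>2 +
          (avg (D n) (h i) x)\<^sup>2"]) auto
    have "(\<lambda>n. avg (C n) f x) \<longlonglongrightarrow> mean_at f y"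
      using mem by (intro lim C(1)) (smt (verit) zero_le_power2)
    moreover have "(\<lambda>n. avg (D n) f x) \<longlonglongrightarrow> mean_at f y"
      using mem by (intro lim D(1)) (smt (verit) zero_le_power2)
    ultimately have "(\<lambda>n. \<bar>avg (C n) f x - avg (D n) f x\<bar>) \<longlonglongrightarrow> \<bar>mean_at f y - mean_at f y\<bar>"
      by (intro tendsto_intros)
    then show "(\<lambda>n. k n x) \<longlonglongrightarrow> 0" by (simp add: k_def)
  qed
  have i: "(\<lambda>n. 1 / real (Suc n)) \<longlonglongrightarrow> 0"
    using LIMSEQ_inverse_real_of_nat by (simp add: inverse_eq_divide)
  have "\<bar>c - c'\<bar> \<le> 0"
  proof (rule LIMSEQ_le_const)
    show "(\<lambda>n. \<mu> (k n) + 1 / real (Suc n) + 1 / real (Suc n)) \<longlonglongrightarrow> 0"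
      using tendsto_add[OF tendsto_add[OF k0 i] i] by simp
    have "\<bar>c - c'\<bar> \<le> \<mu> (k n) + 1 / real (Suc n) + 1 / real (Suc n)" for n
    proof -
      have "\<bar>\<psi> (\<lambda>x. avg (C n) f x - avg (D n) f x)\<bar> \<le> \<mu> (k n)"
        unfolding k_def by (rule \<mu>(2)) (intro continuous_on_diff cont_avg C D f)
      then have "\<bar>\<psi> (avg (C n) f) - \<psi> (avg (D n) f)\<bar> \<le> \<mu> (k n)"
        using lin_fun_diff[OF bdd_fun_lin[OF \<psi>] cont_avg[OF C(1) f] cont_avg[OF D(1) f], of n n]
            by simp
      then show ?thesis using C(2)[of n] D(2)[of n] by linarith
    qed
    then show "\<exists>N. \<forall>n\<ge>N. \<bar>c - c'\<bar> \<le> \<mu> (k n) + 1 / real (Suc n) + 1 / real (Suc n)" by blast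
  qed
  then show ?thesis by simp
qed

end

section \<open>Nets, seminorm topologies and operator hulls\<close>

text \<open>
  The tails of a net can form any proper filter: take pairs of a member of the filter and a point of
  it, ordered by reverse inclusion of the first components.
\<close>

lemma net_of_filter:
  fixes F :: "'x filter"
  assumes F: "F \<noteq> bot" and Y: "eventually (\<lambda>t. t \<in> Y) F"
  obtains B :: "'x net_index set" and le' where "directed_set B le'" "snd ` B \<subseteq> Y"
    "filtermap snd (net_filter B le') = F"
proof -
  define B where "B = {(U, t). eventually (\<lambda>t. t \<in> U) F \<and> t \<in> U \<and> t \<in> Y}"
  define le' where "le' = (\<lambda>(U :: 'x set, t :: 'x) (V, u :: 'x). V \<subseteq> U)"
  have inB: "\<exists>t. (U, t) \<in> B" if "eventually (\<lambda>t. t \<in> U) F" for U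
  proof -
    from eventually_happens'[OF F eventually_conj[OF that Y]] show ?thesis
      using that by (auto simp: B_def)
  qed
  have dir: "directed_set B le'"
    unfolding directed_set_def
  proof (intro conjI)
    show "B \<noteq> {}" using inB[of UNIV] by auto
    show "reflp_on B le'" by (auto simp: reflp_on_def le'_def)
    show "transp_on B le'" by (auto simp: transp_on_def le'_def)
    show "\<forall>a\<in>B. \<forall>b\<in>B. \<exists>c\<in>B. le' a c \<and> le' b c"
    proof (intro ballI)
      fix a b assume "a \<in> B" "b \<in> B"
      then have "eventually (\<lambda>t. t \<in> fst a \<inter> fst b) F"
        by (auto simp: B_def intro: eventually_conj)
      from inB[OF this] obtain t where "(fst a \<inter> fst b, t) \<in> B" ..
      then show "\<exists>c\<in>B. le' a c \<and> le' b c"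
        by (intro bexI[of _ "(fst a \<inter> fst b, t)"]) (auto simp: le'_def)
    qed
  qed
  have "eventually P (filtermap snd (net_filter B le')) \<longleftrightarrow> eventually P F" for P
    unfolding eventually_filtermap eventually_net_filter[OF dir]
  proof
    assume "\<exists>a\<in>B. \<forall>b\<in>B. le' a b \<longrightarrow> P (snd b)"
    then obtain U t where U: "(U, t) \<in> B" "\<And>b. b \<in> B \<Longrightarrow> le' (U, t) b \<Longrightarrow> P (snd b)" by auto
    then have "eventually (\<lambda>t. t \<in> U) F" by (simp add: B_def)
    from this Y show "eventually P F"
    proof eventually_elim
      case (elim u)
      then have "(U, u) \<in> B" using U(1) by (simp add: B_def)
      from U(2)[OF this] show ?case by (simp add: le'_def)
    qed
  next
    assume "eventually P F"
    then have "eventually (\<lambda>t. t \<in> Collect P) F" by simp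
    from inB[OF this] obtain t where "(Collect P, t) \<in> B" ..
    then show "\<exists>a\<in>B. \<forall>b\<in>B. le' a b \<longrightarrow> P (snd b)"
      by (rule bexI[rotated]) (auto simp: le'_def B_def)
  qed
  then have "filtermap snd (net_filter B le') = F" by (simp add: filter_eq_iff)
  with dir show ?thesis by (intro that[of B le']) (auto simp: B_def)
qed

lemma net_filter_nonbot: "directed_set A le \<Longrightarrow> net_filter A le \<noteq> bot"
  unfolding trivial_limit_def eventually_net_filter
  by (auto simp: directed_set_def reflp_on_def)

lemma eventually_in_net: "directed_set A le \<Longrightarrow> eventually (\<lambda>a. a \<in> A) (net_filter A le)"
  unfolding eventually_net_filter by (auto simp: directed_set_def)

lemma limitin_sup: "limitin X f l (sup F G) \<longleftrightarrow> limitin X f l F \<and> limitin X f l G"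
  by (auto simp: limitin_def eventually_sup)

lemma tendsto_sup: "(f \<longlongrightarrow> l) (sup F G) \<longleftrightarrow> (f \<longlongrightarrow> l) F \<and> (f \<longlongrightarrow> l) G"
  by (auto simp: tendsto_def eventually_sup)

lemma limitin_seminormD:
  assumes "limitin (seminorm_topology Y P) g l F" "p \<in> P" "p 0 = 0" "e > 0"
  shows "eventually (\<lambda>i. p (g i - l) < e) F"
proof -
  have lY: "l \<in> Y" using limitin_topspace[OF assms(1)] topspace_seminorm_topology[OF assms(2,3)]
      by blast
  have "openin (seminorm_topology Y P) {y \<in> Y. p (y - l) < e}"
    unfolding seminorm_topology_def by (rule topology_generated_by_Basis) (use assms lY in blast)
  moreover have "l \<in> {y \<in> Y. p (y - l) < e}" using lY assms by simp
  ultimately have "eventually (\<lambda>i. g i \<in> {y \<in> Y. p (y - l) < e}) F"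
    using assms(1) unfolding limitin_def by blast
  then show ?thesis by eventually_elim simp
qed

lemma limitin_seminormI:
  assumes P: "P \<noteq> {}" "\<And>p. p \<in> P \<Longrightarrow> p 0 = 0" "\<And>p x y. p \<in> P \<Longrightarrow> p (x + y) \<le> p x + p y"
    and l: "l \<in> Y" and g: "eventually (\<lambda>i. g i \<in> Y) F"
    and lim: "\<And>p e. p \<in> P \<Longrightarrow> e > 0 \<Longrightarrow> eventually (\<lambda>i. p (g i - l) < e) F"
  shows "limitin (seminorm_topology Y P) g l F"
proof -
  obtain p0 where "p0 \<in> P" using P(1) by blast
  then have "topspace (seminorm_topology Y P) = Y" by (intro topspace_seminorm_topology P)
  moreover have "l \<in> U \<longrightarrow> eventually (\<lambda>i. g i \<in> U) F"
    if "generate_topology_on {{y \<in> Y. p (y - y0) < e} |p y0 e. p \<in> P \<and> y0 \<in> Y \<and> e > 0} U" for U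
    using that
  proof (induction U rule: generate_topology_on.induct)
    case (Int a b)
    then show ?case by (auto intro: eventually_conj)
  next
    case (UN K)
    show ?case
    proof
      assume "l \<in> \<Union>K"
      then obtain k where k: "k \<in> K" "l \<in> k" by blast
      with UN have "eventually (\<lambda>i. g i \<in> k) F" by blast
      then show "eventually (\<lambda>i. g i \<in> \<Union>K) F" by eventually_elim (use k in blast)
    qed
  next
    case (Basis s)
    then obtain p y0 e where s: "s = {y \<in> Y. p (y - y0) < e}" "p \<in> P" by blast
    show ?case
    proof
      assume "l \<in> s"
      then have "e - p (l - y0) > 0" by (simp add: s)
      from g lim[OF s(2) this] show "eventually (\<lambda>i. g i \<in> s) F"
      proof eventually_elim
        case (elim i)
        have "p (g i - y0) \<le> p (g i - l) + p (l - y0)"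
          using P(3)[OF s(2), of "g i - l" "l - y0"] by simp
        with elim show ?case by (simp add: s)
      qed
    qed
  qed simp
  ultimately show ?thesis
    using l by (auto simp: limitin_def seminorm_topology_def openin_topology_generated_by_iff)
qed

text \<open>
  The product topology tests an operator at finitely many points only, each with finitely many
  seminorms.
\<close>

lemma closure_of_self_power_approx:
  assumes T: "T \<in> self_power (seminorm_topology Y P) closure_of H"
    and P: "P \<noteq> {}" "\<And>p. p \<in> P \<Longrightarrow> p 0 = 0"
    and J: "finite J" "J \<subseteq> Y \<times> P" and e: "e > 0"
  shows "(\<forall>y\<in>Y. T y \<in> Y) \<and> (\<exists>T'\<in>H. \<forall>(y, p)\<in>J. p (T' y - T y) < (e::real))"
proof -
  let ?X = "self_power (seminorm_topology Y P)"
  obtain p0 where "p0 \<in> P" using P(1) by blast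
  then have tY: "topspace (seminorm_topology Y P) = Y" by (intro topspace_seminorm_topology P)
  have T1: "T \<in> topspace ?X" and T2: "\<And>U. openin ?X U \<Longrightarrow> T \<in> U \<Longrightarrow> \<exists>T'\<in>H. T' \<in> U"
    using T by (auto simp: in_closure_of)
  have TY: "T y \<in> Y" if "y \<in> Y" for y using T1 that by (auto simp: self_power_def tY)
  define U where "U y p = {f \<in> topspace ?X. f y \<in> {z \<in> Y. p (z - T y) < e}}" for y p
  have U: "openin ?X (U y p)" if "y \<in> Y" "p \<in> P" for y p
    unfolding U_def
  proof (rule openin_continuous_map_preimage)
    show "continuous_map ?X (seminorm_topology Y P) (\<lambda>f. f y)"
      unfolding self_power_def by (rule continuous_map_product_projection) (simp add: tY that)
    show "openin (seminorm_topology Y P) {z \<in> Y. p (z - T y) < e}"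
      unfolding seminorm_topology_def by (rule topology_generated_by_Basis) (use that e TY in blast)
  qed
  have "openin ?X (topspace ?X \<inter> (\<Inter>(y, p)\<in>J. U y p))"
    using J
  proof (induction J rule: finite_induct)
    case (insert j J)
    obtain y p where j: "j = (y, p)" by (cases j)
    have "openin ?X (U y p \<inter> (topspace ?X \<inter> (\<Inter>(y, p)\<in>J. U y p)))"
    proof (rule openin_Int)
      show "openin ?X (U y p)" using insert.prems j by (intro U) auto
      show "openin ?X (topspace ?X \<inter> (\<Inter>(y, p)\<in>J. U y p))" using insert by auto
    qed
    moreover have "U y p \<inter> (topspace ?X \<inter> (\<Inter>(y, p)\<in>J. U y p)) =
        topspace ?X \<inter> (\<Inter>(y, p)\<in>insert j J. U y p)"
      by (auto simp: j)
    ultimately show ?case by simp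
  qed simp
  moreover have "T \<in> topspace ?X \<inter> (\<Inter>(y, p)\<in>J. U y p)"
  proof -
    have "T \<in> U y p" if j: "(y, p) \<in> J" for y p
    proof -
      have "y \<in> Y" "p 0 = 0" using j J(2) P(2) by blast+
      then show ?thesis using T1 TY e by (simp add: U_def)
    qed
    then show ?thesis using T1 by auto
  qed
  ultimately obtain T' where "T' \<in> H" "T' \<in> topspace ?X \<inter> (\<Inter>(y, p)\<in>J. U y p)" using T2 by blast
  then show ?thesis using TY by (intro conjI bexI[of _ T']) (auto simp: U_def)
qed

lemma operator_hull_convex:
  assumes T: "T1 \<in> operator_hull Y \<S>" "T2 \<in> operator_hull Y \<S>" and t: "0 \<le> t" "t \<le> 1"
  shows "restrict (\<lambda>y. (1 - t) *\<^sub>R T1 y + t *\<^sub>R T2 y) Y \<in> operator_hull Y \<S>"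
proof -
  obtain F1 c1 where 1: "T1 = restrict (\<lambda>y. \<Sum>T\<in>F1. c1 T *\<^sub>R T y) Y" "finite F1" "F1 \<subseteq> \<S>"
    "\<forall>T\<in>F1. 0 \<le> c1 T" "sum c1 F1 = 1" using T(1) by (auto simp: operator_hull_def)
  obtain F2 c2 where 2: "T2 = restrict (\<lambda>y. \<Sum>T\<in>F2. c2 T *\<^sub>R T y) Y" "finite F2" "F2 \<subseteq> \<S>"
    "\<forall>T\<in>F2. 0 \<le> c2 T" "sum c2 F2 = 1" using T(2) by (auto simp: operator_hull_def)
  define d1 where "d1 T = (if T \<in> F1 then c1 T else 0)" for T
  define d2 where "d2 T = (if T \<in> F2 then c2 T else 0)" for T
  define c where "c T = (1 - t) * d1 T + t * d2 T" for T
  have s1: "(\<Sum>T\<in>F1 \<union> F2. d1 T *\<^sub>R T y) = (\<Sum>T\<in>F1. c1 T *\<^sub>R T y)" for y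
    by (rule sum.mono_neutral_cong_right) (auto simp: d1_def 1 2)
  have s2: "(\<Sum>T\<in>F1 \<union> F2. d2 T *\<^sub>R T y) = (\<Sum>T\<in>F2. c2 T *\<^sub>R T y)" for y
    by (rule sum.mono_neutral_cong_right) (auto simp: d2_def 1 2)
  have "sum d1 (F1 \<union> F2) = sum c1 F1" by (rule sum.mono_neutral_cong_right) (auto simp: d1_def 1 2)
  moreover have "sum d2 (F1 \<union> F2) = sum c2 F2"
      by (rule sum.mono_neutral_cong_right) (auto simp: d2_def 1 2)
  ultimately have "sum c (F1 \<union> F2) = 1"
    by (simp add: c_def sum.distrib 1 2 flip: sum_distrib_left)
  moreover have "0 \<le> c T" if "T \<in> F1 \<union> F2" for T
    using that t 1(4) 2(4) by (auto simp: c_def d1_def d2_def)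
  moreover have "(\<Sum>T\<in>F1 \<union> F2. c T *\<^sub>R T y) = (1 - t) *\<^sub>R (\<Sum>T\<in>F1. c1 T *\<^sub>R T y) +
      t *\<^sub>R (\<Sum>T\<in>F2. c2 T *\<^sub>R T y)" for y
  proof -
    have "(\<Sum>T\<in>F1 \<union> F2. c T *\<^sub>R T y) = (1 - t) *\<^sub>R (\<Sum>T\<in>F1 \<union> F2. d1 T *\<^sub>R T y) +
        t *\<^sub>R (\<Sum>T\<in>F1 \<union> F2. d2 T *\<^sub>R T y)"
      by (simp add: c_def scaleR_add_left sum.distrib scaleR_sum_right)
    then show ?thesis by (simp only: s1 s2)
  qed
  then have "restrict (\<lambda>y. (1 - t) *\<^sub>R T1 y + t *\<^sub>R T2 y) Y =
      restrict (\<lambda>y. \<Sum>T\<in>F1 \<union> F2. c T *\<^sub>R T y) Y"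
    unfolding 1(1) 2(1) by (auto simp: restrict_def)
  ultimately show ?thesis unfolding operator_hull_def using 1(2,3) 2(2,3)
    by (intro CollectI exI[of _ "F1 \<union> F2"] exI[of _ c]) auto
qed

lemma operator_hull_point:
  assumes "R \<in> \<S>" shows "restrict R Y \<in> operator_hull Y \<S>"
proof -
  have "restrict R Y = restrict (\<lambda>y. \<Sum>T\<in>{R}. (1::real) *\<^sub>R T y) Y" by simp
  then show ?thesis using assms unfolding operator_hull_def
    by (intro CollectI exI[of _ "{R}"] exI[of _ "\<lambda>_. 1"]) auto
qed

text \<open>
  The functional given by the discrete complex measure with weights \<open>a\<close>.
\<close>

definition l1_functional :: "('k \<Rightarrow> complex) \<Rightarrow> ('k::topological_space \<Rightarrow>\<^sub>C complex) \<Rightarrow>\<^sub>L complex" where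
  "l1_functional a = Blinfun (\<lambda>f. \<Sum>\<^sub>\<infinity>x. a x * apply_bcontfun f x)"

lemma l1_functional:
  assumes a: "(\<lambda>x. norm (a x)) summable_on UNIV"
  shows "blinfun_apply (l1_functional a) f = (\<Sum>\<^sub>\<infinity>x. a x * apply_bcontfun f x)"
      "l1_functional a \<in> cdual"
proof -
  have bnd: "norm (a x * apply_bcontfun f x) \<le> norm (a x) * norm f" for f :: "'a \<Rightarrow>\<^sub>C complex" and x
    by (simp add: norm_mult mult_left_mono norm_bounded)
  have sn: "(\<lambda>x. norm (a x * apply_bcontfun f x)) summable_on UNIV" for f :: "'a \<Rightarrow>\<^sub>C complex"
  proof (rule Infinite_Sum.abs_summable_on_comparison_test[where g =
      "\<lambda>x. complex_of_real (norm (a x) * norm f)"])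
    show "(\<lambda>x. norm (complex_of_real (norm (a x) * norm f))) summable_on UNIV"
      using summable_on_cmult_left[OF a, of "norm f"] by (simp add: norm_mult)
    show "norm (a x * apply_bcontfun f x) \<le> norm (complex_of_real (norm (a x) * norm f))" for x
      using bnd[of x f] by (simp add: norm_mult)
  qed
  have s: "(\<lambda>x. a x * apply_bcontfun f x) summable_on UNIV" for f :: "'a \<Rightarrow>\<^sub>C complex"
    by (rule Infinite_Sum.abs_summable_summable[OF sn])
  have "bounded_linear (\<lambda>f. \<Sum>\<^sub>\<infinity>x. a x * apply_bcontfun f x)"
  proof (rule bounded_linear_intro[of _ "\<Sum>\<^sub>\<infinity>x. norm (a x)"])
    show "(\<Sum>\<^sub>\<infinity>x. a x * apply_bcontfun (f + g) x) = (\<Sum>\<^sub>\<infinity>x. a x * apply_bcontfun f x) + (\<Sum>\<^sub>\<infinity>x. a x *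
        apply_bcontfun g x)" for f g
      by (simp add: distrib_left infsum_add[OF s s])
    show "(\<Sum>\<^sub>\<infinity>x. a x * apply_bcontfun (r *\<^sub>R f) x) = r *\<^sub>R (\<Sum>\<^sub>\<infinity>x. a x * apply_bcontfun f x)" for r f
      by (simp add: infsum_scaleR_right)
    show "norm (\<Sum>\<^sub>\<infinity>x. a x * apply_bcontfun f x) \<le> norm f * (\<Sum>\<^sub>\<infinity>x. norm (a x))" for f
    proof -
      have "norm (\<Sum>\<^sub>\<infinity>x. a x * apply_bcontfun f x) \<le> (\<Sum>\<^sub>\<infinity>x. norm (a x * apply_bcontfun f x))"
        by (rule Infinite_Sum.norm_infsum_bound[OF sn])
      also have "\<dots> \<le> (\<Sum>\<^sub>\<infinity>x. norm (a x) * norm f)"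
        by (rule infsum_mono[OF sn summable_on_cmult_left[OF a]]) (rule bnd)
      also have "\<dots> = (\<Sum>\<^sub>\<infinity>x. norm (a x)) * norm f" by (rule infsum_cmult_left) (use a in blast)
      finally show ?thesis by (simp add: mult.commute)
    qed
  qed
  then show 1: "blinfun_apply (l1_functional a) f = (\<Sum>\<^sub>\<infinity>x. a x * apply_bcontfun f x)" for f
    unfolding l1_functional_def by (simp add: bounded_linear_Blinfun_apply)
  show "l1_functional a \<in> cdual"
    unfolding cdual_def by (auto simp: 1 apply_scaleC_bcontfun mult.left_commute
        infsum_cmult_right'[symmetric])
qed

lemma sigma_l1_seminorms:
  "{\<lambda>f. norm (\<Sum>\<^sub>\<infinity>x. a x * apply_bcontfun f x) |a :: 'k::t2_space \<Rightarrow> complex. (\<lambda>x. norm (a x))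
      summable_on UNIV}
   = (\<lambda>a f. norm (blinfun_apply (l1_functional a) f)) ` {a. (\<lambda>x. norm (a x)) summable_on UNIV}"
  by (auto simp: l1_functional(1) fun_eq_iff image_iff)

lemma sigma_l1_alt:
  "sigma_l1 = seminorm_topology UNIV ((\<lambda>a f. norm (blinfun_apply (l1_functional a) f)) `
     {a :: 'k::t2_space \<Rightarrow> complex. (\<lambda>x. norm (a x)) summable_on UNIV})"
  unfolding sigma_l1_def sigma_l1_seminorms ..

lemma l1_functional_indicator:
  "(\<lambda>z. norm (if z = x then 1 else 0 :: complex)) summable_on UNIV"
  "blinfun_apply (l1_functional (\<lambda>z. if z = x then 1 else 0)) f = apply_bcontfun f x"
proof -
  show s: "(\<lambda>z. norm (if z = x then 1 else 0 :: complex)) summable_on UNIV"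
    by (rule finite_nonzero_values_imp_summable_on) (auto intro: finite_subset[of _ "{x}"])
  have "(\<Sum>\<^sub>\<infinity>z. (if z = x then 1 else 0) * apply_bcontfun f z) = (\<Sum>\<^sub>\<infinity>z\<in>{x}. (if z =
      x then 1 else 0) * apply_bcontfun f z)"
    by (rule infsum_cong_neutral) auto
  then show "blinfun_apply (l1_functional (\<lambda>z. if z = x then 1 else 0)) f = apply_bcontfun f x"
    by (simp add: l1_functional(1)[OF s])
qed

lemma limitin_sigma_l1_pointwise:
  assumes "limitin sigma_l1 G 0 F"
  shows "((\<lambda>i. apply_bcontfun (G i) x) \<longlongrightarrow> 0) F"
proof (rule tendstoI)
  fix e :: real assume "e > 0"
  let ?a = "\<lambda>z. if z = x then 1 else 0 :: complex"
  have "eventually (\<lambda>i. norm (blinfun_apply (l1_functional ?a) (G i - 0)) < e) F"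
    by (rule limitin_seminormD[OF assms[unfolded sigma_l1_alt] _ _ \<open>e > 0\<close>])
       (use l1_functional_indicator(1)[of x] in auto)
  then show "eventually (\<lambda>i. dist (apply_bcontfun (G i) x) 0 < e) F"
    by (simp add: l1_functional_indicator(2))
qed

lemma limitin_sigma_l1I:
  assumes "\<And>\<phi>. \<phi> \<in> cdual \<Longrightarrow> ((\<lambda>i. blinfun_apply \<phi> (G i)) \<longlongrightarrow> 0) F"
  shows "limitin sigma_l1 G 0 F"
  unfolding sigma_l1_alt
proof (rule limitin_seminormI)
  fix p :: "('a \<Rightarrow>\<^sub>C complex) \<Rightarrow> real" and e :: real
  assume "p \<in> (\<lambda>a f. norm (blinfun_apply (l1_functional a) f)) ` {a. (\<lambda>x. norm (a x)) summable_on
      UNIV}"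
  then obtain a where a: "(\<lambda>x. norm (a x)) summable_on UNIV"
      "p = (\<lambda>f. norm (blinfun_apply (l1_functional a) f))" by auto
  assume "e > 0"
  from tendstoD[OF assms[OF l1_functional(2)[OF a(1)]] this]
  show "eventually (\<lambda>i. p (G i - 0) < e) F" by (simp add: a(2))
next
  have "(\<lambda>z. if z = undefined then 1 else 0) \<in> {a :: 'a \<Rightarrow> complex. (\<lambda>x. norm (a x)) summable_on
      UNIV}"
    unfolding mem_Collect_eq by (rule l1_functional_indicator(1))
  then show "(\<lambda>a f. norm (blinfun_apply (l1_functional a) f)) ` {a :: 'a \<Rightarrow> complex. (\<lambda>x. norm (a
      x)) summable_on UNIV} \<noteq> {}"
    unfolding image_is_empty by (metis empty_iff)
qed (auto simp: blinfun.add_right norm_triangle_ineq)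

lemma limitin_weak_star_iff:
  "limitin weak_star \<Phi> \<psi> F \<longleftrightarrow> \<psi> \<in> cdual \<and> eventually (\<lambda>i. \<Phi> i \<in> cdual) F \<and>
     (\<forall>f. ((\<lambda>i. blinfun_apply (\<Phi> i) f) \<longlongrightarrow> blinfun_apply \<psi> f) F)"
proof (intro iffI conjI allI)
  assume l: "limitin weak_star \<Phi> \<psi> F"
  show "\<psi> \<in> cdual" using limitin_topspace[OF l] by (simp add: topspace_weak_star)
  show "eventually (\<lambda>i. \<Phi> i \<in> cdual) F"
    using l unfolding limitin_def by (metis (no_types) openin_topspace topspace_weak_star)
  fix f
  show "((\<lambda>i. blinfun_apply (\<Phi> i) f) \<longlongrightarrow> blinfun_apply \<psi> f) F"
  proof (rule tendstoI)
    fix e :: real assume "e > 0"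
    have "eventually (\<lambda>i. (\<lambda>\<phi>. norm (blinfun_apply \<phi> f)) (\<Phi> i - \<psi>) < e) F"
      by (rule limitin_seminormD[OF l[unfolded weak_star_def] _ _ \<open>e > 0\<close>]) auto
    then show "eventually (\<lambda>i. dist (blinfun_apply (\<Phi> i) f) (blinfun_apply \<psi> f) < e) F"
      by (simp add: dist_norm blinfun.diff_left)
  qed
next
  assume r: "\<psi> \<in> cdual \<and> eventually (\<lambda>i. \<Phi> i \<in> cdual) F \<and>
     (\<forall>f. ((\<lambda>i. blinfun_apply (\<Phi> i) f) \<longlongrightarrow> blinfun_apply \<psi> f) F)"
  show "limitin weak_star \<Phi> \<psi> F"
    unfolding weak_star_def
  proof (rule limitin_seminormI)
    fix p :: "(('a \<Rightarrow>\<^sub>C complex) \<Rightarrow>\<^sub>L complex) \<Rightarrow> real" and e :: real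
    assume "p \<in> range (\<lambda>f \<phi>. norm (blinfun_apply \<phi> f))"
    then obtain f where f: "p = (\<lambda>\<phi>. norm (blinfun_apply \<phi> f))" by auto
    assume "e > 0"
    with r have "eventually (\<lambda>i. dist (blinfun_apply (\<Phi> i) f) (blinfun_apply \<psi> f) < e) F"
      by (auto dest: tendstoD)
    then show "eventually (\<lambda>i. p (\<Phi> i - \<psi>) < e) F" by (simp add: f dist_norm blinfun.diff_left)
  qed (use r in \<open>auto simp: blinfun.add_left norm_triangle_ineq\<close>)
qed

section \<open>Complex functions, dual functionals and ergodic nets\<close>

lemma apply_Bcontfun_compact:
  fixes g :: "'a::topological_space \<Rightarrow> complex"
  assumes "compact (UNIV :: 'a set)" "continuous_on UNIV g"
  shows "apply_bcontfun (Bcontfun g) x = g x"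
proof -
  have "bounded (range g)" using assms by (intro compact_imp_bounded compact_continuous_image)
  then show ?thesis using assms(2) by (simp add: Bcontfun_inverse bcontfun_def)
qed

text \<open>
  A real function as a complex one. The value is meaningful for bounded continuous \<open>f\<close>.
\<close>

definition cplx :: "('k::topological_space \<Rightarrow> real) \<Rightarrow> ('k \<Rightarrow>\<^sub>C complex)" where
  "cplx f = Bcontfun (\<lambda>x. complex_of_real (f x))"

definition re_part :: "('k::topological_space \<Rightarrow>\<^sub>C complex) \<Rightarrow> 'k \<Rightarrow> real" where
  "re_part F = (\<lambda>x. Re (apply_bcontfun F x))"

definition im_part :: "('k::topological_space \<Rightarrow>\<^sub>C complex) \<Rightarrow> 'k \<Rightarrow> real" where
  "im_part F = (\<lambda>x. Im (apply_bcontfun F x))"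

lemma cont_re_part: "cont (re_part F)" and cont_im_part: "cont (im_part F)"
  unfolding re_part_def im_part_def by (intro continuous_intros continuous_on_apply_bcontfun)+

lemma abs_re_part: "\<bar>re_part F x\<bar> \<le> norm F" and abs_im_part: "\<bar>im_part F x\<bar> \<le> norm F"
  unfolding re_part_def im_part_def using norm_bounded[of F x]
  by (meson abs_Re_le_cmod abs_Im_le_cmod order_trans)+

lemma part_simps:
  "re_part (F + G) = (\<lambda>x. re_part F x + re_part G x)"
      "im_part (F + G) = (\<lambda>x. im_part F x + im_part G x)"
  "re_part (F - G) = (\<lambda>x. re_part F x - re_part G x)"
      "im_part (F - G) = (\<lambda>x. im_part F x - im_part G x)"
  "re_part (r *\<^sub>R F) = (\<lambda>x. r * re_part F x)" "im_part (r *\<^sub>R F) = (\<lambda>x. r * im_part F x)"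
  "re_part (scaleC_bcontfun c F) = (\<lambda>x. Re c * re_part F x - Im c * im_part F x)"
  "im_part (scaleC_bcontfun c F) = (\<lambda>x. Re c * im_part F x + Im c * re_part F x)"
  by (auto simp: re_part_def im_part_def plus_bcontfun.rep_eq minus_bcontfun.rep_eq
      scaleR_bcontfun.rep_eq
      apply_scaleC_bcontfun)

lemma bcontfun_parts_eqI: "re_part F = re_part G \<Longrightarrow> im_part F = im_part G \<Longrightarrow> F = G"
  by (rule bcontfun_eqI) (metis complex_eqI im_part_def re_part_def)

lemma apply_sum_scaleR:
  "apply_bcontfun (\<Sum>i\<in>I. c i *\<^sub>R f i) x = (\<Sum>i\<in>I. c i *\<^sub>R apply_bcontfun (f i) x)"
  by (induction I rule: infinite_finite_induct) (auto simp: plus_bcontfun.rep_eq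
      scaleR_bcontfun.rep_eq)

lemma blinfun_sum_scaleR:
  "blinfun_apply (\<Sum>i\<in>I. c i *\<^sub>R f i) x = (\<Sum>i\<in>I. c i *\<^sub>R blinfun_apply (f i) x)"
  by (simp add: blinfun.sum_left blinfun.scaleR_left)

context amenable_action
begin

lemma dynsys: "dynamical_system act"
  unfolding dynamical_system_def semitopological_semigroup_def
  using K act_mult act_cont mult_cont1 mult_cont2 by blast

lemma re_part_cplx: "cont f \<Longrightarrow> re_part (cplx f) = f"
    and im_part_cplx: "cont f \<Longrightarrow> im_part (cplx f) = (\<lambda>x. 0)"
  for f :: "'k \<Rightarrow> real"
  by (auto simp: re_part_def im_part_def cplx_def apply_Bcontfun_compact[OF K]
      continuous_on_of_real)

lemma re_part_koopman: "re_part (koopman act t F) = (\<lambda>x. re_part F (act t x))"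
  and im_part_koopman: "im_part (koopman act t F) = (\<lambda>x. im_part F (act t x))"
  by (auto simp: re_part_def im_part_def apply_koopman[OF dynsys])

lemma cplx_add: "cont f \<Longrightarrow> cont g \<Longrightarrow> cplx (\<lambda>x. f x + g x) = cplx f + cplx g" for f g :: "'k \<Rightarrow> real"
  by (rule bcontfun_parts_eqI) (simp_all add: re_part_cplx im_part_cplx part_simps
      continuous_on_add)

lemma cplx_scale: "cont f \<Longrightarrow> cplx (\<lambda>x. c * f x) = c *\<^sub>R cplx f" for f :: "'k \<Rightarrow> real"
  by (rule bcontfun_parts_eqI) (simp_all add: re_part_cplx im_part_cplx part_simps
      continuous_on_mult_left)

lemma bcontfun_decomp: "F = cplx (re_part F) + scaleC_bcontfun \<i> (cplx (im_part F))"
    for F :: "'k \<Rightarrow>\<^sub>C complex"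
  by (rule bcontfun_parts_eqI) (simp_all add: re_part_cplx im_part_cplx part_simps cont_re_part
      cont_im_part)

lemma norm_cplx_le:
  assumes "cont f" "\<And>x. \<bar>f x\<bar> \<le> e" shows "norm (cplx f :: 'k \<Rightarrow>\<^sub>C complex) \<le> e"
proof (rule norm_bound)
  fix x
  have "apply_bcontfun (cplx f) x = complex_of_real (f x)"
    using assms(1) by (simp add: cplx_def apply_Bcontfun_compact[OF K] continuous_on_of_real)
  then show "norm (apply_bcontfun (cplx f) x) \<le> e" using assms(2) by simp
qed

text \<open>
  The convex combination of Koopman operators given by a finite mean.
\<close>

definition avg_op :: "(('s \<Rightarrow> real) \<Rightarrow> real) \<Rightarrow> ('k \<Rightarrow>\<^sub>C complex) \<Rightarrow> ('k \<Rightarrow>\<^sub>C complex)" where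
  "avg_op L F = cplx (avg L (re_part F)) + scaleC_bcontfun \<i> (cplx (avg L (im_part F)))"

lemma re_part_avg_op: "L \<in> finite_means \<Longrightarrow> re_part (avg_op L F) = avg L (re_part F)"
  and im_part_avg_op: "L \<in> finite_means \<Longrightarrow> im_part (avg_op L F) = avg L (im_part F)"
  by (simp_all add: avg_op_def part_simps re_part_cplx im_part_cplx cont_avg cont_re_part
      cont_im_part)

lemma apply_avg_op: "L \<in> finite_means \<Longrightarrow> apply_bcontfun (avg_op L F) x =
    Complex (avg L (re_part F) x) (avg L (im_part F) x)"
  using re_part_avg_op[of L F] im_part_avg_op[of L F]
      by (auto simp: re_part_def im_part_def complex_eq_iff fun_eq_iff)

lemma avg_op_cplx:
  assumes "L \<in> finite_means" "cont f" shows "avg_op L (cplx f) = cplx (avg L f)"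
proof (rule bcontfun_parts_eqI)
  show "re_part (avg_op L (cplx f)) = re_part (cplx (avg L f))"
    by (simp only: re_part_avg_op[OF assms(1)] re_part_cplx[OF assms(2)] re_part_cplx[OF
        cont_avg[OF assms]])
  have "avg L (\<lambda>x. 0) = (\<lambda>x. 0)" by (rule ext) (rule avg_const[OF assms(1)])
  then show "im_part (avg_op L (cplx f)) = im_part (cplx (avg L f))"
    by (simp only: im_part_avg_op[OF assms(1)] im_part_cplx[OF assms(2)] im_part_cplx[OF
        cont_avg[OF assms]])
qed

lemma avg_op_scaleC:
  assumes "L \<in> finite_means" shows "avg_op L (scaleC_bcontfun c F) = scaleC_bcontfun c (avg_op L F)"
  by (rule bcontfun_parts_eqI)
     (simp_all add: re_part_avg_op[OF assms] im_part_avg_op[OF assms] part_simps fun_eq_iff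
        avg_diff[OF assms] avg_add[OF assms] avg_scale[OF assms])

lemma norm_avg_op:
  assumes "L \<in> finite_means" shows "norm (avg_op L F) \<le> 2 * norm F"
proof (rule norm_bound)
  fix x
  have "\<bar>avg L (re_part F) x\<bar> \<le> norm F" "\<bar>avg L (im_part F) x\<bar> \<le> norm F"
    by (rule avg_abs_le[OF assms abs_re_part], rule avg_abs_le[OF assms abs_im_part])
  then show "norm (apply_bcontfun (avg_op L F) x) \<le> 2 * norm F"
    using cmod_le[of "apply_bcontfun (avg_op L F) x"] by (simp add: apply_avg_op[OF assms])
qed

lemma cdual_decomp:
  assumes "\<phi> \<in> cdual"
  shows "blinfun_apply \<phi> (F :: 'k \<Rightarrow>\<^sub>C complex) = blinfun_apply \<phi> (cplx (re_part F)) + \<i> *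
      blinfun_apply \<phi> (cplx (im_part F))"
  by (subst bcontfun_decomp[of F]) (use assms in \<open>simp add: blinfun.add_right cdual_def\<close>)

lemma bdd_fun_Re: "bdd_fun (\<lambda>f. Re (blinfun_apply \<phi> (cplx f :: 'k \<Rightarrow>\<^sub>C complex)))"
  and bdd_fun_Im: "bdd_fun (\<lambda>f. Im (blinfun_apply \<phi> (cplx f :: 'k \<Rightarrow>\<^sub>C complex)))"
proof -
  have b: "norm (blinfun_apply \<phi> (cplx f)) \<le> norm \<phi> * e" if "cont f" "\<forall>x. \<bar>f x\<bar> \<le> e" for f e
    using norm_blinfun[of \<phi> "cplx f"] norm_cplx_le[OF that(1), of e] that(2)
    by (meson mult_left_mono norm_ge_zero order_trans)
  show "bdd_fun (\<lambda>f. Re (blinfun_apply \<phi> (cplx f)))" "bdd_fun (\<lambda>f. Im (blinfun_apply \<phi> (cplx f)))"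
    unfolding bdd_fun_def lin_fun_def
    by (auto simp: cplx_add cplx_scale blinfun.add_right blinfun.scaleR_right
        intro!: exI[of _ "norm \<phi>"] order_trans[OF abs_Re_le_cmod] order_trans[OF abs_Im_le_cmod] b)
qed

text \<open>
  Real and complex dual functionals determine each other, so tests with all complex functionals
  amount to tests with all real ones.
\<close>

lemma complexify:
  assumes \<psi>: "bdd_fun (\<psi> :: ('k \<Rightarrow> real) \<Rightarrow> real)"
  shows "\<exists>\<phi>\<in>cdual. \<forall>f. cont f \<longrightarrow> blinfun_apply \<phi> (cplx f) = complex_of_real (\<psi> f)"
proof -
  note lin = bdd_fun_lin[OF \<psi>]
  obtain B where B: "\<And>f e. cont f \<Longrightarrow> (\<And>x. \<bar>f x\<bar> \<le> e) \<Longrightarrow> \<bar>\<psi> f\<bar> \<le> B * e"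
    using \<psi> by (auto simp: bdd_fun_def)
  define \<Phi> where "\<Phi> F = Complex (\<psi> (re_part F)) (\<psi> (im_part F))" for F
  have "bounded_linear \<Phi>"
  proof (rule bounded_linear_intro[of _ "2 * B"])
    show "\<Phi> (F + G) = \<Phi> F + \<Phi> G" for F G
      by (simp add: \<Phi>_def part_simps lin_fun_add[OF lin] cont_re_part cont_im_part complex_eq_iff)
    show "\<Phi> (r *\<^sub>R F) = r *\<^sub>R \<Phi> F" for r F
      by (simp add: \<Phi>_def part_simps lin_fun_scale[OF lin] cont_re_part cont_im_part complex_eq_iff)
    show "norm (\<Phi> F) \<le> norm F * (2 * B)" for F
      using cmod_le[of "\<Phi> F"] B[OF cont_re_part abs_re_part, of F] B[OF cont_im_part abs_im_part,
          of F]
      by (simp add: \<Phi>_def algebra_simps)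
  qed
  then have a: "blinfun_apply (Blinfun \<Phi>) F = \<Phi> F" for F by (simp add: bounded_linear_Blinfun_apply)
  have l2: "\<psi> (\<lambda>x. a * f x - b * g x) = a * \<psi> f - b * \<psi> g"
      "\<psi> (\<lambda>x. a * f x + b * g x) = a * \<psi> f + b * \<psi> g"
    if "cont f" "cont g" for a b f g
    using that by (simp_all add: lin_fun_diff[OF lin] lin_fun_add[OF lin] lin_fun_scale[OF lin]
        continuous_on_mult_left)
  have "Blinfun \<Phi> \<in> cdual"
    unfolding cdual_def
    by (simp add: a \<Phi>_def part_simps l2 cont_re_part cont_im_part complex_eq_iff)
  moreover have "blinfun_apply (Blinfun \<Phi>) (cplx f) = complex_of_real (\<psi> f)" if "cont f" for f
    by (simp add: a \<Phi>_def re_part_cplx im_part_cplx that lin_fun_zero[OF lin] complex_eq_iff)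
  ultimately show ?thesis by blast
qed

lemma sum_koopman:
  assumes "finite I" "\<And>i. i \<in> I \<Longrightarrow> 0 \<le> c i" "sum c I = 1"
  shows "(\<Sum>i\<in>I. c i *\<^sub>R koopman act (\<sigma> i) F) = avg_op (\<lambda>\<phi>. \<Sum>i\<in>I. c i * \<phi> (\<sigma> i)) F"
proof (rule bcontfun_eqI)
  fix x
  have "(\<lambda>\<phi>. \<Sum>i\<in>I. c i * \<phi> (\<sigma> i)) \<in> finite_means" by (rule finite_mean_combination[OF assms])
  then show "apply_bcontfun (\<Sum>i\<in>I. c i *\<^sub>R koopman act (\<sigma> i) F) x
      = apply_bcontfun (avg_op (\<lambda>\<phi>. \<Sum>i\<in>I. c i * \<phi> (\<sigma> i)) F) x"
    by (simp add: apply_avg_op apply_sum_scaleR apply_koopman[OF dynsys] complex_eq_iff avg_def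
        re_part_def im_part_def)
qed

lemma koopman_hull_avg_op:
  assumes "T \<in> operator_hull UNIV (range (koopman act))"
  shows "\<exists>L\<in>finite_means. T = avg_op L"
proof -
  obtain I c where T: "T = restrict (\<lambda>y. \<Sum>R\<in>I. c R *\<^sub>R R y) UNIV"
      and I: "finite I" "I \<subseteq> range (koopman act)"
    and c: "\<And>R. R \<in> I \<Longrightarrow> 0 \<le> c R" "sum c I = 1"
    using assms by (auto simp: operator_hull_def)
  obtain \<sigma> where \<sigma>: "\<And>R. R \<in> I \<Longrightarrow> R = koopman act (\<sigma> R)" using I(2) by (metis f_inv_into_f subsetD)
  have "T F = avg_op (\<lambda>\<phi>. \<Sum>R\<in>I. c R * \<phi> (\<sigma> R)) F" for F
  proof -
    have "T F = (\<Sum>R\<in>I. c R *\<^sub>R koopman act (\<sigma> R) F)" using \<sigma> by (auto simp: T intro!: sum.cong)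
    then show ?thesis using sum_koopman[OF I(1) c] by simp
  qed
  then show ?thesis using finite_mean_combination[OF I(1) c]
      by (intro bexI[of _ "\<lambda>\<phi>. \<Sum>R\<in>I. c R * \<phi> (\<sigma> R)"]) auto
qed

lemma avg_op_point: "avg_op (\<lambda>\<phi>. \<phi> s) F = koopman act s F"
  by (rule bcontfun_eqI)
     (simp add: apply_avg_op[OF finite_mean_point] apply_koopman[OF dynsys] avg_def re_part_def
         im_part_def complex_eq_iff)

lemma avg_op_mix:
  assumes "L \<in> finite_means" "L' \<in> finite_means" "0 \<le> t" "t \<le> 1"
  shows "avg_op (\<lambda>\<phi>. (1 - t) * L \<phi> + t * L' \<phi>) F = (1 - t) *\<^sub>R avg_op L F + t *\<^sub>R avg_op L' F"
  by (rule bcontfun_eqI)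
     (simp add: apply_avg_op[OF finite_mean_mix[OF assms]] apply_avg_op assms avg_def complex_eq_iff
        plus_bcontfun.rep_eq scaleR_bcontfun.rep_eq)

lemma avg_op_in_koopman_hull: "L \<in> finite_means \<Longrightarrow>
    avg_op L \<in> operator_hull UNIV (range (koopman act))"
proof (induction L rule: finite_means.induct)
  case (finite_mean_point s)
  have "avg_op (\<lambda>\<phi>. \<phi> s) = restrict (koopman act s) UNIV" by (rule ext) (simp add: avg_op_point)
  then show ?case using operator_hull_point[of "koopman act s" "range (koopman act)" UNIV]
      by (simp only: rangeI)
next
  case (finite_mean_mix L L' t)
  have "avg_op (\<lambda>\<phi>. (1 - t) * L \<phi> + t * L' \<phi>) = restrict (\<lambda>y. (1 - t) *\<^sub>R avg_op L y +
      t *\<^sub>R avg_op L' y) UNIV"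
    by (rule ext) (simp add: avg_op_mix finite_mean_mix.hyps)
  then show ?case using operator_hull_convex[OF finite_mean_mix.IH finite_mean_mix.hyps(3,4)]
      by (simp only:)
qed

text \<open>
  Convex combinations of adjoints of Koopman operators are the adjoints of the averaging operators.
\<close>

lemma adjoint_hull_avg_op:
  assumes "T \<in> operator_hull cdual (range (koopman_adjoint act))"
  shows "\<exists>L\<in>finite_means. \<forall>\<phi>\<in>cdual. \<forall>F. blinfun_apply (T \<phi>) F = blinfun_apply \<phi> (avg_op L F)"
proof -
  obtain I c where T: "T = restrict (\<lambda>y. \<Sum>R\<in>I. c R *\<^sub>R R y) cdual"
      and I: "finite I" "I \<subseteq> range (koopman_adjoint act)"
    and c: "\<And>R. R \<in> I \<Longrightarrow> 0 \<le> c R" "sum c I = 1"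
    using assms by (auto simp: operator_hull_def)
  obtain \<sigma> where \<sigma>: "\<And>R. R \<in> I \<Longrightarrow> R = koopman_adjoint act (\<sigma> R)" using I(2)
      by (metis f_inv_into_f subsetD)
  have "blinfun_apply (T \<phi>) F = blinfun_apply \<phi> (avg_op (\<lambda>\<phi>. \<Sum>R\<in>I. c R * \<phi> (\<sigma> R)) F)"
      if "\<phi> \<in> cdual" for \<phi> F
  proof -
    have "blinfun_apply (T \<phi>) F = (\<Sum>R\<in>I. c R *\<^sub>R blinfun_apply (R \<phi>) F)"
      using that by (simp add: T blinfun_sum_scaleR)
    also have "\<dots> = (\<Sum>R\<in>I. c R *\<^sub>R blinfun_apply \<phi> (koopman act (\<sigma> R) F))"
      by (rule sum.cong[OF refl]) (metis \<sigma> apply_koopman_adjoint[OF dynsys])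
    also have "\<dots> = blinfun_apply \<phi> (\<Sum>R\<in>I. c R *\<^sub>R koopman act (\<sigma> R) F)"
      by (simp add: blinfun.sum_right blinfun.scaleR_right)
    finally show ?thesis using sum_koopman[OF I(1) c] by simp
  qed
  then show ?thesis using finite_mean_combination[OF I(1) c]
      by (intro bexI[of _ "\<lambda>\<phi>. \<Sum>R\<in>I. c R * \<phi> (\<sigma> R)"]) auto
qed

lemma avg_op_in_adjoint_hull:
  "L \<in> finite_means \<Longrightarrow> \<exists>T\<in>operator_hull cdual (range (koopman_adjoint act)).
     \<forall>\<phi>\<in>cdual. \<forall>F. blinfun_apply (T \<phi>) F = blinfun_apply \<phi> (avg_op L F)"
proof (induction L rule: finite_means.induct)
  case (finite_mean_point s)
  show ?case
    by (rule bexI[OF _ operator_hull_point[OF rangeI[of "koopman_adjoint act" s]]])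
       (simp add: avg_op_point apply_koopman_adjoint[OF dynsys])
next
  case (finite_mean_mix L L' t)
  then obtain T T' where T: "T \<in> operator_hull cdual (range (koopman_adjoint act))"
    "\<forall>\<phi>\<in>cdual. \<forall>F. blinfun_apply (T \<phi>) F = blinfun_apply \<phi> (avg_op L F)"
    and T': "T' \<in> operator_hull cdual (range (koopman_adjoint act))"
    "\<forall>\<phi>\<in>cdual. \<forall>F. blinfun_apply (T' \<phi>) F = blinfun_apply \<phi> (avg_op L' F)" by blast
  show ?case
    by (rule bexI[OF _ operator_hull_convex[OF T(1) T'(1) finite_mean_mix.hyps(3,4)]])
       (simp add: avg_op_mix finite_mean_mix.hyps T(2) T'(2) blinfun.add_left blinfun.scaleR_left
         blinfun.add_right blinfun.scaleR_right)
qed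

lemma adjoint_hull_cdual:
  assumes "T \<in> operator_hull cdual (range (koopman_adjoint act))" "\<phi> \<in> cdual"
  shows "T \<phi> \<in> cdual"
proof -
  obtain L where "L \<in> finite_means" "\<forall>\<phi>\<in>cdual. \<forall>F. blinfun_apply (T \<phi>) F =
      blinfun_apply \<phi> (avg_op L F)"
    using adjoint_hull_avg_op[OF assms(1)] by blast
  then show ?thesis using assms(2) by (simp add: cdual_def avg_op_scaleC)
qed

lemma adjoint_hull_subset:
  "operator_hull cdual (range (koopman_adjoint act)) \<subseteq> topspace (self_power weak_star)"
proof
  fix T assume T: "T \<in> operator_hull cdual (range (koopman_adjoint act))"
  then have "T \<in> extensional cdual" by (auto simp: operator_hull_def)
  then show "T \<in> topspace (self_power weak_star)"
    using adjoint_hull_cdual[OF T] by (simp add: self_power_def topspace_weak_star PiE_def)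
qed

end

context tame_action
begin

lemma asymptotic_avg_op:
  assumes V: "asymptotic V" and \<phi>: "\<phi> \<in> cdual"
  shows "((\<lambda>L. blinfun_apply \<phi> (avg_op L (F - koopman act t F))) \<longlongrightarrow> 0) V"
proof -
  have finite_means: "eventually (\<lambda>L. L \<in> finite_means) V" using V by (simp add: asymptotic_def)
  have lim: "((\<lambda>L. \<psi> (avg L (\<lambda>x. g x - g (act t x)))) \<longlongrightarrow> 0) V" if "bdd_fun \<psi>" "cont g" for \<psi> g
    using V that by (simp add: asymptotic_def)
  have c: "((\<lambda>L. blinfun_apply \<phi> (cplx (avg L (\<lambda>x. g x - g (act t x))))) \<longlongrightarrow> 0) V" if "cont g" for g
    using tendsto_Complex[OF lim[OF bdd_fun_Re[of \<phi>] that] lim[OF bdd_fun_Im[of \<phi>] that]]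
    by (simp add: complex_surj flip: zero_complex.code)
  let ?G = "F - koopman act t F"
  have "((\<lambda>L. blinfun_apply \<phi> (cplx (avg L (re_part ?G))) + \<i> *
      blinfun_apply \<phi> (cplx (avg L (im_part ?G)))) \<longlongrightarrow> 0 + \<i> * 0) V"
    unfolding part_simps re_part_koopman im_part_koopman
    by (intro tendsto_add tendsto_mult_left c cont_re_part cont_im_part)
  moreover have "eventually (\<lambda>L. blinfun_apply \<phi> (cplx (avg L (re_part ?G))) + \<i> *
      blinfun_apply \<phi> (cplx (avg L (im_part ?G)))
      = blinfun_apply \<phi> (avg_op L ?G)) V"
    by (rule eventually_mono[OF finite_means]) (simp add: cdual_decomp[OF \<phi>,
        of "avg_op _ _"] re_part_avg_op im_part_avg_op)
  ultimately show ?thesis by (simp add: Lim_transform_eventually)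
qed

text \<open>
  Distinct minimal sets are disjoint, so Urysohn's lemma gives a function that is \<open>0\<close> on one of
      them and
  \<open>1\<close> on the other. Its mean along an orbit in either set is this constant.
\<close>

lemma distinct_minimal_sets_separated:
  assumes M1: "minimal_set act M1" "M1 \<subseteq> orbit_closure x"
      and M2: "minimal_set act M2" "M2 \<subseteq> orbit_closure x" and ne: "M1 \<noteq> M2"
  obtains V1 V2 f where "asymptotic V1" "asymptotic V2" "cont f"
    "((\<lambda>L. avg L f x) \<longlongrightarrow> 0) V1" "((\<lambda>L. avg L f x) \<longlongrightarrow> 1) V2"
proof -
  have c: "closed M1" "closed M2" and i: "invariant_set act M1" "invariant_set act M2"
    using M1(1) M2(1) by (simp_all add: minimal_set_def)
  have i12: "invariant_set act (M1 \<inter> M2)"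
    unfolding invariant_set_def
  proof
    show "act s ` (M1 \<inter> M2) \<subseteq> M1 \<inter> M2" for s
      using i[unfolded invariant_set_def, rule_format, of s] by blast
  qed
  have "M1 \<inter> M2 = {}"
  proof (rule ccontr)
    assume "M1 \<inter> M2 \<noteq> {}"
    moreover have "M1 \<inter> M2 = {} \<or> M1 \<inter> M2 = M1"
      using M1(1) i12 closed_Int[OF c] Int_lower1 unfolding minimal_set_def by meson
    moreover have "M1 \<inter> M2 = {} \<or> M1 \<inter> M2 = M2"
      using M2(1) i12 closed_Int[OF c] Int_lower2 unfolding minimal_set_def by meson
    ultimately have "M1 \<inter> M2 = M1" "M1 \<inter> M2 = M2" by blast+
    then show False using ne by simp
  qed
  moreover have "normal_space (euclidean :: 'k topology)"
  proof (rule compact_Hausdorff_or_regular_imp_normal_space)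
    show "compact_space (euclidean :: 'k topology)" using K by (simp add: compact_space_def)
    show "Hausdorff_space (euclidean :: 'k topology) \<or> regular_space (euclidean :: 'k topology)"
      using hausdorff[where ?'a = 'k] by (intro disjI1) (simp add: Hausdorff_space_def disjnt_def)
  qed
  ultimately obtain f where f: "continuous_map euclidean (top_of_set {0..1::real}) f"
      "f ` M1 \<subseteq> {0}" "f ` M2 \<subseteq> {1}"
    using Urysohn_lemma[of "euclidean :: 'k topology" M1 M2 0 1] c by (auto simp: disjnt_def)
  have fcf: "cont f" using f(1) by (simp add: continuous_map_in_subtopology)
  have mean_at: "mean_at f y = v" if "invariant_set act M" "f ` M \<subseteq> {v}" "y \<in> M" for M y v
  proof -
    have "f (act s y) = v" for s
      using that(1)[unfolded invariant_set_def, rule_format, of s] that(2,3) by blast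
    then show ?thesis by (simp add: mean_at_def mean_const)
  qed
  obtain y1 y2 where y: "y1 \<in> M1" "y2 \<in> M2"
    using M1(1) M2(1) unfolding minimal_set_def by (meson ex_in_conv)
  obtain V1 where V1: "asymptotic V1" "((\<lambda>L. avg L f x) \<longlongrightarrow> mean_at f y1) V1"
    using asymptotic_ultrafilter[of y1 x] y M1(2) fcf by (metis subsetD)
  obtain V2 where V2: "asymptotic V2" "((\<lambda>L. avg L f x) \<longlongrightarrow> mean_at f y2) V2"
    using asymptotic_ultrafilter[of y2 x] y M2(2) fcf by (metis subsetD)
  show ?thesis
    using that[OF V1(1) V2(1) fcf] V1(2) V2(2) mean_at[OF i(1) f(2) y(1)] mean_at[OF i(2) f(3)
        y(2)] by simp
qed

lemma unique_minimal_setI: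
  assumes "\<And>V1 V2 f. asymptotic V1 \<Longrightarrow> asymptotic V2 \<Longrightarrow> cont f \<Longrightarrow>
    ((\<lambda>L. avg L f x) \<longlongrightarrow> 0) V1 \<Longrightarrow> ((\<lambda>L. avg L f x) \<longlongrightarrow> 1) V2 \<Longrightarrow> False"
  shows "\<exists>!M. minimal_set act M \<and> M \<subseteq> orbit_closure x"
proof (rule ex_ex1I)
  show "\<exists>M. minimal_set act M \<and> M \<subseteq> orbit_closure x"
    by (rule minimal_set_exists[OF K, of "orbit_closure x" act]) (use orbit_closure_invariant in
        auto)
  fix M1 M2 assume "minimal_set act M1 \<and> M1 \<subseteq> orbit_closure x"
      "minimal_set act M2 \<and> M2 \<subseteq> orbit_closure x"
  then show "M1 = M2" using distinct_minimal_sets_separated[of M1 x M2] assms by metis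
qed

text \<open>
  A net whose tail filter is the supremum of the two ultrafilters is still ergodic, but along it
  the averages at \<open>x\<close> have the cluster points \<open>0\<close> and \<open>1\<close>.
\<close>

lemma unique_minimal_if_right_ergodic_nets_converge:
  assumes conv: "\<forall>(A :: (('k \<Rightarrow>\<^sub>C complex) \<Rightarrow> ('k \<Rightarrow>\<^sub>C complex)) net_index set) le T.
         right_ergodic_net sigma_l1 (range (koopman act)) A le T \<longrightarrow>
         (\<forall>f x. \<exists>l. ((\<lambda>\<alpha>. apply_bcontfun (T \<alpha> f) x) \<longlongrightarrow> l) (net_filter A le))"
  shows "\<exists>!M. minimal_set act M \<and> M \<subseteq> orbit_closure x"
proof (rule unique_minimal_setI)
  fix V1 V2 f assume V1: "asymptotic V1" and V2: "asymptotic V2" and f: "cont f"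
    and l1: "((\<lambda>L. avg L f x) \<longlongrightarrow> 0) V1" and l2: "((\<lambda>L. avg L f x) \<longlongrightarrow> 1) V2"
  have nb: "V1 \<noteq> bot" "V2 \<noteq> bot" and finite_means: "eventually (\<lambda>L. L \<in> finite_means) V1"
      "eventually (\<lambda>L. L \<in> finite_means) V2"
    using V1 V2 by (auto simp: asymptotic_def ultrafilter_def)
  define F where "F = sup (filtermap avg_op V1) (filtermap avg_op V2)"
  let ?H = "operator_hull UNIV (range (koopman act))"
  have Fnb: "F \<noteq> bot" using nb by (simp add: F_def filtermap_bot_iff)
  have FH: "eventually (\<lambda>t. t \<in> ?H) F"
    unfolding F_def eventually_sup eventually_filtermap
    using finite_means by (auto elim!: eventually_mono intro: avg_op_in_koopman_hull)
  obtain B :: "(('k \<Rightarrow>\<^sub>C complex) \<Rightarrow> ('k \<Rightarrow>\<^sub>C complex)) net_index set" and le' where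
    B: "directed_set B le'" "snd ` B \<subseteq> ?H" "filtermap snd (net_filter B le') = F"
    using net_of_filter[OF Fnb FH] by blast
  have "?H \<subseteq> self_power sigma_l1 closure_of ?H"
    by (rule closure_of_subset) (simp add: self_power_def topspace_sigma_l1)
  then have "operator_net sigma_l1 (range (koopman act)) B le' snd"
    using B(1,2) by (auto simp: operator_net_def topspace_sigma_l1)
  moreover have "limitin sigma_l1 (\<lambda>\<alpha>. snd \<alpha> (y - R y)) 0 (net_filter B le')"
    if R: "R \<in> range (koopman act)" for R y
  proof -
    obtain t where t: "R = koopman act t" using R by blast
    have "limitin sigma_l1 (\<lambda>T. T (y - R y)) 0 F"
      unfolding F_def limitin_sup limitin_filtermap t
      by (intro conjI limitin_sigma_l1I asymptotic_avg_op V1 V2)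
    then show ?thesis unfolding B(3)[symmetric] limitin_filtermap .
  qed
  ultimately have "right_ergodic_net sigma_l1 (range (koopman act)) B le' snd"
    by (simp add: right_ergodic_net_def)
  with conv obtain l where "((\<lambda>\<alpha>. apply_bcontfun (snd \<alpha> (cplx f)) x) \<longlongrightarrow> l) (net_filter B le')"
      by blast
  then have "((\<lambda>T. apply_bcontfun (T (cplx f)) x) \<longlongrightarrow> l) F"
    unfolding B(3)[symmetric] by (simp add: filterlim_filtermap)
  then have l: "((\<lambda>L. apply_bcontfun (avg_op L (cplx f)) x) \<longlongrightarrow> l) V1"
      "((\<lambda>L. apply_bcontfun (avg_op L (cplx f)) x) \<longlongrightarrow> l) V2"
    by (auto simp: F_def tendsto_sup filterlim_filtermap)
  have ev: "eventually (\<lambda>L. Re (apply_bcontfun (avg_op L (cplx f)) x) = avg L f x) V"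
      if "eventually (\<lambda>L. L \<in> finite_means) V" for V
    by (rule eventually_mono[OF that]) (simp add: apply_avg_op re_part_cplx f)
  have "((\<lambda>L. avg L f x) \<longlongrightarrow> Re l) V1" "((\<lambda>L. avg L f x) \<longlongrightarrow> Re l) V2"
    by (rule Lim_transform_eventually[OF tendsto_Re[OF l(1)] ev[OF finite_means(1)]],
        rule Lim_transform_eventually[OF tendsto_Re[OF l(2)] ev[OF finite_means(2)]])
  then show False using tendsto_unique[OF nb(1) l1] tendsto_unique[OF nb(2) l2] by force
qed

text \<open>
  The same construction for the adjoint operators; the point \<open>x\<close> now enters through the functional
  \<open>\<delta>\<close> of evaluation at \<open>x\<close>.
\<close>

lemma unique_minimal_if_weak_star_mean_ergodic:
  assumes conv: "weak_star_mean_ergodic act"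
  shows "\<exists>!M. minimal_set act M \<and> M \<subseteq> orbit_closure x"
proof (rule unique_minimal_setI)
  fix V1 V2 f assume V1: "asymptotic V1" and V2: "asymptotic V2" and f: "cont f"
    and l1: "((\<lambda>L. avg L f x) \<longlongrightarrow> 0) V1" and l2: "((\<lambda>L. avg L f x) \<longlongrightarrow> 1) V2"
  have nb: "V1 \<noteq> bot" "V2 \<noteq> bot" and finite_means: "eventually (\<lambda>L. L \<in> finite_means) V1"
      "eventually (\<lambda>L. L \<in> finite_means) V2"
    using V1 V2 by (auto simp: asymptotic_def ultrafilter_def)
  let ?H = "operator_hull cdual (range (koopman_adjoint act))"
  obtain adj where adj: "\<And>L. L \<in> finite_means \<Longrightarrow> adj L \<in> ?H"
    "\<And>L \<phi> F. L \<in> finite_means \<Longrightarrow> \<phi> \<in> cdual \<Longrightarrow> blinfun_apply (adj L \<phi>) F =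
        blinfun_apply \<phi> (avg_op L F)"
    using avg_op_in_adjoint_hull by metis
  define F where "F = sup (filtermap adj V1) (filtermap adj V2)"
  have Fnb: "F \<noteq> bot" using nb by (simp add: F_def filtermap_bot_iff)
  have FH: "eventually (\<lambda>t. t \<in> ?H) F"
    unfolding F_def eventually_sup eventually_filtermap
    using finite_means by (auto elim!: eventually_mono intro: adj)
  obtain B :: "((('k \<Rightarrow>\<^sub>C complex) \<Rightarrow>\<^sub>L complex) \<Rightarrow> (('k \<Rightarrow>\<^sub>C complex) \<Rightarrow>\<^sub>L complex)) net_index set"
      and le' where
    B: "directed_set B le'" "snd ` B \<subseteq> ?H" "filtermap snd (net_filter B le') = F"
    using net_of_filter[OF Fnb FH] by blast
  have "?H \<subseteq> self_power weak_star closure_of ?H" by (rule closure_of_subset[OF adjoint_hull_subset])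
  then have "operator_net weak_star (range (koopman_adjoint act)) B le' snd"
    using B(1,2) by (auto simp: operator_net_def topspace_weak_star)
  moreover have "limitin weak_star (\<lambda>\<alpha>. snd \<alpha> \<phi> - R (snd \<alpha> \<phi>)) 0 (net_filter B le')"
    if R: "R \<in> range (koopman_adjoint act)" and \<phi>: "\<phi> \<in> cdual" for R \<phi>
  proof -
    obtain t where t: "R = koopman_adjoint act t" using R by blast
    have "limitin weak_star (\<lambda>L. adj L \<phi> - R (adj L \<phi>)) 0 V" if V: "asymptotic V" for V
      unfolding limitin_weak_star_iff
    proof (intro conjI allI)
      have finite_means: "eventually (\<lambda>L. L \<in> finite_means) V" using V by (simp add: asymptotic_def)
      show "0 \<in> cdual" by (simp add: cdual_def)
      show "eventually (\<lambda>L. adj L \<phi> - R (adj L \<phi>) \<in> cdual) V"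
      proof (rule eventually_mono[OF finite_means])
        fix L :: "('s \<Rightarrow> real) \<Rightarrow> real" assume "L \<in> finite_means"
        then have "adj L \<phi> \<in> cdual" by (rule adjoint_hull_cdual[OF adj(1) \<phi>])
        then have "R (adj L \<phi>) \<in> cdual" unfolding t by (rule koopman_adjoint_cdual[OF dynsys])
        with \<open>adj L \<phi> \<in> cdual\<close> show "adj L \<phi> - R (adj L \<phi>) \<in> cdual"
          by (simp add: cdual_def blinfun.diff_left algebra_simps)
      qed
      fix G
      have "eventually (\<lambda>L. blinfun_apply \<phi> (avg_op L (G - koopman act t G)) =
          blinfun_apply (adj L \<phi> - R (adj L \<phi>)) G) V"
      proof (rule eventually_mono[OF finite_means])
        fix L :: "('s \<Rightarrow> real) \<Rightarrow> real" assume L: "L \<in> finite_means"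
        have "blinfun_apply \<phi> (avg_op L (G - koopman act t G)) =
            blinfun_apply (adj L \<phi>) (G - koopman act t G)"
          using adj(2)[OF L \<phi>] by simp
        then show "blinfun_apply \<phi> (avg_op L (G - koopman act t G)) =
            blinfun_apply (adj L \<phi> - R (adj L \<phi>)) G"
          by (simp add: t blinfun.diff_left blinfun.diff_right apply_koopman_adjoint[OF dynsys])
      qed
      then show "((\<lambda>L. blinfun_apply (adj L \<phi> - R (adj L \<phi>)) G) \<longlongrightarrow> blinfun_apply 0 G) V"
        using Lim_transform_eventually[OF asymptotic_avg_op[OF V \<phi>, of G t]] by simp
    qed
    then have "limitin weak_star (\<lambda>T. T \<phi> - R (T \<phi>)) 0 F"
      unfolding F_def limitin_sup limitin_filtermap using V1 V2 by blast
    then show ?thesis unfolding B(3)[symmetric] limitin_filtermap .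
  qed
  ultimately have "left_ergodic_net weak_star (range (koopman_adjoint act)) B le' snd"
    by (simp add: left_ergodic_net_def topspace_weak_star)
  then have conv': "\<forall>\<phi>\<in>cdual. \<exists>\<psi>. limitin weak_star (\<lambda>\<alpha>. snd \<alpha> \<phi>) \<psi> (net_filter B le')"
    using conv unfolding weak_star_mean_ergodic_def by blast
  have "bdd_fun (\<lambda>f. f x)" unfolding bdd_fun_def lin_fun_def by (auto intro!: exI[of _ 1])
  from complexify[OF this] obtain \<delta> where \<delta>: "\<delta> \<in> cdual"
      "\<And>f. cont f \<Longrightarrow> blinfun_apply \<delta> (cplx f) = complex_of_real (f x)"
    by blast
  from conv' \<delta>(1) obtain \<psi> where "limitin weak_star (\<lambda>\<alpha>. snd \<alpha> \<delta>) \<psi> (net_filter B le')" by blast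
  then have "limitin weak_star (\<lambda>T. T \<delta>) \<psi> F"
    unfolding B(3)[symmetric] limitin_filtermap .
  then have "limitin weak_star (\<lambda>L. adj L \<delta>) \<psi> V1" "limitin weak_star (\<lambda>L. adj L \<delta>) \<psi> V2"
    by (auto simp: F_def limitin_sup limitin_filtermap)
  then have l: "((\<lambda>L. blinfun_apply (adj L \<delta>) (cplx f)) \<longlongrightarrow> blinfun_apply \<psi> (cplx f)) V1"
    "((\<lambda>L. blinfun_apply (adj L \<delta>) (cplx f)) \<longlongrightarrow> blinfun_apply \<psi> (cplx f)) V2"
    by (auto simp: limitin_weak_star_iff)
  have ev: "eventually (\<lambda>L. Re (blinfun_apply (adj L \<delta>) (cplx f)) = avg L f x) V"
      if "eventually (\<lambda>L. L \<in> finite_means) V" for V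
    by (rule eventually_mono[OF that]) (simp add: adj(2)[OF _ \<delta>(1)] avg_op_cplx f \<delta>(2) cont_avg)
  have "((\<lambda>L. avg L f x) \<longlongrightarrow> Re (blinfun_apply \<psi> (cplx f))) V1"
      "((\<lambda>L. avg L f x) \<longlongrightarrow> Re (blinfun_apply \<psi> (cplx f))) V2"
    by (rule Lim_transform_eventually[OF tendsto_Re[OF l(1)] ev[OF finite_means(1)]],
        rule Lim_transform_eventually[OF tendsto_Re[OF l(2)] ev[OF finite_means(2)]])
  then show False using tendsto_unique[OF nb(1) l1] tendsto_unique[OF nb(2) l2] by force
qed

text \<open>
  Only the values at \<open>x\<close> matter. A limit of \<open>T \<alpha> F x\<close> along an ultrafilter is also a limit of
      averages
  at \<open>x\<close>, and these are asymptotically invariant because the net is right ergodic.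
\<close>

lemma right_ergodic_nets_converge:
  fixes T :: "'i \<Rightarrow> ('k \<Rightarrow>\<^sub>C complex) \<Rightarrow> ('k \<Rightarrow>\<^sub>C complex)"
  assumes uni: "\<And>x. \<exists>!M. minimal_set act M \<and> M \<subseteq> orbit_closure x"
    and T: "right_ergodic_net sigma_l1 (range (koopman act)) A le T"
  shows "\<exists>l. ((\<lambda>\<alpha>. apply_bcontfun (T \<alpha> F) x) \<longlongrightarrow> l) (net_filter A le)"
proof -
  let ?H = "operator_hull UNIV (range (koopman act))"
  let ?N = "net_filter A le"
  have dir: "directed_set A le" and TA: "T ` A \<subseteq> self_power sigma_l1 closure_of ?H"
    and erg: "\<And>t G. limitin sigma_l1 (\<lambda>\<alpha>. T \<alpha> (G - koopman act t G)) 0 ?N"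
    using T by (auto simp: right_ergodic_net_def operator_net_def topspace_sigma_l1)
  obtain M where M: "minimal_set act M" "M \<subseteq> orbit_closure x"
      "\<And>M'. minimal_set act M' \<Longrightarrow> M' \<subseteq> orbit_closure x \<Longrightarrow> M' = M" using uni[of x] by blast
  obtain y where y: "y \<in> M" using M(1) by (auto simp: minimal_set_def)
  let ?a = "\<lambda>z. if z = x then 1 else 0 :: complex"
  have approx: "\<exists>L\<in>finite_means. \<forall>G\<in>J. dist (apply_bcontfun (avg_op L G) x) (apply_bcontfun (T \<alpha>
      G) x) < e"
    if \<alpha>: "\<alpha> \<in> A" and J: "finite J" "J \<subseteq> UNIV" and e: "e > 0" for \<alpha> J e
  proof -
    let ?P = "(\<lambda>a f. norm (blinfun_apply (l1_functional a) f)) ` {a :: 'k \<Rightarrow> complex. (\<lambda>x. norm (a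
        x)) summable_on UNIV}"
    let ?p = "\<lambda>f. norm (blinfun_apply (l1_functional ?a) f)"
    have pP: "?p \<in> ?P" by (rule imageI) (simp only: mem_Collect_eq l1_functional_indicator(1))
    have "T \<alpha> \<in> self_power (seminorm_topology UNIV ?P) closure_of ?H"
      using TA \<alpha> unfolding sigma_l1_alt by blast
    moreover have "?P \<noteq> {}" using pP by (metis empty_iff)
    moreover have "p 0 = 0" if "p \<in> ?P" for p using that by (elim imageE) simp
    moreover have "(\<lambda>G. (G, ?p)) ` J \<subseteq> UNIV \<times> ?P"
    proof (rule image_subsetI)
      show "(G, ?p) \<in> UNIV \<times> ?P" for G using pP by (intro SigmaI UNIV_I)
    qed
    ultimately have "\<exists>T'\<in>?H. \<forall>(G, p)\<in>(\<lambda>G. (G, ?p)) ` J. p (T' G - T \<alpha> G) < e"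
      using closure_of_self_power_approx[of "T \<alpha>" UNIV ?P ?H "(\<lambda>G. (G, ?p)) ` J" e] J(1) e by blast
    then obtain T' where T': "T' \<in> ?H" "\<forall>G\<in>J. ?p (T' G - T \<alpha> G) < e" by auto
    from koopman_hull_avg_op[OF T'(1)] obtain L where "L \<in> finite_means" "T' = avg_op L" by blast
    with T'(2) show ?thesis
      by (auto simp: l1_functional_indicator(2) blinfun.diff_right dist_norm)
  qed
  have bound: "dist 0 (apply_bcontfun (T \<alpha> G) x) \<le> 2 * norm G + 1" if \<alpha>: "\<alpha> \<in> A" for \<alpha> G
  proof -
    from approx[OF \<alpha>, of "{G}" 1] obtain L where L: "L \<in> finite_means"
        "dist (apply_bcontfun (avg_op L G) x) (apply_bcontfun (T \<alpha> G) x) < 1"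
      by auto
    have "norm (apply_bcontfun (avg_op L G) x) \<le> 2 * norm G"
      using norm_avg_op[OF L(1), of G] norm_bounded[of "avg_op L G" x] by simp
    then show ?thesis
      using L(2) dist_triangle[of 0 "apply_bcontfun (T \<alpha> G) x" "apply_bcontfun (avg_op L G) x"]
          by simp
  qed
  have "((\<lambda>\<alpha>. apply_bcontfun (T \<alpha> F) x) \<longlongrightarrow> Complex (mean_at (re_part F) y) (mean_at (im_part F) y))
      ?N"
  proof (rule tendsto_by_ultrafilter)
    fix U assume UN: "U \<le> ?N" and U: "ultrafilter U"
    have Unb: "U \<noteq> bot" using U by (simp add: ultrafilter_def)
    have UA: "eventually (\<lambda>\<alpha>. \<alpha> \<in> A) U" by (rule filter_leD[OF UN eventually_in_net[OF dir]])
    have "\<exists>V l. ultrafilter V \<and> eventually (\<lambda>L. L \<in> finite_means) V \<and>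
      (\<forall>G\<in>UNIV. ((\<lambda>\<alpha>. apply_bcontfun (T \<alpha> G) x) \<longlongrightarrow> l G) U \<and>
          ((\<lambda>L. apply_bcontfun (avg_op L G) x) \<longlongrightarrow> l G) V)"
      by (rule ultrafilter_transfer[OF U UA approx bound])
    then obtain V l where V: "ultrafilter V" "eventually (\<lambda>L. L \<in> finite_means) V"
      "\<And>G. ((\<lambda>L. apply_bcontfun (avg_op L G) x) \<longlongrightarrow> l G) V"
      and l: "\<And>G. ((\<lambda>\<alpha>. apply_bcontfun (T \<alpha> G) x) \<longlongrightarrow> l G) U" by blast
    have Vnb: "V \<noteq> bot" using V(1) by (simp add: ultrafilter_def)
    have inv: "((\<lambda>L. avg L (\<lambda>x. g x - g (act t x)) x) \<longlongrightarrow> 0) V" if g: "cont g" for g t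
    proof -
      let ?G = "cplx g - koopman act t (cplx g)"
      have "((\<lambda>\<alpha>. apply_bcontfun (T \<alpha> ?G) x) \<longlongrightarrow> 0) U"
        by (rule tendsto_mono[OF UN limitin_sigma_l1_pointwise[OF erg]])
      then have "l ?G = 0" using tendsto_unique[OF Unb l] by blast
      then have lim: "((\<lambda>L. Re (apply_bcontfun (avg_op L ?G) x)) \<longlongrightarrow> 0) V"
        using tendsto_Re[OF V(3)[of ?G]] by simp
      have "re_part ?G = (\<lambda>x. g x - g (act t x))"
          by (simp add: part_simps re_part_koopman re_part_cplx g)
      then have "eventually (\<lambda>L. Re (apply_bcontfun (avg_op L ?G) x) =
          avg L (\<lambda>x. g x - g (act t x)) x) V"
        by (intro eventually_mono[OF V(2)]) (simp add: apply_avg_op)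
      then show ?thesis by (rule Lim_transform_eventually[OF lim])
    qed
    have limf: "((\<lambda>L. avg L f x) \<longlongrightarrow> mean_at f y) V" if "cont f" for f
      by (rule avg_tendsto_mean_at[OF V(2) inv M(3,1,2) y that])
    have "((\<lambda>L. Complex (avg L (re_part F) x) (avg L (im_part F) x)) \<longlongrightarrow> Complex (mean_at (re_part
        F) y) (mean_at (im_part F) y)) V"
      by (intro tendsto_Complex limf cont_re_part cont_im_part)
    moreover have "eventually (\<lambda>L. Complex (avg L (re_part F) x) (avg L (im_part F) x) =
        apply_bcontfun (avg_op L F) x) V"
      by (intro eventually_mono[OF V(2)]) (simp add: apply_avg_op)
    ultimately have "((\<lambda>L. apply_bcontfun (avg_op L F) x) \<longlongrightarrow> Complex (mean_at (re_part F) y)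
        (mean_at (im_part F) y)) V"
      by (rule Lim_transform_eventually)
    then have "l F = Complex (mean_at (re_part F) y) (mean_at (im_part F) y)"
        using tendsto_unique[OF Vnb V(3)] by blast
    then show "((\<lambda>\<alpha>. apply_bcontfun (T \<alpha> F) x) \<longlongrightarrow> Complex (mean_at (re_part F) y) (mean_at (im_part
        F) y)) U" using l[of F] by simp
  qed
  then show ?thesis by blast
qed

text \<open>
  The limits of the net along an ultrafilter are also limits of averages along an ultrafilter of
  finite means, which is asymptotically invariant since the net is left ergodic. By uniqueness of
      such
  limits, they do not depend on the ultrafilter, so the net converges; the limit is a dual
      functional
  because all operators of the net are contractions up to a factor of \<open>2\<close>.
\<close>

lemma left_ergodic_nets_converge:
  fixes T :: "'i \<Rightarrow> (('k \<Rightarrow>\<^sub>C complex) \<Rightarrow>\<^sub>L complex) \<Rightarrow> (('k \<Rightarrow>\<^sub>C complex) \<Rightarrow>\<^sub>L complex)"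
  assumes \<B>: "countable \<B>" "\<And>B :: 'k set. B \<in> \<B> \<Longrightarrow> open B"
      "\<And>(U :: 'k set) x. open U \<Longrightarrow> x \<in> U \<Longrightarrow> \<exists>B\<in>\<B>. x \<in> B \<and> B \<subseteq> U"
    and uni: "\<And>x. \<exists>!M. minimal_set act M \<and> M \<subseteq> orbit_closure x"
    and T: "left_ergodic_net weak_star (range (koopman_adjoint act)) A le T" and \<phi>0: "\<phi>0 \<in> cdual"
  shows "\<exists>\<psi>. limitin weak_star (\<lambda>\<alpha>. T \<alpha> \<phi>0) \<psi> (net_filter A le)"
proof -
  let ?H = "operator_hull cdual (range (koopman_adjoint act))"
  let ?N = "net_filter A le"
  have dir: "directed_set A le" and TA: "T ` A \<subseteq> self_power weak_star closure_of ?H"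
    and erg: "\<And>t \<phi>. \<phi> \<in> cdual \<Longrightarrow> limitin weak_star (\<lambda>\<alpha>. T \<alpha> \<phi> - koopman_adjoint act t (T \<alpha> \<phi>)) 0 ?N"
    using T by (auto simp: left_ergodic_net_def operator_net_def topspace_weak_star)
  have approx0: "(\<forall>\<phi>\<in>cdual. T \<alpha> \<phi> \<in> cdual) \<and>
      (\<exists>L\<in>finite_means. \<forall>(\<phi>, G)\<in>J. dist (blinfun_apply \<phi> (avg_op L G)) (blinfun_apply (T \<alpha> \<phi>) G) <
          e)"
    if \<alpha>: "\<alpha> \<in> A" and J: "finite J" "J \<subseteq> cdual \<times> UNIV" and e: "e > 0" for \<alpha> J e
  proof -
    let ?P = "range (\<lambda>(f :: 'k \<Rightarrow>\<^sub>C complex) \<phi>. norm (blinfun_apply \<phi> f))"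
    let ?J = "(\<lambda>(\<phi>, G). (\<phi>, \<lambda>\<phi>. norm (blinfun_apply \<phi> G))) ` J"
    have T\<alpha>: "T \<alpha> \<in> self_power (seminorm_topology cdual ?P) closure_of ?H"
      using TA \<alpha> unfolding weak_star_def by blast
    have J': "finite ?J" "?J \<subseteq> cdual \<times> ?P" using J by auto
    have cl: "(\<forall>\<phi>\<in>cdual. T \<alpha> \<phi> \<in> cdual) \<and> (\<exists>T'\<in>?H. \<forall>(\<phi>, p)\<in>?J. p (T' \<phi> - T \<alpha> \<phi>) < e)"
      by (rule closure_of_self_power_approx[OF T\<alpha> _ _ J' e]) auto
    then obtain T' where T': "T' \<in> ?H" "\<forall>(\<phi>, p)\<in>?J. p (T' \<phi> - T \<alpha> \<phi>) < e" by blast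
    from adjoint_hull_avg_op[OF T'(1)] obtain L where
      L: "L \<in> finite_means" "\<forall>\<phi>\<in>cdual. \<forall>F. blinfun_apply (T' \<phi>) F = blinfun_apply \<phi> (avg_op L F)"
          by blast
    have "dist (blinfun_apply \<phi> (avg_op L G)) (blinfun_apply (T \<alpha> \<phi>) G) < e" if "(\<phi>, G) \<in> J" for \<phi> G
    proof -
      have inJ: "(\<phi>, \<lambda>\<phi> :: ('k \<Rightarrow>\<^sub>C complex) \<Rightarrow>\<^sub>L complex. norm (blinfun_apply \<phi> G)) \<in> ?J"
        using that by force
      then have "norm (blinfun_apply (T' \<phi> - T \<alpha> \<phi>) G) < e" using bspec[OF T'(2) inJ] by simp
      moreover have "\<phi> \<in> cdual" using that J(2) by blast
      ultimately show ?thesis using L(2) by (simp add: blinfun.diff_left dist_norm)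
    qed
    then show ?thesis using cl L(1) by blast
  qed
  have Tc: "T \<alpha> \<phi> \<in> cdual" if "\<alpha> \<in> A" "\<phi> \<in> cdual" for \<alpha> \<phi>
    using approx0[OF that(1), of "{}" 1] that(2) by simp
  have approx: "\<exists>L\<in>finite_means. \<forall>(\<phi>, G)\<in>J. dist (blinfun_apply \<phi> (avg_op L G)) (blinfun_apply (T
      \<alpha> \<phi>) G) < e"
    if \<alpha>: "\<alpha> \<in> A" and J: "finite J" "J \<subseteq> cdual \<times> UNIV" and e: "e > 0" for \<alpha> J e
    using approx0[OF that] by blast
  have bound: "dist 0 (blinfun_apply (T \<alpha> \<phi>) G) \<le> norm G * (2 * norm \<phi>)" if \<alpha>: "\<alpha> \<in> A"
      and \<phi>: "\<phi> \<in> cdual" for \<alpha> \<phi> G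
  proof (rule field_le_epsilon)
    fix e :: real assume e: "e > 0"
    from approx[OF \<alpha> _ _ e, of "{(\<phi>, G)}"] \<phi> obtain L where
      L: "L \<in> finite_means" "dist (blinfun_apply \<phi> (avg_op L G)) (blinfun_apply (T \<alpha> \<phi>) G) < e"
          by auto
    have "norm (blinfun_apply \<phi> (avg_op L G)) \<le> norm \<phi> * norm (avg_op L G)" by (rule norm_blinfun)
    also have "\<dots> \<le> norm \<phi> * (2 * norm G)" by (rule mult_left_mono[OF norm_avg_op[OF L(1)]]) simp
    finally show "dist 0 (blinfun_apply (T \<alpha> \<phi>) G) \<le> norm G * (2 * norm \<phi>) + e"
      using L(2) dist_triangle[of 0 "blinfun_apply (T \<alpha> \<phi>) G" "blinfun_apply \<phi> (avg_op L G)"]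
      by (simp add: mult_ac)
  qed
  have cluster: "\<exists>V l. asymptotic V \<and> (\<forall>\<phi>\<in>cdual. \<forall>G. ((\<lambda>\<alpha>. blinfun_apply (T \<alpha> \<phi>) G) \<longlongrightarrow> l \<phi> G) U \<and>
      ((\<lambda>L. blinfun_apply \<phi> (avg_op L G)) \<longlongrightarrow> l \<phi> G) V)"
    if UN: "U \<le> ?N" and U: "ultrafilter U" for U
  proof -
    have Unb: "U \<noteq> bot" using U by (simp add: ultrafilter_def)
    have UA: "eventually (\<lambda>\<alpha>. \<alpha> \<in> A) U" by (rule filter_leD[OF UN eventually_in_net[OF dir]])
    have "\<exists>V l. ultrafilter V \<and> eventually (\<lambda>L. L \<in> finite_means) V \<and> (\<forall>j\<in>cdual \<times> UNIV.
      ((\<lambda>\<alpha>. blinfun_apply (T \<alpha> (fst j)) (snd j)) \<longlongrightarrow> l j) U \<and>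
          ((\<lambda>L. blinfun_apply (fst j) (avg_op L (snd j))) \<longlongrightarrow> l j) V)"
      by (rule ultrafilter_transfer[OF U UA, where B = "\<lambda>j. norm (snd j) * (2 * norm (fst j))"
          and a = 0])
         (use approx bound in \<open>auto simp: split_beta\<close>)
    then obtain V l' where V: "ultrafilter V" "eventually (\<lambda>L. L \<in> finite_means) V"
        and l': "\<And>j. j \<in> cdual \<times> UNIV \<Longrightarrow>
      ((\<lambda>\<alpha>. blinfun_apply (T \<alpha> (fst j)) (snd j)) \<longlongrightarrow> l' j) U \<and>
          ((\<lambda>L. blinfun_apply (fst j) (avg_op L (snd j))) \<longlongrightarrow> l' j) V"
      by blast
    define l where "l \<phi> G = l' (\<phi>, G)" for \<phi> G
    have l: "((\<lambda>\<alpha>. blinfun_apply (T \<alpha> \<phi>) G) \<longlongrightarrow> l \<phi> G) U"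
      and Vl: "((\<lambda>L. blinfun_apply \<phi> (avg_op L G)) \<longlongrightarrow> l \<phi> G) V" if "\<phi> \<in> cdual" for \<phi> G
      using l'[of "(\<phi>, G)"] that by (simp_all add: l_def)
    have "((\<lambda>L. \<psi> (avg L (\<lambda>x. g x - g (act t x)))) \<longlongrightarrow> 0) V" if \<psi>: "bdd_fun \<psi>" and g: "cont g"
        for \<psi> g t
    proof -
      from complexify[OF \<psi>] obtain \<phi> where \<phi>: "\<phi> \<in> cdual"
          "\<And>f. cont f \<Longrightarrow> blinfun_apply \<phi> (cplx f) = complex_of_real (\<psi> f)"
        by blast
      let ?g = "\<lambda>x. g x - g (act t x)"
      have gt: "cont ?g" by (intro continuous_on_diff g cont_act)
      have G: "cplx ?g = cplx g - koopman act t (cplx g)"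
        by (rule bcontfun_parts_eqI) (simp_all add: part_simps re_part_koopman im_part_koopman
            re_part_cplx im_part_cplx g gt)
      have "((\<lambda>\<alpha>. blinfun_apply (T \<alpha> \<phi> - koopman_adjoint act t (T \<alpha> \<phi>)) (cplx g)) \<longlongrightarrow> blinfun_apply
          0 (cplx g)) U"
        using erg[OF \<phi>(1), of t] tendsto_mono[OF UN] by (auto simp: limitin_weak_star_iff)
      then have "((\<lambda>\<alpha>. blinfun_apply (T \<alpha> \<phi>) (cplx ?g)) \<longlongrightarrow> 0) U"
        by (simp add: G blinfun.diff_left blinfun.diff_right apply_koopman_adjoint[OF dynsys])
      then have "l \<phi> (cplx ?g) = 0" using tendsto_unique[OF Unb l[OF \<phi>(1)]] by blast
      then have lim: "((\<lambda>L. Re (blinfun_apply \<phi> (avg_op L (cplx ?g)))) \<longlongrightarrow> 0) V"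
        using tendsto_Re[OF Vl[OF \<phi>(1), of "cplx ?g"]] by simp
      have "eventually (\<lambda>L. Re (blinfun_apply \<phi> (avg_op L (cplx ?g))) = \<psi> (avg L ?g)) V"
        by (rule eventually_mono[OF V(2)]) (simp add: avg_op_cplx gt \<phi>(2) cont_avg)
      then show ?thesis by (rule Lim_transform_eventually[OF lim])
    qed
    then have "asymptotic V" using V(1,2) by (simp add: asymptotic_def)
    then show ?thesis using l Vl by blast
  qed
  obtain U0 where U0: "U0 \<le> ?N" "ultrafilter U0"
      using ultrafilter_ex[OF net_filter_nonbot[OF dir]] by blast
  from cluster[OF this] obtain V0 l0 where V0: "asymptotic V0"
    "\<And>\<phi> G. \<phi> \<in> cdual \<Longrightarrow> ((\<lambda>L. blinfun_apply \<phi> (avg_op L G)) \<longlongrightarrow> l0 \<phi> G) V0"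
    and l0: "\<And>\<phi> G. \<phi> \<in> cdual \<Longrightarrow> ((\<lambda>\<alpha>. blinfun_apply (T \<alpha> \<phi>) G) \<longlongrightarrow> l0 \<phi> G) U0" by blast
  have U0nb: "U0 \<noteq> bot" using U0 by (simp add: ultrafilter_def)
  have U0A: "eventually (\<lambda>\<alpha>. \<alpha> \<in> A) U0" by (rule filter_leD[OF U0(1) eventually_in_net[OF dir]])
  have lim: "((\<lambda>\<alpha>. blinfun_apply (T \<alpha> \<phi>) G) \<longlongrightarrow> l0 \<phi> G) ?N" if \<phi>: "\<phi> \<in> cdual" for \<phi> G
  proof (rule tendsto_by_ultrafilter)
    fix U assume UN: "U \<le> ?N" and U: "ultrafilter U"
    from cluster[OF this] obtain V l where V: "asymptotic V"
      "\<And>\<phi> G. \<phi> \<in> cdual \<Longrightarrow> ((\<lambda>L. blinfun_apply \<phi> (avg_op L G)) \<longlongrightarrow> l \<phi> G) V"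
      and l: "\<And>\<phi> G. \<phi> \<in> cdual \<Longrightarrow> ((\<lambda>\<alpha>. blinfun_apply (T \<alpha> \<phi>) G) \<longlongrightarrow> l \<phi> G) U" by blast
    have real: "l \<phi> (cplx f) = l0 \<phi> (cplx f)" if f: "cont f" for f
    proof -
      have R: "((\<lambda>L. blinfun_apply \<phi> (cplx (avg L f))) \<longlongrightarrow> c) V"
          if "asymptotic V" "((\<lambda>L. blinfun_apply \<phi> (avg_op L (cplx f))) \<longlongrightarrow> c) V" for V c
      proof (rule Lim_transform_eventually[OF that(2)])
        have "eventually (\<lambda>L. L \<in> finite_means) V" using that(1) by (simp add: asymptotic_def)
        then show "eventually (\<lambda>L. blinfun_apply \<phi> (avg_op L (cplx f)) =
            blinfun_apply \<phi> (cplx (avg L f))) V"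
          by (rule eventually_mono) (simp add: avg_op_cplx f)
      qed
      note a = R[OF V(1) V(2)[OF \<phi>]] and b = R[OF V0(1) V0(2)[OF \<phi>]]
      have "Re (l \<phi> (cplx f)) = Re (l0 \<phi> (cplx f))"
        by (rule asymptotic_limit_unique[OF \<B> uni V(1) V0(1) bdd_fun_Re f tendsto_Re[OF a]
            tendsto_Re[OF b]])
      moreover have "Im (l \<phi> (cplx f)) = Im (l0 \<phi> (cplx f))"
        by (rule asymptotic_limit_unique[OF \<B> uni V(1) V0(1) bdd_fun_Im f tendsto_Im[OF a]
            tendsto_Im[OF b]])
      ultimately show ?thesis by (rule complex_eqI)
    qed
    have dec: "l G = l (cplx (re_part G)) + \<i> * l (cplx (im_part G))"
      if U: "ultrafilter U" and UN: "U \<le> ?N" and l: "\<And>G. ((\<lambda>\<alpha>. blinfun_apply (T \<alpha> \<phi>) G) \<longlongrightarrow> l G) U"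
          for U l
    proof (rule tendsto_unique[OF _ l])
      show "U \<noteq> bot" using U by (simp add: ultrafilter_def)
      have UA: "eventually (\<lambda>\<alpha>. \<alpha> \<in> A) U" by (rule filter_leD[OF UN eventually_in_net[OF dir]])
      have "eventually (\<lambda>\<alpha>. blinfun_apply (T \<alpha> \<phi>) (cplx (re_part G)) + \<i> *
          blinfun_apply (T \<alpha> \<phi>) (cplx (im_part G)) = blinfun_apply (T \<alpha> \<phi>) G) U"
        by (rule eventually_mono[OF UA]) (rule cdual_decomp[OF Tc[OF _ \<phi>], symmetric])
      then show "((\<lambda>\<alpha>. blinfun_apply (T \<alpha> \<phi>) G) \<longlongrightarrow> l (cplx (re_part G)) + \<i> *
          l (cplx (im_part G))) U"
        by (rule Lim_transform_eventually[rotated]) (intro tendsto_add tendsto_mult_left l)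
    qed
    have "l \<phi> G = l0 \<phi> G"
      using dec[OF U UN, of "l \<phi>"] l[OF \<phi>] dec[OF U0(2,1),
          of "l0 \<phi>"] l0[OF \<phi>] real[OF cont_re_part] real[OF cont_im_part] by simp
    then show "((\<lambda>\<alpha>. blinfun_apply (T \<alpha> \<phi>) G) \<longlongrightarrow> l0 \<phi> G) U" using l[OF \<phi>, of G] by simp
  qed
  let ?l = "l0 \<phi>0"
  have "bounded_linear ?l"
  proof (rule bounded_linear_intro[of _ "2 * norm \<phi>0"])
    show "?l (F + G) = ?l F + ?l G" for F G
      by (rule tendsto_unique[OF U0nb l0[OF \<phi>0]]) (simp add: blinfun.add_right tendsto_add l0[OF
          \<phi>0])
    show "?l (r *\<^sub>R F) = r *\<^sub>R ?l F" for r F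
      by (rule tendsto_unique[OF U0nb l0[OF \<phi>0]]) (simp only: blinfun.scaleR_right,
          intro tendsto_scaleR tendsto_const l0[OF \<phi>0])
    show "norm (?l F) \<le> norm F * (2 * norm \<phi>0)" for F
    proof (rule tendsto_upperbound[OF tendsto_norm[OF l0[OF \<phi>0]] _ U0nb])
      show "eventually (\<lambda>\<alpha>. norm (blinfun_apply (T \<alpha> \<phi>0) F) \<le> norm F * (2 * norm \<phi>0)) U0"
        by (rule eventually_mono[OF U0A]) (use bound[OF _ \<phi>0] in simp)
    qed
  qed
  then have a: "blinfun_apply (Blinfun ?l) F = ?l F" for F
      by (simp add: bounded_linear_Blinfun_apply)
  have "?l (scaleC_bcontfun c F) = c * ?l F" for c F
  proof (rule tendsto_unique[OF U0nb l0[OF \<phi>0]])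
    have "eventually (\<lambda>\<alpha>. c * blinfun_apply (T \<alpha> \<phi>0) F =
        blinfun_apply (T \<alpha> \<phi>0) (scaleC_bcontfun c F)) U0"
      by (rule eventually_mono[OF U0A]) (use Tc[OF _ \<phi>0] in \<open>simp add: cdual_def\<close>)
    then show "((\<lambda>\<alpha>. blinfun_apply (T \<alpha> \<phi>0) (scaleC_bcontfun c F)) \<longlongrightarrow> c * ?l F) U0"
      by (rule Lim_transform_eventually[OF tendsto_mult_left[OF l0[OF \<phi>0]]])
  qed
  then have "Blinfun ?l \<in> cdual" by (simp add: cdual_def a)
  moreover have "eventually (\<lambda>\<alpha>. T \<alpha> \<phi>0 \<in> cdual) ?N"
    by (rule eventually_mono[OF eventually_in_net[OF dir]]) (rule Tc[OF _ \<phi>0])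
  ultimately have "limitin weak_star (\<lambda>\<alpha>. T \<alpha> \<phi>0) (Blinfun ?l) ?N"
    using lim[OF \<phi>0] by (simp add: limitin_weak_star_iff a)
  then show ?thesis by blast
qed

end

section \<open>The equivalence theorem\<close>

lemma compact_metrizable_countable_base:
  assumes K: "compact (UNIV :: 'k::t2_space set)"
      and m: "metrizable_space (euclidean :: 'k topology)"
  shows "\<exists>\<B> :: 'k set set. countable \<B> \<and> (\<forall>B\<in>\<B>. open B) \<and>
    (\<forall>U x. open U \<longrightarrow> x \<in> U \<longrightarrow> (\<exists>B\<in>\<B>. x \<in> B \<and> B \<subseteq> U))"
proof -
  obtain M d where "Metric_space M d" and e: "(euclidean :: 'k topology) =
      Metric_space.mtopology M d"
    using m by (auto simp: metrizable_space_def)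
  then interpret Metric_space M d by simp
  have M: "M = UNIV" using topspace_mtopology unfolding e[symmetric] by simp
  have ob: "open (mball x r)" for x r using openin_mball[of x r] unfolding e[symmetric] by simp
  have "\<exists>I. finite I \<and> (UNIV :: 'k set) \<subseteq> (\<Union>x\<in>I. mball x (1 / real (Suc n)))" for n
  proof -
    have "x \<in> mball x (1 / real (Suc n))" for x
        by (rule centre_in_mball_iff[THEN iffD2]) (simp add: M)
    then have "UNIV \<subseteq> (\<Union>x\<in>UNIV. mball x (1 / real (Suc n)))" by blast
    from compactE_image[OF K _ this] ob show ?thesis by metis
  qed
  then obtain I where I: "\<And>n. finite (I n)" "\<And>n. (UNIV :: 'k set) \<subseteq> (\<Union>x\<in>I n. mball x (1 / real
      (Suc n)))"
    by metis
  define \<B> where "\<B> = (\<Union>n. (\<lambda>x. mball x (1 / real (Suc n))) ` I n)"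
  show ?thesis
  proof (intro exI[of _ \<B>] conjI ballI allI impI)
    show "countable \<B>"
      unfolding \<B>_def by (rule countable_UN) (auto intro!: countable_image countable_finite I(1))
    show "open B" if "B \<in> \<B>" for B using that ob by (auto simp: \<B>_def)
    fix U :: "'k set" and x assume U: "open U" "x \<in> U"
    then have "openin mtopology U" unfolding e[symmetric] by simp
    with U(2) obtain r where r: "r > 0" "mball x r \<subseteq> U" by (auto simp: openin_mtopology)
    obtain n where n: "1 / real (Suc n) < r / 2" using r nat_approx_posE[of "r / 2"] by auto
    obtain z where z: "z \<in> I n" "x \<in> mball z (1 / real (Suc n))" using I(2)[of n] by blast
    have "mball z (1 / real (Suc n)) \<subseteq> mball x r"
    proof
      fix w assume w: "w \<in> mball z (1 / real (Suc n))"
      have inM: "v \<in> M" for v by (simp add: M)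
      have "d x w \<le> d x z + d z w" by (rule triangle) (rule inM)+
      moreover have "d z w < 1 / real (Suc n)" "d z x < 1 / real (Suc n)"
        using w z(2) unfolding in_mball by blast+
      ultimately have "d x w < r" using n commute[of x z] by linarith
      then show "w \<in> mball x r" unfolding in_mball using inM by blast
    qed
    then show "\<exists>B\<in>\<B>. x \<in> B \<and> B \<subseteq> U" using z r(2) unfolding \<B>_def by blast
  qed
qed

lemma real_invariant_mean:
  fixes m :: "('s::{semigroup_mult,topological_space} \<Rightarrow>\<^sub>C complex) \<Rightarrow>\<^sub>L complex"
  assumes m: "invariant_mean m" and S: "semitopological_semigroup TYPE('s)"
  defines "mean \<equiv> \<lambda>\<phi> :: 's \<Rightarrow> real. Re (blinfun_apply m (cplx \<phi>))"
  shows "bounded_cont \<phi> \<Longrightarrow> bounded_cont \<psi> \<Longrightarrow> mean (\<lambda>s. \<phi> s + \<psi> s) = mean \<phi> + mean \<psi>"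
    and "bounded_cont \<phi> \<Longrightarrow> mean (\<lambda>s. c * \<phi> s) = c * mean \<phi>"
    and "bounded_cont \<phi> \<Longrightarrow> (\<And>s. 0 \<le> \<phi> s) \<Longrightarrow> 0 \<le> mean \<phi>"
    and "mean (\<lambda>s. 1) = 1"
    and "bounded_cont \<phi> \<Longrightarrow> mean (\<lambda>t. \<phi> (s * t)) = mean \<phi>"
    and "bounded_cont \<phi> \<Longrightarrow> mean (\<lambda>t. \<phi> (t * s)) = mean \<phi>"
proof -
  have ap: "apply_bcontfun (cplx \<phi>) s = complex_of_real (\<phi> s)" if \<phi>: "bounded_cont \<phi>"
      for \<phi> :: "'s \<Rightarrow> real" and s
  proof -
    obtain B where B: "\<And>s. \<bar>\<phi> s\<bar> \<le> B" using \<phi> by blast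
    have "(\<lambda>s. complex_of_real (\<phi> s)) \<in> bcontfun"
      by (rule bcontfun_normI[of _ B]) (use \<phi> B in \<open>auto intro!: continuous_intros\<close>)
    then show ?thesis by (simp add: cplx_def Bcontfun_inverse)
  qed
  have cm: "continuous_on UNIV (\<lambda>t::'s. s * t)" "continuous_on UNIV (\<lambda>t::'s. t * s)" for s
    using S by (auto simp: semitopological_semigroup_def)
  have bt: "bounded_cont (\<lambda>t. \<phi> (s * t))" "bounded_cont (\<lambda>t. \<phi> (t * s))" if \<phi>: "bounded_cont \<phi>"
      for \<phi> :: "'s \<Rightarrow> real" and s
  proof -
    obtain B where B: "\<And>s. \<bar>\<phi> s\<bar> \<le> B" using \<phi> by blast
    have "cont (\<lambda>t. \<phi> (s * t))" "cont (\<lambda>t. \<phi> (t * s))"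
      using \<phi> by (auto intro: continuous_on_compose2[OF _ cm(1)] continuous_on_compose2[OF _ cm(2)])
    then show "bounded_cont (\<lambda>t. \<phi> (s * t))" "bounded_cont (\<lambda>t. \<phi> (t * s))" using B by blast+
  qed
  show "mean (\<lambda>s. \<phi> s + \<psi> s) = mean \<phi> + mean \<psi>" if "bounded_cont \<phi>" "bounded_cont \<psi>" for \<phi> \<psi>
  proof -
    have "cplx (\<lambda>s. \<phi> s + \<psi> s) = cplx \<phi> + cplx \<psi>"
      by (rule bcontfun_eqI) (simp add: ap[OF bounded_cont_add[OF that]] ap that
          plus_bcontfun.rep_eq)
    then show ?thesis by (simp add: mean_def blinfun.add_right)
  qed
  show "mean (\<lambda>s. c * \<phi> s) = c * mean \<phi>" if "bounded_cont \<phi>" for c \<phi>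
  proof -
    have "cplx (\<lambda>s. c * \<phi> s) = c *\<^sub>R cplx \<phi>"
      by (rule bcontfun_eqI) (simp only: ap[OF bounded_cont_scale[OF that]] ap[OF that]
          scaleR_bcontfun.rep_eq scaleR_conv_of_real of_real_mult)
    then show ?thesis by (simp add: mean_def blinfun.scaleR_right)
  qed
  show "0 \<le> mean \<phi>" if "bounded_cont \<phi>" "\<And>s. 0 \<le> \<phi> s" for \<phi>
  proof -
    have "\<forall>t. apply_bcontfun (cplx \<phi>) t \<in> \<real>\<^sub>\<ge>\<^sub>0" using that by (simp add: ap)
    then have "blinfun_apply m (cplx \<phi>) \<in> \<real>\<^sub>\<ge>\<^sub>0" using m by (simp add: invariant_mean_def)
    then show ?thesis by (auto simp: mean_def complex_nonneg_Reals_iff)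
  qed
  have "cplx (\<lambda>s::'s. 1) = const_bcontfun 1"
    by (rule bcontfun_eqI) (simp only: ap[OF bounded_cont_const] const_bcontfun.rep_eq of_real_1)
  then show "mean (\<lambda>s. 1) = 1" using m by (simp add: mean_def invariant_mean_def)
  show "mean (\<lambda>t. \<phi> (s * t)) = mean \<phi>" if "bounded_cont \<phi>" for \<phi> s
  proof -
    have "cplx (\<lambda>t. \<phi> (s * t)) = precomp (\<lambda>t. s * t) (cplx \<phi>)"
      by (rule bcontfun_eqI) (simp only: ap[OF bt(1)[OF that]] apply_precomp[OF cm(1)] ap[OF that])
    then show ?thesis using m by (simp add: mean_def invariant_mean_def)
  qed
  show "mean (\<lambda>t. \<phi> (t * s)) = mean \<phi>" if "bounded_cont \<phi>" for \<phi> s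
  proof -
    have "cplx (\<lambda>t. \<phi> (t * s)) = precomp (\<lambda>t. t * s) (cplx \<phi>)"
      by (rule bcontfun_eqI) (simp only: ap[OF bt(2)[OF that]] apply_precomp[OF cm(2)] ap[OF that])
    then show ?thesis using m by (simp add: mean_def invariant_mean_def)
  qed
qed

lemma tame_pointwise:
  fixes act :: "'s::{semigroup_mult,topological_space} \<Rightarrow> 'k::t2_space \<Rightarrow> 'k" and s :: "nat \<Rightarrow> 's"
  assumes dynsys: "dynamical_system act" and t: "tame act" and f: "cont f"
  shows "\<exists>r. strict_mono r \<and> (\<forall>x. convergent (\<lambda>n. f (act (s (r n)) x)))"
proof -
  have K: "compact (UNIV :: 'k set)" using dynsys by (simp add: dynamical_system_def)
  define X where "X n = apply_bcontfun (koopman act (s n) (cplx f))" for n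
  have X: "X n x = complex_of_real (f (act (s n) x))" for n x
    using f by (simp add: X_def apply_koopman[OF dynsys] cplx_def apply_Bcontfun_compact[OF K]
        continuous_on_of_real)
  have "range X \<subseteq> range (\<lambda>s. apply_bcontfun (koopman act s (cplx f)))" by (auto simp: X_def)
  then obtain r l where r: "strict_mono r" "(X \<circ> r) \<longlonglongrightarrow> l"
    using t unfolding tame_def rel_seq_compact_def by blast
  have "convergent (\<lambda>n. f (act (s (r n)) x))" for x
  proof -
    from continuous_on_tendsto_compose[OF continuous_on_product_coordinates[of x] r(2)]
    have "(\<lambda>n. (X \<circ> r) n x) \<longlonglongrightarrow> l x" by simp
    from tendsto_Re[OF this] show ?thesis by (auto simp: X convergent_def)
  qed
  with r(1) show ?thesis by blast
qed

theorem theorem5p10: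
  fixes act :: "'s::{semigroup_mult,topological_space} \<Rightarrow> 'k::t2_space \<Rightarrow> 'k"
  assumes "metric_system act"
    and "tame act"
    and "amenable TYPE('s)"
  shows
    "((\<forall>(A :: (('k \<Rightarrow>\<^sub>C complex) \<Rightarrow> ('k \<Rightarrow>\<^sub>C complex)) net_index set) le T.
         right_ergodic_net sigma_l1 (range (koopman act)) A le T \<longrightarrow>
         (\<forall>f x. \<exists>l. ((\<lambda>\<alpha>. apply_bcontfun (T \<alpha> f) x) \<longlongrightarrow> l) (net_filter A le)))
       \<longleftrightarrow> weak_star_mean_ergodic act) \<and>
     (weak_star_mean_ergodic act
       \<longleftrightarrow> (\<forall>x. \<exists>!M. minimal_set act M \<and> M \<subseteq> closure (range (\<lambda>s. act s x))))"
proof -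
  have dynsys: "dynamical_system act" and metr: "metrizable_space (euclidean :: 'k topology)"
    using assms(1) by (simp_all add: metric_system_def)
  have K: "compact (UNIV :: 'k set)" and S: "semitopological_semigroup TYPE('s)"
    using dynsys by (simp_all add: dynamical_system_def)
  obtain m :: "('s \<Rightarrow>\<^sub>C complex) \<Rightarrow>\<^sub>L complex" where m: "invariant_mean m"
    using assms(3) by (auto simp: amenable_def)
  interpret tame_action act "\<lambda>\<phi> :: 's \<Rightarrow> real. Re (blinfun_apply m (cplx \<phi>))"
  proof
    show "act (s * t) x = act s (act t x)" for s t x using dynsys
        by (simp add: dynamical_system_def)
    show "continuous_on UNIV (\<lambda>(s, x). act s x)" using dynsys by (simp add: dynamical_system_def)
    show "continuous_on UNIV (\<lambda>t::'s. s * t)" "continuous_on UNIV (\<lambda>t::'s. t * s)" for s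
      using S by (auto simp: semitopological_semigroup_def)
  qed (fact K | fact tame_pointwise[OF dynsys assms(2)] | fact real_invariant_mean[OF m S])+
  obtain \<B> :: "'k set set" where "countable \<B> \<and> (\<forall>B\<in>\<B>. open B) \<and>
    (\<forall>U x. open U \<longrightarrow> x \<in> U \<longrightarrow> (\<exists>B\<in>\<B>. x \<in> B \<and> B \<subseteq> U))"
    using compact_metrizable_countable_base[OF K metr] ..
  then have \<B>: "countable \<B>" "\<And>B. B \<in> \<B> \<Longrightarrow> open B"
      "\<And>U x. open U \<Longrightarrow> x \<in> U \<Longrightarrow> \<exists>B\<in>\<B>. x \<in> B \<and> B \<subseteq> U"
    by simp_all
  let ?i = "\<forall>(A :: (('k \<Rightarrow>\<^sub>C complex) \<Rightarrow> ('k \<Rightarrow>\<^sub>C complex)) net_index set) le T.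
         right_ergodic_net sigma_l1 (range (koopman act)) A le T \<longrightarrow>
         (\<forall>f x. \<exists>l. ((\<lambda>\<alpha>. apply_bcontfun (T \<alpha> f) x) \<longlongrightarrow> l) (net_filter A le))"
  let ?iii = "\<forall>x. \<exists>!M. minimal_set act M \<and> M \<subseteq> orbit_closure x"
  have 1: ?iii if ?i
  proof
    show "\<exists>!M. minimal_set act M \<and> M \<subseteq> orbit_closure x" for x
      by (rule unique_minimal_if_right_ergodic_nets_converge[OF that])
  qed
  have 2: ?iii if "weak_star_mean_ergodic act"
    using unique_minimal_if_weak_star_mean_ergodic[OF that] by (rule allI)
  have 3: ?i if iii: ?iii
  proof (intro allI impI)
    fix A :: "(('k \<Rightarrow>\<^sub>C complex) \<Rightarrow> ('k \<Rightarrow>\<^sub>C complex)) net_index set" and le T f x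
    assume T: "right_ergodic_net sigma_l1 (range (koopman act)) A le T"
    show "\<exists>l. ((\<lambda>\<alpha>. apply_bcontfun (T \<alpha> f) x) \<longlongrightarrow> l) (net_filter A le)"
      by (rule right_ergodic_nets_converge[OF iii[rule_format] T])
  qed
  have 4: "weak_star_mean_ergodic act" if iii: ?iii
    unfolding weak_star_mean_ergodic_def
  proof (intro allI impI ballI)
    fix A :: "((('k \<Rightarrow>\<^sub>C complex) \<Rightarrow>\<^sub>L complex) \<Rightarrow> (('k \<Rightarrow>\<^sub>C complex) \<Rightarrow>\<^sub>L complex)) net_index set"
      and le T and \<phi> :: "('k \<Rightarrow>\<^sub>C complex) \<Rightarrow>\<^sub>L complex"
    assume T: "left_ergodic_net weak_star (range (koopman_adjoint act)) A le T" and \<phi>: "\<phi> \<in> cdual"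
    show "\<exists>\<psi>. limitin weak_star (\<lambda>\<alpha>. T \<alpha> \<phi>) \<psi> (net_filter A le)"
      by (rule left_ergodic_nets_converge[OF \<B> iii[rule_format] T \<phi>])
  qed
  show ?thesis
    by (intro conjI iffI) (erule 4[OF 1], erule 3[OF 2], erule 2, erule 4)
qed

end
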